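(* Let $d\in\{1,2,3\}$, let $Y$ be the unit cell with $|Y|=1$, let $G,\rho$ be $Y$-periodic coefficients as in the context, and let $\hat{\boldsymbol k}\in\mathbb R^d$, $\hat\omega\in\mathbb R$ be fixed and such that $\boldsymbol\mu^{(0)}:(i\hat{\boldsymbol k})^2+\rho_0\hat\omega^2\neq 0$. In the long-wavelength, low-frequency regime $\boldsymbol k=\epsilon\hat{\boldsymbol k}$, $\omega=\epsilon\hat\omega$, $\epsilon\to 0$, let $\tilde Z^e_2$ be the second-order (i.e. $O(\epsilon^4)$) approximation of the Willis effective impedance $\tilde Z^e=1/\langle\tilde w\rangle$ defined in the context, and let $$\tilde{\mathcal Z}^e_2=\epsilon^2\big(\boldsymbol\mu^{(0)}:(i\hat{\boldsymbol k})^2+\rho_0\hat\omega^2\big)+\epsilon^4\big(\boldsymbol\mu^{(2)}:(i\hat{\boldsymbol k})^4+\boldsymbol\rho^{(2)}:(i\hat{\boldsymbol k})^2\,\hat\omega^2\big)$$ be its counterpart obtained by two-scale homogenization. Then $\tilde Z^e_2$ and $\tilde{\mathcal Z}^e_2$ differ by the factor $$\tilde M_2=-1-\epsilon^2\Big(\big\langle G(\nabla\boldsymbol\eta^{(1)}+\boldsymbol I\,\eta^{(0)})\big\rangle:(i\hat{\boldsymbol k})^2+\langle\rho\,\eta^{(0)}\rangle\,\hat\omega^2\Big),$$ a polynomial in $\boldsymbol k$ and $\omega$, in the sense that $$\tilde Z^e_2=\tilde M_2^{-1}\,\tilde{\mathcal Z}^e_2$$ up to and including the $O(\epsilon^4)$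 term, i.e. $\tilde Z^e_2-\tilde M_2^{-1}\tilde{\mathcal Z}^e_2=o(\epsilon^4)$ as $\epsilon\to0$.
   Context: **Setting.** $Y=\{\boldsymbol x\in\mathbb R^d:0<x_j<\ell_j,\ j=1,\dots,d\}$; $G,\rho$ are real-valued, $Y$-periodic, in $L^\infty(Y)$ and bounded below by a positive constant. $\langle g\rangle=|Y|^{-1}\int_Y g$. $H^1_p(Y)$ is the space of $g\in L^2(Y)$ with $\nabla g\in L^2(Y)^d$ and $g|_{x_j=0}=g|_{x_j=\ell_j}$, $j=1,\dots,d$. All differential equations below are posed in $Y$ with periodic boundary conditions: the unknown is in $H^1_p(Y)$ (componentwise) and the flux appearing under the outer divergence is periodic; equivalently, they hold weakly against all test functions in $H^1_p(Y)$. **Tensor conventions.** For a tensor field $\boldsymbol g$, $\nabla\boldsymbol g=\boldsymbol e_j\otimes\partial\boldsymbol g/\partial x_j$ (the derivative index comes first), and $\nabla\cdot$ contracts with the first index. $\boldsymbol I$ is the second-order identity. $(i\hat{\boldsymbol k})^n=i\hat{\boldsymbol k}\otimes\dots\otimes i\hat{\boldsymbol k}$ ($n$ times), and ":" is full contraction of two $n$th-order tensors, without complex conjugation. $\{\boldsymbol\tau\}$ denotes the average of $\boldsymbol\tau$ over all permutations of its indices, and $\{\boldsymbol\tau\}'$ the average over all permutations of all indices except the first. **Willis impedance.** $\tilde w\in H^1_p(Y)$ solves $-\omega^2\rho\tilde w-\nabla_{\boldsymbol k}\cdot(G\nabla_{\boldsymbol k}\tilde w)=1$, $\nabla_{\boldsymbol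 k}=\nabla+i\boldsymbol k$, and $\tilde Z^e=1/\langle\tilde w\rangle$. **Second-order approximation.** Inserting $\boldsymbol k=\epsilon\hat{\boldsymbol k}$, $\omega=\epsilon\hat\omega$ and the formal expansion $\tilde w=\epsilon^{-2}\tilde w_0+\epsilon^{-1}\tilde w_1+\tilde w_2+\epsilon\tilde w_3+\epsilon^2\tilde w_4+\cdots$ gives, with $\tilde w_{-1}=\tilde w_{-2}=0$ and for $m=0,1,\dots,4$, $$-\nabla\cdot\big(G(\nabla\tilde w_m+i\hat{\boldsymbol k}\,\tilde w_{m-1})\big)-i\hat{\boldsymbol k}\cdot G(\nabla\tilde w_{m-1}+i\hat{\boldsymbol k}\,\tilde w_{m-2})-\hat\omega^2\rho\,\tilde w_{m-2}=\delta_{m2},$$ where $\tilde w_m\in H^1_p(Y)$ and the flux $G(\nabla\tilde w_m+i\hat{\boldsymbol k}\tilde w_{m-1})$ is periodic. Set $w_m=\langle\tilde w_m\rangle$ (the $w_0,w_1,w_2$ are determined by this hierarchy, and $w_1=0$). Then $$\tilde Z^e_2=\frac{\epsilon^2}{w_0+\epsilon^2w_2}.$$ **Cell functions** (unique zero-mean periodic solutions): - $\boldsymbol\chi^{(1)}$ (vector): $\nabla\cdot(G(\nabla\boldsymbol\chi^{(1)}+\boldsymbol I))=0$. - $\boldsymbol\chi^{(2)}$ (2nd order): $\nabla\cdot\big(G(\nabla\boldsymbol\chi^{(2)}+\{\boldsymbol I\otimes\boldsymbol\chi^{(1)}\}')\big)+G(\{\nabla\boldsymbol\chi^{(1)}\}+\boldsymbol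 I)-\frac{\rho}{\rho_0}\boldsymbol\mu^{(0)}=0$. - $\boldsymbol\chi^{(3)}$ (3rd order): $\nabla\cdot\big(G(\nabla\boldsymbol\chi^{(3)}+\{\boldsymbol I\otimes\boldsymbol\chi^{(2)}\}')\big)+G(\{\nabla\boldsymbol\chi^{(2)}\}+\{\boldsymbol I\otimes\boldsymbol\chi^{(1)}\})-\frac1{\rho_0}\{\rho\boldsymbol\chi^{(1)}\otimes\boldsymbol\mu^{(0)}\}=0$. - $\eta^{(0)}$ (scalar): $\nabla\cdot(G\nabla\eta^{(0)})=\frac{\rho-\rho_0}{\rho_0}$. - $\boldsymbol\eta^{(1)}$ (vector): $\nabla\cdot\big(G(\nabla\boldsymbol\eta^{(1)}+\boldsymbol I\eta^{(0)})\big)+G\nabla\eta^{(0)}-\frac{\rho\boldsymbol\chi^{(1)}}{\rho_0}=\boldsymbol 0$. **Coefficients.** $\rho_0=\langle\rho\rangle$, $\boldsymbol\mu^{(0)}=\{\langle G(\nabla\boldsymbol\chi^{(1)}+\boldsymbol I)\rangle\}$, $\boldsymbol\rho^{(2)}=\langle\rho\boldsymbol\chi^{(2)}\rangle$, $\boldsymbol\mu^{(2)}=\{\langle G(\nabla\boldsymbol\chi^{(3)}+\boldsymbol I\otimes\boldsymbol\chi^{(2)})\rangle\}$. *)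

theory Defs
  imports
    "HOL-Analysis.Analysis"
    "HOL-Combinatorics.Permutations"
    "HOL-Library.Landau_Symbols"
begin

section \<open>Sobolev spaces on the unit cell\<close>

text \<open>
  The unit cell with side lengths \<open>l $ j\<close> is \<open>box 0 l\<close>.  All fields are complex valued and are
  understood as representatives of almost-everywhere classes.
\<close>

definition mean :: "real^'d::finite \<Rightarrow> (real^'d \<Rightarrow> 'a::{banach, second_countable_topology}) \<Rightarrow> 'a" where
  "mean l g = (1 / measure lebesgue (box 0 l)) *\<^sub>R (LINT x|lebesgue_on (box 0 l). g x)"

definition in_L2 :: "real^'d::finite \<Rightarrow> (real^'d \<Rightarrow> complex) \<Rightarrow> bool" where
  "in_L2 l g \<longleftrightarrow> g \<in> borel_measurable (lebesgue_on (box 0 l)) \<and>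
     integrable (lebesgue_on (box 0 l)) (\<lambda>x. (norm (g x))\<^sup>2)"

definition L2_dist_sq :: "real^'d::finite \<Rightarrow> (real^'d \<Rightarrow> complex) \<Rightarrow> (real^'d \<Rightarrow> complex) \<Rightarrow> real" where
  "L2_dist_sq l g h = (LINT x|lebesgue_on (box 0 l). (norm (g x - h x))\<^sup>2)"

definition partial_deriv :: "'d::finite \<Rightarrow> (real^'d \<Rightarrow> complex) \<Rightarrow> real^'d \<Rightarrow> complex" where
  "partial_deriv j \<phi> = (\<lambda>x. frechet_derivative \<phi> (at x) (axis j 1))"

text \<open>
  Differentiability of every iterated partial derivative gives their continuity, so this is
  the class of infinitely differentiable functions on the whole space.
\<close>

definition smooth :: "(real^'d::finite \<Rightarrow> complex) \<Rightarrow> bool" where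
  "smooth \<phi> \<longleftrightarrow> (\<forall>js x. foldr partial_deriv js \<phi> differentiable (at x))"

definition weak_gradient ::
  "real^'d::finite \<Rightarrow> (real^'d \<Rightarrow> complex) \<Rightarrow> (real^'d \<Rightarrow> complex^'d) \<Rightarrow> bool" where
  "weak_gradient l g v \<longleftrightarrow> (\<forall>\<phi>. smooth \<phi> \<and> closure {x. \<phi> x \<noteq> 0} \<subseteq> box 0 l \<longrightarrow>
     (\<forall>j. (LINT x|lebesgue_on (box 0 l). g x * partial_deriv j \<phi> x) =
          - (LINT x|lebesgue_on (box 0 l). v x $ j * \<phi> x)))"

definition in_H1 :: "real^'d::finite \<Rightarrow> (real^'d \<Rightarrow> complex) \<Rightarrow> bool" where
  "in_H1 l g \<longleftrightarrow> in_L2 l g \<and> (\<exists>v. (\<forall>j. in_L2 l (\<lambda>x. v x $ j)) \<and> weak_gradient l g v)"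

text \<open>The choice is unique up to null sets whenever \<open>in_H1 l g\<close> holds.\<close>

definition grad :: "real^'d::finite \<Rightarrow> (real^'d \<Rightarrow> complex) \<Rightarrow> real^'d \<Rightarrow> complex^'d" where
  "grad l g = (SOME v. (\<forall>j. in_L2 l (\<lambda>x. v x $ j)) \<and> weak_gradient l g v)"

definition set_coord :: "'d::finite \<Rightarrow> real \<Rightarrow> real^'d \<Rightarrow> real^'d" where
  "set_coord j c x = (\<chi> i. if i = j then c else x $ i)"

text \<open>
  The trace on the face \<open>x $ j = c\<close> is the continuous extension of the restriction of smooth
  functions, as an element of \<open>L\<^sup>2\<close> of the face.  A function on the face is encoded as a function
  \<open>t\<close> of the remaining coordinates (the \<open>j\<close>-th coordinate is set to \<open>0\<close> before evaluating \<open>t\<close>).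
  By Fubini, integrating such a function over the cell gives the integral over the face times
  the constant \<open>l $ j\<close>, so convergence in \<open>L\<^sup>2\<close> of the face is expressed by integrals over the cell.
\<close>

definition has_trace ::
  "real^'d::finite \<Rightarrow> (real^'d \<Rightarrow> complex) \<Rightarrow> 'd \<Rightarrow> real \<Rightarrow> (real^'d \<Rightarrow> complex) \<Rightarrow> bool" where
  "has_trace l g j c t \<longleftrightarrow> in_L2 l (\<lambda>x. t (set_coord j 0 x)) \<and>
     (\<exists>\<phi> :: nat \<Rightarrow> real^'d \<Rightarrow> complex. (\<forall>n. smooth (\<phi> n)) \<and>
        (\<lambda>n. L2_dist_sq l (\<phi> n) g) \<longlonglongrightarrow> 0 \<and>
        (\<forall>i. (\<lambda>n. L2_dist_sq l (partial_deriv i (\<phi> n)) (\<lambda>x. grad l g x $ i)) \<longlonglongrightarrow> 0) \<and>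
        (\<lambda>n. L2_dist_sq l (\<lambda>x. \<phi> n (set_coord j c x)) (\<lambda>x. t (set_coord j 0 x))) \<longlonglongrightarrow> 0)"

definition in_H1p :: "real^'d::finite \<Rightarrow> (real^'d \<Rightarrow> complex) \<Rightarrow> bool" where
  "in_H1p l g \<longleftrightarrow> in_H1 l g \<and> (\<forall>j. \<exists>t. has_trace l g j 0 t \<and> has_trace l g j (l $ j) t)"

text \<open>
  Weak form of \<open>\<nabla> \<cdot> F + f = 0\<close> with periodic flux \<open>F\<close>; the pairing is bilinear (no complex
  conjugation), which is immaterial because the test space is closed under conjugation.
\<close>

definition weak_div_eq ::
  "real^'d::finite \<Rightarrow> (real^'d \<Rightarrow> 'd \<Rightarrow> complex) \<Rightarrow> (real^'d \<Rightarrow> complex) \<Rightarrow> bool" where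
  "weak_div_eq l F f \<longleftrightarrow> (\<forall>\<phi>. in_H1p l \<phi> \<longrightarrow>
     (LINT x|lebesgue_on (box 0 l). - (\<Sum>j\<in>UNIV. F x j * grad l \<phi> x $ j) + f x * \<phi> x) = 0)"

definition admissible_coeff :: "real^'d::finite \<Rightarrow> (real^'d \<Rightarrow> real) \<Rightarrow> bool" where
  "admissible_coeff l a \<longleftrightarrow>
     (\<forall>j. AE x in lebesgue. a (x + l $ j *\<^sub>R axis j 1) = a x) \<and>
     a \<in> borel_measurable (lebesgue_on (box 0 l)) \<and>
     (\<exists>C. AE x in lebesgue_on (box 0 l). \<bar>a x\<bar> \<le> C) \<and>
     (\<exists>c>0. AE x in lebesgue_on (box 0 l). c \<le> a x)"


section \<open>Tensors\<close>

text \<open>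
  A tensor of order \<open>n\<close> is given by its components, indexed by lists of length \<open>n\<close>; the values
  at lists of other lengths are irrelevant.
\<close>

type_synonym 'd tensor = "'d list \<Rightarrow> complex"

definition id_tensor :: "'d tensor" where
  "id_tensor js = (if js ! 0 = js ! 1 then 1 else 0)"

text \<open>Tensor product in which the first factor has order \<open>m\<close>.\<close>

definition tensor_prod :: "nat \<Rightarrow> 'd tensor \<Rightarrow> 'd tensor \<Rightarrow> 'd tensor" where
  "tensor_prod m S T js = S (take m js) * T (drop m js)"

definition tensor_sym :: "'d tensor \<Rightarrow> 'd tensor" where
  "tensor_sym T js = (\<Sum>p | p permutes {..<length js}. T (permute_list p js)) / fact (length js)"

text \<open>Average over the permutations of all indices except the first.\<close>

definition tensor_sym' :: "'d tensor \<Rightarrow> 'd tensor" where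
  "tensor_sym' T js = tensor_sym (\<lambda>is. T (hd js # is)) (tl js)"

text \<open>Full contraction of a tensor of order \<open>n\<close> with \<open>(i k)\<^sup>n\<close>.\<close>

definition contract_ik :: "nat \<Rightarrow> 'd tensor \<Rightarrow> real^'d::finite \<Rightarrow> complex" where
  "contract_ik n T k = (\<Sum>js | length js = n. T js * (\<Prod>j\<leftarrow>js. \<i> * complex_of_real (k $ j)))"

definition tensor_grad ::
  "real^'d::finite \<Rightarrow> (real^'d \<Rightarrow> 'd tensor) \<Rightarrow> real^'d \<Rightarrow> 'd tensor" where
  "tensor_grad l T x js = grad l (\<lambda>y. T y (tl js)) x $ hd js"

text \<open>
  \<open>X\<close> is a zero-mean periodic tensor field of order \<open>n\<close> satisfying \<open>\<nabla> \<cdot> F + f = 0\<close>, where the flux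
  \<open>F\<close> has order \<open>n + 1\<close> and the divergence contracts its first index.
\<close>

definition cell_solution ::
  "real^'d::finite \<Rightarrow> nat \<Rightarrow> (real^'d \<Rightarrow> 'd tensor) \<Rightarrow> (real^'d \<Rightarrow> 'd tensor) \<Rightarrow>
   (real^'d \<Rightarrow> 'd tensor) \<Rightarrow> bool" where
  "cell_solution l n X F f \<longleftrightarrow> (\<forall>js. length js = n \<longrightarrow>
     in_H1p l (\<lambda>x. X x js) \<and> mean l (\<lambda>x. X x js) = 0 \<and>
     weak_div_eq l (\<lambda>x j. F x (j # js)) (\<lambda>x. f x js))"


section \<open>Cell functions and homogenized coefficients\<close>

definition is_chi1 :: "real^'d::finite \<Rightarrow> (real^'d \<Rightarrow> real) \<Rightarrow> (real^'d \<Rightarrow> 'd tensor) \<Rightarrow> bool" where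
  "is_chi1 l G chi1 \<longleftrightarrow> cell_solution l 1 chi1
     (\<lambda>x js. G x * (tensor_grad l chi1 x js + id_tensor js))
     (\<lambda>x js. 0)"

definition mu0 :: "real^'d::finite \<Rightarrow> (real^'d \<Rightarrow> real) \<Rightarrow> (real^'d \<Rightarrow> 'd tensor) \<Rightarrow> 'd tensor" where
  "mu0 l G chi1 = tensor_sym (\<lambda>js. mean l (\<lambda>x. G x * (tensor_grad l chi1 x js + id_tensor js)))"

definition is_chi2 ::
  "real^'d::finite \<Rightarrow> (real^'d \<Rightarrow> real) \<Rightarrow> (real^'d \<Rightarrow> real) \<Rightarrow> (real^'d \<Rightarrow> 'd tensor) \<Rightarrow>
   (real^'d \<Rightarrow> 'd tensor) \<Rightarrow> bool" where
  "is_chi2 l G \<rho> chi1 chi2 \<longleftrightarrow> cell_solution l 2 chi2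
     (\<lambda>x js. G x * (tensor_grad l chi2 x js + tensor_sym' (tensor_prod 2 id_tensor (chi1 x)) js))
     (\<lambda>x js. G x * (tensor_sym (tensor_grad l chi1 x) js + id_tensor js)
             - \<rho> x / mean l \<rho> * mu0 l G chi1 js)"

definition is_chi3 ::
  "real^'d::finite \<Rightarrow> (real^'d \<Rightarrow> real) \<Rightarrow> (real^'d \<Rightarrow> real) \<Rightarrow> (real^'d \<Rightarrow> 'd tensor) \<Rightarrow>
   (real^'d \<Rightarrow> 'd tensor) \<Rightarrow> (real^'d \<Rightarrow> 'd tensor) \<Rightarrow> bool" where
  "is_chi3 l G \<rho> chi1 chi2 chi3 \<longleftrightarrow> cell_solution l 3 chi3
     (\<lambda>x js. G x * (tensor_grad l chi3 x js + tensor_sym' (tensor_prod 2 id_tensor (chi2 x)) js))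
     (\<lambda>x js. G x * (tensor_sym (tensor_grad l chi2 x) js
                    + tensor_sym (tensor_prod 2 id_tensor (chi1 x)) js)
             - 1 / mean l \<rho> * tensor_sym (tensor_prod 1 (\<lambda>is. \<rho> x * chi1 x is) (mu0 l G chi1)) js)"

definition is_eta0 ::
  "real^'d::finite \<Rightarrow> (real^'d \<Rightarrow> real) \<Rightarrow> (real^'d \<Rightarrow> real) \<Rightarrow> (real^'d \<Rightarrow> complex) \<Rightarrow> bool" where
  "is_eta0 l G \<rho> eta0 \<longleftrightarrow> in_H1p l eta0 \<and> mean l eta0 = 0 \<and>
     weak_div_eq l (\<lambda>x j. G x * grad l eta0 x $ j)
       (\<lambda>x. - complex_of_real ((\<rho> x - mean l \<rho>) / mean l \<rho>))"

definition is_eta1 ::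
  "real^'d::finite \<Rightarrow> (real^'d \<Rightarrow> real) \<Rightarrow> (real^'d \<Rightarrow> real) \<Rightarrow> (real^'d \<Rightarrow> 'd tensor) \<Rightarrow>
   (real^'d \<Rightarrow> complex) \<Rightarrow> (real^'d \<Rightarrow> 'd tensor) \<Rightarrow> bool" where
  "is_eta1 l G \<rho> chi1 eta0 eta1 \<longleftrightarrow> cell_solution l 1 eta1
     (\<lambda>x js. G x * (tensor_grad l eta1 x js + id_tensor js * eta0 x))
     (\<lambda>x js. G x * grad l eta0 x $ hd js - \<rho> x * chi1 x js / mean l \<rho>)"

definition rho2 ::
  "real^'d::finite \<Rightarrow> (real^'d \<Rightarrow> real) \<Rightarrow> (real^'d \<Rightarrow> 'd tensor) \<Rightarrow> 'd tensor" where
  "rho2 l \<rho> chi2 js = mean l (\<lambda>x. \<rho> x * chi2 x js)"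

definition mu2 ::
  "real^'d::finite \<Rightarrow> (real^'d \<Rightarrow> real) \<Rightarrow> (real^'d \<Rightarrow> 'd tensor) \<Rightarrow> (real^'d \<Rightarrow> 'd tensor) \<Rightarrow>
   'd tensor" where
  "mu2 l G chi2 chi3 = tensor_sym (\<lambda>js. mean l (\<lambda>x.
     G x * (tensor_grad l chi3 x js + tensor_prod 2 id_tensor (chi2 x) js)))"

text \<open>The mean flux of \<open>eta1\<close>, which enters the factor between the two impedances.\<close>

definition eta1_flux ::
  "real^'d::finite \<Rightarrow> (real^'d \<Rightarrow> real) \<Rightarrow> (real^'d \<Rightarrow> complex) \<Rightarrow> (real^'d \<Rightarrow> 'd tensor) \<Rightarrow>
   'd tensor" where
  "eta1_flux l G eta0 eta1 js =
     mean l (\<lambda>x. G x * (tensor_grad l eta1 x js + id_tensor js * eta0 x))"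


section \<open>Impedances\<close>

text \<open>
  The hierarchy obtained from the formal expansion of the Willis problem
  \<open>- \<omega>\<^sup>2 \<rho> w - (\<nabla> + i k) \<cdot> (G (\<nabla> + i k) w) = 1\<close> with \<open>k = \<epsilon> khat\<close> and \<open>\<omega> = \<epsilon> what\<close>.
\<close>

definition willis_hierarchy ::
  "real^'d::finite \<Rightarrow> (real^'d \<Rightarrow> real) \<Rightarrow> (real^'d \<Rightarrow> real) \<Rightarrow> real^'d \<Rightarrow> real \<Rightarrow>
   (int \<Rightarrow> real^'d \<Rightarrow> complex) \<Rightarrow> bool" where
  "willis_hierarchy l G \<rho> khat what w \<longleftrightarrow>
     w (-1) = (\<lambda>x. 0) \<and> w (-2) = (\<lambda>x. 0) \<and>
     (\<forall>m\<in>{0..4}. in_H1p l (w m) \<and>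
        weak_div_eq l
          (\<lambda>x j. G x * (grad l (w m) x $ j + \<i> * khat $ j * w (m - 1) x))
          (\<lambda>x. (\<Sum>j\<in>UNIV. \<i> * khat $ j *
                   (G x * (grad l (w (m - 1)) x $ j + \<i> * khat $ j * w (m - 2) x)))
               + what\<^sup>2 * \<rho> x * w (m - 2) x + (if m = 2 then 1 else 0)))"

definition willis_impedance_2 ::
  "real^'d::finite \<Rightarrow> (int \<Rightarrow> real^'d \<Rightarrow> complex) \<Rightarrow> real \<Rightarrow> complex" where
  "willis_impedance_2 l w \<epsilon> = \<epsilon>\<^sup>2 / (mean l (w 0) + \<epsilon>\<^sup>2 * mean l (w 2))"

definition two_scale_impedance_2 ::
  "real^'d::finite \<Rightarrow> (real^'d \<Rightarrow> real) \<Rightarrow> (real^'d \<Rightarrow> real) \<Rightarrow> (real^'d \<Rightarrow> 'd tensor) \<Rightarrow>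
   (real^'d \<Rightarrow> 'd tensor) \<Rightarrow> (real^'d \<Rightarrow> 'd tensor) \<Rightarrow> real^'d \<Rightarrow> real \<Rightarrow> real \<Rightarrow> complex" where
  "two_scale_impedance_2 l G \<rho> chi1 chi2 chi3 khat what \<epsilon> =
     \<epsilon>\<^sup>2 * (contract_ik 2 (mu0 l G chi1) khat + mean l \<rho> * what\<^sup>2) +
     \<epsilon>^4 * (contract_ik 4 (mu2 l G chi2 chi3) khat + contract_ik 2 (rho2 l \<rho> chi2) khat * what\<^sup>2)"

definition impedance_factor ::
  "real^'d::finite \<Rightarrow> (real^'d \<Rightarrow> real) \<Rightarrow> (real^'d \<Rightarrow> real) \<Rightarrow> (real^'d \<Rightarrow> complex) \<Rightarrow>
   (real^'d \<Rightarrow> 'd tensor) \<Rightarrow> real^'d \<Rightarrow> real \<Rightarrow> complex" where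
  "impedance_factor l G \<rho> eta0 eta1 k \<omega> =
     - 1 - (contract_ik 2 (eta1_flux l G eta0 eta1) k + mean l (\<lambda>x. \<rho> x * eta0 x) * \<omega>\<^sup>2)"

end

(* After contraction with powers of i khat the cell problems become scalar, and the hierarchy is
   solved by w_0 = c_0, w_1 = c_0 X_1, w_2 = c_0 X_2 + eta_0 + c_2, w_3 = c_0 X_3 + E_1 + c_2 X_1 + c_3,
   where X_n and E_1 are the contractions of the cell functions chi and eta1.  The constants are
   fixed by the solvability conditions two orders later: c_0 sigma = -1 and
   c_2 sigma = -(c_0 A + B), where sigma and A are the coefficients of the two-scale impedance and
   M_2 = -1 - eps^2 B.  Then 1 + eps^2 B + (sigma + eps^2 A)(c_0 + eps^2 c_2) = eps^4 A c_2, so that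
   the two impedances differ by O(eps^6).
   The analytic input is the uniqueness of the periodic cell problem: weak gradients are unique up
   to null sets, test functions may be conjugated, and a function in H^1 with zero gradient is
   constant because of a Poincare inequality for its smooth approximations. *)

theory Submission
  imports Defs "HOL-Real_Asymp.Real_Asymp"
begin

section \<open>Smooth functions and cutoffs\<close>

text \<open>The tensor (i khat)^n is symmetric, so averages over permutations, whether of all
  indices or of all but the first, disappear after contraction; this is what makes the symmetrized
  cell problems collapse to scalar ones. The functions eta come from the unit source. At order two
  the source is c_0 K + omega^2 rho c_0 + 1, and c_0 sigma = -1 turns omega^2 rho c_0 + 1 into -c_0
  rho m_0 / rho_0 + (1 - rho / rho_0), where m_0 is the contraction of mu^(0). The first part
  belongs to the problem of chi^(2), the second is the source of eta_0. The same relation splits the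
  source at order three between chi^(3) and eta1. The leading -1 of M_2 is the sign in 1 / c_0 =
  -sigma. For uniqueness, membership in \<open>in_H1p\<close> already carries smooth functions
  converging in H^1 on the cell, so an inequality for smooth functions is enough. It is taken in the
  form of a double integral of |phi(x) - phi(y)|, which involves no mean value and passes directly
  to the limit in L^1.\<close>

lemma smooth_partial_deriv: "smooth f \<Longrightarrow> smooth (partial_deriv j f)"
  unfolding smooth_def
proof (intro allI)
  fix js x assume "\<forall>js x. foldr partial_deriv js f differentiable at x"
  then have "foldr partial_deriv (js @ [j]) f differentiable at x" by blast
  then show "foldr partial_deriv js (partial_deriv j f) differentiable at x" by simp
qed

lemma smooth_differentiable: "smooth f \<Longrightarrow> f differentiable (at x)"
  unfolding smooth_def by (metis foldr.simps(1) id_apply)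

text \<open>Iterated derivatives need no explicit formula: it is enough to exhibit a family of
  differentiable functions that is stable under one derivative.\<close>

lemma smooth_coinduct:
  assumes "f \<in> S" "\<And>g x. g \<in> S \<Longrightarrow> g differentiable (at x)"
    and "\<And>g j. g \<in> S \<Longrightarrow> partial_deriv j g \<in> S"
  shows "smooth f"
proof -
  have "foldr partial_deriv js f \<in> S" for js
    by (induction js) (use assms in auto)
  then show ?thesis unfolding smooth_def using assms(2) by blast
qed

lemma partial_derivI:
  assumes "\<And>x. (f has_derivative D x) (at x)"
  shows "partial_deriv j f = (\<lambda>x. D x (axis j 1))"
  unfolding partial_deriv_def using frechet_derivative_at[OF assms] by metis

lemma smooth_has_derivative:
  "smooth f \<Longrightarrow> (f has_derivative frechet_derivative f (at x)) (at x)"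
  using smooth_differentiable frechet_derivative_works by blast

lemma smooth_continuous: "smooth f \<Longrightarrow> continuous_on S f"
  by (meson continuous_at_imp_continuous_on differentiable_imp_continuous_within smooth_differentiable)

lemma partial_deriv_linear:
  fixes L :: "complex \<Rightarrow> complex"
  assumes "smooth f" "bounded_linear L"
  shows "partial_deriv j (\<lambda>x. L (f x)) = (\<lambda>x. L (partial_deriv j f x))"
  using partial_derivI[of "\<lambda>x. L (f x)" "\<lambda>x h. L (frechet_derivative f (at x) h)" j]
    bounded_linear.has_derivative[OF assms(2) smooth_has_derivative[OF assms(1)]]
  by (simp add: partial_deriv_def)

lemma partial_deriv_add:
  assumes "smooth f" "smooth g"
  shows "partial_deriv j (\<lambda>x. f x + g x) = (\<lambda>x. partial_deriv j f x + partial_deriv j g x)"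
  using partial_derivI[of "\<lambda>x. f x + g x"
      "\<lambda>x h. frechet_derivative f (at x) h + frechet_derivative g (at x) h" j]
    has_derivative_add[OF smooth_has_derivative[OF assms(1)] smooth_has_derivative[OF assms(2)]]
  by (simp add: partial_deriv_def)

lemma smooth_linear:
  fixes L :: "complex \<Rightarrow> complex"
  assumes "smooth f" "bounded_linear L"
  shows "smooth (\<lambda>x. L (f x))"
proof (rule smooth_coinduct[of _ "{\<lambda>x. L (f x) |f. smooth f}"])
  fix g :: "real^'a \<Rightarrow> complex" and x j
  assume "g \<in> {\<lambda>x. L (f x) |f. smooth f}"
  then obtain f where f: "g = (\<lambda>x. L (f x))" "smooth f" by blast
  show "g differentiable at x"
    unfolding f(1) differentiable_def
    using bounded_linear.has_derivative[OF assms(2) smooth_has_derivative[OF f(2)]] by blast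
  show "partial_deriv j g \<in> {\<lambda>x. L (f x) |f. smooth f}"
    unfolding f(1) partial_deriv_linear[OF f(2) assms(2)] using smooth_partial_deriv[OF f(2)] by blast
qed (use assms in blast)

lemma smooth_add:
  assumes "smooth f" "smooth g"
  shows "smooth (\<lambda>x. f x + g x)"
proof (rule smooth_coinduct[of _ "{\<lambda>x. f x + g x |f g. smooth f \<and> smooth g}"])
  fix h :: "real^'a \<Rightarrow> complex" and x j
  assume "h \<in> {\<lambda>x. f x + g x |f g. smooth f \<and> smooth g}"
  then obtain f g where f: "h = (\<lambda>x. f x + g x)" "smooth f" "smooth g" by blast
  show "h differentiable at x"
    unfolding f(1) using f(2,3) by (intro differentiable_add smooth_differentiable)
  show "partial_deriv j h \<in> {\<lambda>x. f x + g x |f g. smooth f \<and> smooth g}"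
    unfolding f(1) partial_deriv_add[OF f(2,3)]
    using smooth_partial_deriv[OF f(2)] smooth_partial_deriv[OF f(3)] by blast
qed (use assms in blast)

lemma partial_deriv_const: "partial_deriv j (\<lambda>x. a) = (\<lambda>x. 0)"
  using partial_derivI[of "\<lambda>x. a" "\<lambda>x h. 0" j] by simp

lemma smooth_const: "smooth (\<lambda>x. a)"
  by (rule smooth_coinduct[of _ "range (\<lambda>a x. a)"]) (auto simp: partial_deriv_const)

text \<open>For \<open>p = 1\<close> this is the usual flat function; the polynomial makes the family closed under
  differentiation.\<close>

definition flat :: "real poly \<Rightarrow> real \<Rightarrow> real" where
  "flat p t = (if t > 0 then poly p (1 / t) * exp (- (1 / t)) else 0)"

text \<open>With u = 1 / t this is the decay of \<open>flat p\<close> at the origin from the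
  right.\<close>

lemma poly_exp_decay: "((\<lambda>u. poly p u * exp (- u)) \<longlongrightarrow> (0::real)) at_top"
proof -
  have "((\<lambda>u. \<Sum>i\<le>degree p. coeff p i * (u ^ i / exp u)) \<longlongrightarrow> (\<Sum>i\<le>degree p. coeff p i * 0)) at_top"
    by (intro tendsto_intros tendsto_power_div_exp_0)
  then show ?thesis
    by (simp add: poly_altdef sum_distrib_right exp_minus divide_inverse mult.assoc)
qed

lemma flat_tendsto: "(flat p \<longlongrightarrow> 0) (at 0)"
proof -
  have "((\<lambda>t. poly p (1 / t) * exp (- (1 / t))) \<longlongrightarrow> 0) (at_right 0)"
    using filterlim_compose[OF poly_exp_decay filterlim_inverse_at_top_right]
    by (simp add: inverse_eq_divide)
  then have "(flat p \<longlongrightarrow> 0) (at_right 0)"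
    by (rule Lim_transform_eventually) (auto simp: flat_def eventually_at_filter)
  moreover have "(flat p \<longlongrightarrow> 0) (at_left 0)"
    by (rule tendsto_eventually) (auto simp: flat_def eventually_at_filter)
  ultimately show ?thesis
    by (simp add: filterlim_split_at)
qed

lemma flat_deriv:
  "(flat p has_real_derivative flat (monom 1 2 * (p - pderiv p)) t) (at t)"
proof -
  consider "t > 0" | "t < 0" | "t = 0" by linarith
  then show ?thesis
  proof cases
    case 1
    have "((\<lambda>t. poly p (1 / t) * exp (- (1 / t))) has_real_derivative
        flat (monom 1 2 * (p - pderiv p)) t) (at t)"
      using 1 by (auto intro!: derivative_eq_intros poly_DERIV[THEN DERIV_chain2]
          simp: flat_def poly_monom field_simps power2_eq_square)
    then show ?thesis
      by (rule has_field_derivative_transform_within_open[of _ _ _ "{0<..}"])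
        (use 1 in \<open>auto simp: flat_def\<close>)
  next
    case 2
    have "((\<lambda>t. 0) has_real_derivative flat (monom 1 2 * (p - pderiv p)) t) (at t)"
      using 2 by (auto simp: flat_def)
    then show ?thesis
      by (rule has_field_derivative_transform_within_open[of _ _ _ "{..<0}"])
        (use 2 in \<open>auto simp: flat_def\<close>)
  next
    case 3
    \<comment> \<open>The difference quotient at 0 is again flat: division by h multiplies the
      polynomial in 1 / h by its variable.\<close>
    have "((\<lambda>h. (flat p (0 + h) - flat p 0) / h) \<longlongrightarrow> 0) (at 0)"
      by (rule Lim_transform_eventually[OF flat_tendsto[of "monom 1 1 * p"]])
        (auto simp: flat_def poly_monom eventually_at_filter)
    then show ?thesis using 3 by (simp add: DERIV_def flat_def)
  qed
qed

inductive_set flat_algebra :: "(real^'d::finite \<Rightarrow> complex) set" where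
  const: "(\<lambda>x. a) \<in> flat_algebra"
| flat: "(\<lambda>x. of_real (flat p (c * x $ i + d))) \<in> flat_algebra"
| add: "f \<in> flat_algebra \<Longrightarrow> g \<in> flat_algebra \<Longrightarrow> (\<lambda>x. f x + g x) \<in> flat_algebra"
| mult: "f \<in> flat_algebra \<Longrightarrow> g \<in> flat_algebra \<Longrightarrow> (\<lambda>x. f x * g x) \<in> flat_algebra"

text \<open>The derivative is produced together with its membership in the algebra, so that one
  induction serves both the differentiability and the stability demanded by
  \<open>smooth_coinduct\<close>.\<close>

lemma flat_algebra_has_derivative:
  assumes "f \<in> flat_algebra"
  shows "\<exists>D. (\<forall>x. (f has_derivative D x) (at x)) \<and> (\<forall>j. (\<lambda>x. D x (axis j 1)) \<in> flat_algebra)"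
  using assms
proof induction
  case (const a)
  show ?case by (rule exI[of _ "\<lambda>_ _. 0"]) (auto intro: flat_algebra.const)
next
  case (flat p c i d)
  let ?q = "monom 1 2 * (p - pderiv p)"
  have "((\<lambda>x. complex_of_real (flat p (c * x $ i + d))) has_derivative
      (\<lambda>h. complex_of_real (c * h $ i * flat ?q (c * x $ i + d)))) (at x)" for x
  proof -
    have "((\<lambda>x::real^'a. c * x $ i + d) has_derivative (\<lambda>h. c * h $ i)) (at x)"
      by (auto intro!: derivative_eq_intros bounded_linear.has_derivative[OF bounded_linear_vec_nth])
    from DERIV_compose_FDERIV[OF flat_deriv this]
    show ?thesis by (rule has_derivative_of_real)
  qed
  moreover have "(\<lambda>x. complex_of_real (c * axis j 1 $ i * flat ?q (c * x $ i + d))) \<in> flat_algebra" for j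
    using flat_algebra.mult[OF flat_algebra.const flat_algebra.flat, of "of_real (c * axis j 1 $ i)" ?q c i d]
    by simp
  ultimately show ?case by (intro exI conjI allI)
next
  case (add f g)
  then obtain D E where "\<And>x. (f has_derivative D x) (at x)" "\<And>x. (g has_derivative E x) (at x)"
    "\<And>j. (\<lambda>x. D x (axis j 1)) \<in> flat_algebra" "\<And>j. (\<lambda>x. E x (axis j 1)) \<in> flat_algebra"
    by blast
  then show ?case
    by (intro exI[of _ "\<lambda>x h. D x h + E x h"] conjI allI has_derivative_add flat_algebra.add)
next
  case (mult f g)
  then obtain D E where "\<And>x. (f has_derivative D x) (at x)" "\<And>x. (g has_derivative E x) (at x)"
    "\<And>j. (\<lambda>x. D x (axis j 1)) \<in> flat_algebra" "\<And>j. (\<lambda>x. E x (axis j 1)) \<in> flat_algebra"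
    by blast
  then show ?case using mult.hyps
    by (intro exI[of _ "\<lambda>x h. f x * E x h + D x h * g x"] conjI allI has_derivative_mult
        flat_algebra.add flat_algebra.mult)
qed

lemma flat_algebra_smooth:
  assumes "f \<in> flat_algebra" shows "smooth f"
proof (rule smooth_coinduct[OF assms])
  fix g :: "real^'a \<Rightarrow> complex" and x j
  assume "g \<in> flat_algebra"
  then obtain D where D: "\<And>x. (g has_derivative D x) (at x)" "\<And>j. (\<lambda>x. D x (axis j 1)) \<in> flat_algebra"
    using flat_algebra_has_derivative by blast
  show "g differentiable at x" using D(1) differentiable_def by blast
  show "partial_deriv j g \<in> flat_algebra" using partial_derivI[OF D(1)] D(2) by simp
qed

lemma flat_algebra_prod:
  "finite I \<Longrightarrow> (\<And>i. i \<in> I \<Longrightarrow> f i \<in> flat_algebra) \<Longrightarrow> (\<lambda>x. \<Prod>i\<in>I. f i x) \<in> flat_algebra"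
  by (induction I rule: finite_induct) (auto intro: flat_algebra.intros)

text \<open>Product cutoffs built from exp(-1/t) increase to the indicator of the box. Smoothness,
  compact support inside the box and a uniform bound are what is needed to insert them as test
  functions and pass to the limit by dominated convergence.\<close>

lemma smooth_box_indicator:
  fixes a b :: "real^'d::finite"
  obtains \<phi> :: "nat \<Rightarrow> real^'d \<Rightarrow> complex" where
    "\<And>n. smooth (\<phi> n)" "\<And>n. closure {x. \<phi> n x \<noteq> 0} \<subseteq> box a b"
    "\<And>n x. norm (\<phi> n x) \<le> 1" "\<And>x. (\<lambda>n. \<phi> n x) \<longlonglongrightarrow> indicator (box a b) x"
proof -
  define e where "e = flat 1"
  have e: "0 \<le> e t" "e t \<le> 1" "t \<le> 0 \<Longrightarrow> e t = 0" for t
    by (auto simp: e_def flat_def)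
  define r where "r n = real (Suc n)" for n
  \<comment> \<open>The shift by -1 keeps the support at distance \<open>1 / r n\<close> from every
    face, so that its closure stays inside the open box; as \<open>r n\<close> grows, the argument
    tends to infinity at interior points, where \<open>e\<close> tends to 1.\<close>
  define \<psi> where "\<psi> n x = (\<Prod>j\<in>UNIV. e (r n * (x $ j - a $ j) - 1) * e (r n * (b $ j - x $ j) - 1))"
    for n and x :: "real^'d"
  define \<phi> where "\<phi> n x = complex_of_real (\<psi> n x)" for n x
  have "smooth (\<phi> n)" for n
  proof -
    have "(\<lambda>x. \<Prod>j\<in>UNIV. (\<lambda>x. complex_of_real (flat 1 (r n * x $ j + (- r n * a $ j - 1))) *
        complex_of_real (flat 1 (- r n * x $ j + (r n * b $ j - 1)))) x) \<in> flat_algebra"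
      by (intro flat_algebra_prod flat_algebra.intros) auto
    also have "(\<lambda>x. \<Prod>j\<in>UNIV. (\<lambda>x. complex_of_real (flat 1 (r n * x $ j + (- r n * a $ j - 1))) *
        complex_of_real (flat 1 (- r n * x $ j + (r n * b $ j - 1)))) x) = \<phi> n"
      by (simp add: \<phi>_def \<psi>_def e_def fun_eq_iff algebra_simps)
    finally show ?thesis by (rule flat_algebra_smooth)
  qed
  moreover have "closure {x. \<phi> n x \<noteq> 0} \<subseteq> box a b" for n
  proof -
    have r: "r n > 0" by (simp add: r_def)
    have "{x. \<phi> n x \<noteq> 0} \<subseteq> cbox (\<chi> j. a $ j + 1 / r n) (\<chi> j. b $ j - 1 / r n)"
    proof
      fix x assume "x \<in> {x. \<phi> n x \<noteq> 0}"
      then have "e (r n * (x $ j - a $ j) - 1) \<noteq> 0 \<and> e (r n * (b $ j - x $ j) - 1) \<noteq> 0" for j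
        by (auto simp: \<phi>_def \<psi>_def)
      then have "r n * (x $ j - a $ j) - 1 > 0 \<and> r n * (b $ j - x $ j) - 1 > 0" for j
        using e(3) by (meson not_le)
      then show "x \<in> cbox (\<chi> j. a $ j + 1 / r n) (\<chi> j. b $ j - 1 / r n)"
        using r unfolding mem_box_cart by (auto simp: field_simps intro: less_imp_le)
    qed
    then have "closure {x. \<phi> n x \<noteq> 0} \<subseteq> cbox (\<chi> j. a $ j + 1 / r n) (\<chi> j. b $ j - 1 / r n)"
      by (intro closure_minimal closed_cbox)
    also have "\<dots> \<subseteq> box a b"
    proof
      fix x assume *: "x \<in> cbox (\<chi> j. a $ j + 1 / r n) (\<chi> j. b $ j - 1 / r n)"
      have "1 / r n > 0" using r by simp
      show "x \<in> box a b"
        unfolding mem_box_cart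
      proof
        fix j
        have "a $ j + 1 / r n \<le> x $ j" "x $ j \<le> b $ j - 1 / r n"
          using * by (auto simp: mem_box_cart)
        with \<open>1 / r n > 0\<close> show "a $ j < x $ j \<and> x $ j < b $ j" by linarith
      qed
    qed
    finally show ?thesis .
  qed
  moreover have "norm (\<phi> n x) \<le> 1" for n x
  proof -
    have "0 \<le> \<psi> n x" unfolding \<psi>_def by (intro prod_nonneg) (simp add: e)
    moreover have "\<psi> n x \<le> 1" unfolding \<psi>_def by (intro prod_le_1) (auto simp: e intro: mult_le_one)
    ultimately show ?thesis by (simp add: \<phi>_def)
  qed
  moreover have "(\<lambda>n. \<phi> n x) \<longlonglongrightarrow> indicator (box a b) x" for x
  proof -
    have lim: "(\<lambda>n. e (r n * t - 1)) \<longlonglongrightarrow> (if t > 0 then 1 else 0)" for t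
    proof (cases "t > 0")
      case True
      have top: "filterlim (\<lambda>n. r n * t - 1) at_top sequentially"
        unfolding r_def using True by real_asymp
      have "(\<lambda>n. exp (- (inverse (r n * t - 1)))) \<longlonglongrightarrow> exp (- 0)"
        by (intro tendsto_intros filterlim_compose[OF tendsto_inverse_0_at_top top] filterlim_ident)
      moreover have "\<forall>\<^sub>F n in sequentially. exp (- (inverse (r n * t - 1))) = e (r n * t - 1)"
        using filterlim_at_top_dense[THEN iffD1, OF top, rule_format, of 0]
        by eventually_elim (auto simp: e_def flat_def inverse_eq_divide)
      ultimately show ?thesis using True by (auto intro: Lim_transform_eventually)
    next
      case False
      have "r n * t - 1 \<le> 0" for n
        using False mult_nonneg_nonpos[of "r n" t] by (simp add: r_def)
      then show ?thesis using False by (simp add: e(3))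
    qed
    have "(\<lambda>n. \<psi> n x) \<longlonglongrightarrow>
        (\<Prod>j\<in>UNIV. (if x $ j - a $ j > 0 then 1 else 0) * (if b $ j - x $ j > 0 then 1 else 0))"
      unfolding \<psi>_def by (intro tendsto_intros lim)
    also have "(\<Prod>j\<in>UNIV. (if x $ j - a $ j > 0 then 1 else 0) * (if b $ j - x $ j > 0 then 1 else 0))
        = (indicator (box a b) x :: real)"
    proof (cases "x \<in> box a b")
      case True
      then show ?thesis by (simp add: mem_box_cart)
    next
      case False
      then obtain j where "\<not> (a $ j < x $ j \<and> x $ j < b $ j)" by (auto simp: mem_box_cart)
      then have "\<exists>j\<in>UNIV. (if x $ j - a $ j > 0 then 1 else 0) * (if b $ j - x $ j > 0 then 1 else 0) = (0::real)"
        by (intro bexI[of _ j]) auto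
      then show ?thesis using False by (subst prod_zero) auto
    qed
    finally have "(\<lambda>n. \<phi> n x) \<longlonglongrightarrow> complex_of_real (indicator (box a b) x)"
      unfolding \<phi>_def by (rule tendsto_of_real)
    then show ?thesis by (cases "x \<in> box a b") auto
  qed
  ultimately show ?thesis by (rule that)
qed

section \<open>Uniqueness of weak gradients\<close>

lemma finite_measure_cell: "finite_measure (lebesgue_on (box 0 (l::real^'d::finite)))"
  by (intro finite_measure_lebesgue_on lmeasurable_box)

lemma in_L2_measurable: "in_L2 l f \<Longrightarrow> f \<in> borel_measurable (lebesgue_on (box 0 l))"
  by (simp add: in_L2_def)

lemma in_L2_mult_integrable:
  assumes "in_L2 l f" "in_L2 l g"
  shows "integrable (lebesgue_on (box 0 l)) (\<lambda>x. f x * g x)"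
proof (rule Bochner_Integration.integrable_bound)
  show "integrable (lebesgue_on (box 0 l)) (\<lambda>x. (norm (f x))\<^sup>2 + (norm (g x))\<^sup>2)"
    using assms by (auto simp: in_L2_def)
  show "(\<lambda>x. f x * g x) \<in> borel_measurable (lebesgue_on (box 0 l))"
    using assms by (auto simp: in_L2_def)
  have "norm (a * b) \<le> norm ((norm a)\<^sup>2 + (norm b)\<^sup>2)" for a b :: complex
  proof -
    have "norm (a * b) \<le> 2 * norm a * norm b" by (simp add: norm_mult)
    also have "\<dots> \<le> (norm a)\<^sup>2 + (norm b)\<^sup>2" by (rule sum_squares_bound)
    finally show ?thesis by simp
  qed
  then show "AE x in lebesgue_on (box 0 l). norm (f x * g x) \<le> norm ((norm (f x))\<^sup>2 + (norm (g x))\<^sup>2)"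
    by simp
qed

lemma in_L2_bounded:
  assumes "f \<in> borel_measurable (lebesgue_on (box 0 l))"
    and "AE x in lebesgue_on (box 0 l). norm (f x) \<le> C"
  shows "in_L2 l f"
  unfolding in_L2_def
proof
  interpret finite_measure "lebesgue_on (box 0 l)" by (rule finite_measure_cell)
  show "integrable (lebesgue_on (box 0 l)) (\<lambda>x. (norm (f x))\<^sup>2)"
  proof (rule integrable_const_bound)
    show "AE x in lebesgue_on (box 0 l). norm ((norm (f x))\<^sup>2) \<le> C\<^sup>2"
      using assms(2) by eventually_elim (simp add: power_mono)
  qed (use assms in auto)
qed fact

lemma in_L2_const: "in_L2 l (\<lambda>x. a)"
  by (rule in_L2_bounded[of _ _ "norm a"]) auto

lemma in_L2_integrable: "in_L2 l f \<Longrightarrow> integrable (lebesgue_on (box 0 l)) f"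
  using in_L2_mult_integrable[of l f "\<lambda>x. 1"] in_L2_const by auto

lemma in_L2_bounded_mult:
  assumes "in_L2 l f" "g \<in> borel_measurable (lebesgue_on (box 0 l))"
    and "AE x in lebesgue_on (box 0 l). norm (g x :: complex) \<le> C"
  shows "in_L2 l (\<lambda>x. g x * f x)"
  unfolding in_L2_def
proof
  show m: "(\<lambda>x. g x * f x) \<in> borel_measurable (lebesgue_on (box 0 l))"
    using assms by (auto simp: in_L2_def)
  show "integrable (lebesgue_on (box 0 l)) (\<lambda>x. (norm (g x * f x))\<^sup>2)"
  proof (rule Bochner_Integration.integrable_bound)
    show "integrable (lebesgue_on (box 0 l)) (\<lambda>x. C\<^sup>2 * (norm (f x))\<^sup>2)"
      using assms by (auto simp: in_L2_def)
    show "(\<lambda>x. (norm (g x * f x))\<^sup>2) \<in> borel_measurable (lebesgue_on (box 0 l))"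
      using m by measurable
    show "AE x in lebesgue_on (box 0 l). norm ((norm (g x * f x))\<^sup>2) \<le> norm (C\<^sup>2 * (norm (f x))\<^sup>2)"
      using assms(3) by eventually_elim (simp add: norm_mult power_mult_distrib power_mono mult_right_mono)
  qed
qed

lemma in_L2_cmult: "in_L2 l f \<Longrightarrow> in_L2 l (\<lambda>x. a * f x)"
  by (rule in_L2_bounded_mult[of _ _ _ "norm a"]) auto

lemma norm_add_sq_le: "(norm (a + b))\<^sup>2 \<le> 2 * (norm a)\<^sup>2 + 2 * (norm (b::'a::real_normed_vector))\<^sup>2"
proof -
  have "(norm (a + b))\<^sup>2 \<le> (norm a + norm b)\<^sup>2" by (simp add: norm_triangle_ineq power_mono)
  also have "\<dots> \<le> 2 * (norm a)\<^sup>2 + 2 * (norm b)\<^sup>2"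
    using sum_squares_bound[of "norm a" "norm b"] by (simp add: power2_sum)
  finally show ?thesis .
qed

lemma in_L2_add:
  assumes "in_L2 l f" "in_L2 l g"
  shows "in_L2 l (\<lambda>x. f x + g x)"
  unfolding in_L2_def
proof
  show m: "(\<lambda>x. f x + g x) \<in> borel_measurable (lebesgue_on (box 0 l))"
    using assms by (auto simp: in_L2_def)
  show "integrable (lebesgue_on (box 0 l)) (\<lambda>x. (norm (f x + g x))\<^sup>2)"
  proof (rule Bochner_Integration.integrable_bound)
    show "integrable (lebesgue_on (box 0 l)) (\<lambda>x. 2 * (norm (f x))\<^sup>2 + 2 * (norm (g x))\<^sup>2)"
      using assms by (auto simp: in_L2_def)
    show "(\<lambda>x. (norm (f x + g x))\<^sup>2) \<in> borel_measurable (lebesgue_on (box 0 l))"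
      using m by measurable
    show "AE x in lebesgue_on (box 0 l). norm ((norm (f x + g x))\<^sup>2) \<le> norm (2 * (norm (f x))\<^sup>2 + 2 * (norm (g x))\<^sup>2)"
      using norm_add_sq_le by auto
  qed
qed

lemma in_L2_minus: "in_L2 l f \<Longrightarrow> in_L2 l (\<lambda>x. - f x)"
  using in_L2_cmult[of l f "-1"] by simp

lemma in_L2_diff: "in_L2 l f \<Longrightarrow> in_L2 l g \<Longrightarrow> in_L2 l (\<lambda>x. f x - g x)"
  using in_L2_add[of l f "\<lambda>x. - g x"] in_L2_minus[of l g] by simp

lemma in_L2_sum: "(\<And>i. i \<in> I \<Longrightarrow> in_L2 l (f i)) \<Longrightarrow> in_L2 l (\<lambda>x. \<Sum>i\<in>I. f i x)"
  by (induction I rule: infinite_finite_induct) (auto intro: in_L2_add in_L2_const)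

lemma in_L2_cnj: "in_L2 l f \<Longrightarrow> in_L2 l (\<lambda>x. cnj (f x))"
  unfolding in_L2_def
  by (auto intro: measurable_compose[OF _ borel_measurable_continuous_onI[OF continuous_on_cnj[OF continuous_on_id]]])

lemma in_L2_continuous:
  assumes "continuous_on UNIV f"
  shows "in_L2 l f"
proof -
  have "bounded (f ` cbox 0 l)"
    using assms by (meson compact_cbox compact_continuous_image compact_imp_bounded continuous_on_subset subset_UNIV)
  then obtain C where C: "\<And>x. x \<in> cbox 0 l \<Longrightarrow> norm (f x) \<le> C"
    unfolding bounded_iff by auto
  show ?thesis
  proof (rule in_L2_bounded)
    have "f \<in> borel_measurable lebesgue"
      using borel_measurable_continuous_onI[OF assms] by (intro measurable_completion) simp
    then show "f \<in> borel_measurable (lebesgue_on (box 0 l))"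
      by (rule measurable_restrict_space1)
    show "AE x in lebesgue_on (box 0 l). norm (f x) \<le> C"
      using C box_subset_cbox by (intro AE_I2) auto
  qed
qed

text \<open>Dynkin's argument: boxes are stable under intersection and generate the Borel sets, and
  the sets over which \<open>f\<close> integrates to 0 are closed under complements and countable
  disjoint unions.\<close>

lemma integral_eq_0_borel:
  fixes f :: "real^'d::finite \<Rightarrow> complex"
  assumes f: "integrable lebesgue f"
    and box: "\<And>a b. (LINT x|lebesgue. indicator (box a b) x *\<^sub>R f x) = 0"
    and S: "S \<in> sets borel"
  shows "(LINT x|lebesgue. indicator S x *\<^sub>R f x) = 0"
proof -
  let ?G = "range (\<lambda>(a, b). box a b :: (real^'d) set)"
  have sets: "sets borel = sigma_sets UNIV ?G"
    by (simp add: borel_eq_box)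
  have int: "integrable lebesgue (\<lambda>x. indicator A x *\<^sub>R f x)" if "A \<in> sigma_sets UNIV ?G" for A
    using f that sets by (intro integrable_mult_indicator) auto
  \<comment> \<open>The whole space is not a box, yet complements require its integral to vanish; it
    is exhausted by the growing boxes \<open>B n\<close>.\<close>
  have UNIV: "(LINT x|lebesgue. f x) = 0"
  proof -
    define B where "B n = box (\<chi> j. - real n) ((\<chi> j. real n) :: real^'d)" for n
    have "(\<lambda>n. LINT x|lebesgue. indicator (B n) x *\<^sub>R f x) \<longlonglongrightarrow> (LINT x|lebesgue. f x)"
    proof (rule integral_dominated_convergence)
      show "integrable lebesgue (\<lambda>x. norm (f x))" using f by simp
      show "AE x in lebesgue. (\<lambda>n. indicator (B n) x *\<^sub>R f x) \<longlonglongrightarrow> f x"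
      proof (intro AE_I2 tendsto_eventually)
        fix x :: "real^'d"
        obtain N where N: "norm x < real N" using reals_Archimedean2 by blast
        have "x \<in> B n" if "n \<ge> N" for n
          unfolding B_def mem_box_cart
        proof
          fix j
          have "\<bar>x $ j\<bar> \<le> norm x" by (rule component_le_norm_cart)
          with N that show "(\<chi> j. - real n) $ j < x $ j \<and> x $ j < (\<chi> j. real n) $ j"
            by (simp add: abs_le_iff)
        qed
        then show "\<forall>\<^sub>F n in sequentially. indicator (B n) x *\<^sub>R f x = f x"
          by (intro eventually_sequentiallyI[of N]) simp
      qed
      show "(\<lambda>x. indicator (B n) x *\<^sub>R f x) \<in> borel_measurable lebesgue" for n
        using f unfolding B_def
        by (intro borel_measurable_scaleR borel_measurable_indicator borel_measurable_integrable) auto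
    qed (use f in \<open>auto simp: indicator_def\<close>)
    moreover have "(LINT x|lebesgue. indicator (B n) x *\<^sub>R f x) = 0" for n
      unfolding B_def by (rule box)
    ultimately show ?thesis by (simp add: LIMSEQ_const_iff)
  qed
  have "Int_stable ?G"
    by (auto simp: Int_stable_def box_Int_box)
  moreover have "?G \<subseteq> Pow UNIV" by auto
  moreover have "S \<in> sigma_sets UNIV ?G" using S sets by simp
  ultimately show ?thesis
  proof (induction rule: sigma_sets_induct_disjoint)
    case (basic A)
    then show ?case using box by auto
  next
    case empty
    then show ?case by simp
  next
    case (compl A)
    have "(\<lambda>x. indicator (UNIV - A) x *\<^sub>R f x) = (\<lambda>x. f x - indicator A x *\<^sub>R f x)"
      by (auto simp: indicator_def)
    then have "(LINT x|lebesgue. indicator (UNIV - A) x *\<^sub>R f x) =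
        (LINT x|lebesgue. f x) - (LINT x|lebesgue. indicator A x *\<^sub>R f x)"
      using Bochner_Integration.integral_diff[OF f int[OF compl.hyps]] by simp
    then show ?case using compl.IH UNIV by simp
  next
    case (union A)
    have A: "range A \<subseteq> sets lebesgue"
      using union.hyps sets by auto
    have "(LINT x:(\<Union>i. A i)|lebesgue. f x) = (\<Sum>i. (LINT x:(A i)|lebesgue. f x))"
    proof (rule lebesgue_integral_countable_add)
      show "set_integrable lebesgue (\<Union>i. A i) f"
        unfolding set_integrable_def using f A by (intro integrable_mult_indicator) auto
      show "A i \<inter> A j = {}" if "i \<noteq> j" for i j
        using union.hyps that by (auto simp: disjoint_family_on_def)
    qed (use A in auto)
    then show ?case using union.IH by (simp add: set_lebesgue_integral_def)
  qed
qed

text \<open>Testing with smooth cutoffs gives a zero integral over every box inside the cell;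
  extension of \<open>u\<close> by zero then reaches all boxes and, by Dynkin's argument, all Borel
  sets.\<close>

lemma fundamental_lemma:
  fixes u :: "real^'d::finite \<Rightarrow> complex"
  assumes u: "integrable (lebesgue_on (box 0 l)) u"
    and test: "\<And>\<phi>. smooth \<phi> \<Longrightarrow> closure {x. \<phi> x \<noteq> 0} \<subseteq> box 0 l \<Longrightarrow>
      (LINT x|lebesgue_on (box 0 l). u x * \<phi> x) = 0"
  shows "AE x in lebesgue_on (box 0 l). u x = 0"
proof -
  interpret finite_measure "lebesgue_on (box 0 l)" by (rule finite_measure_cell)
  define U where "U x = indicator (box 0 l) x *\<^sub>R u x" for x
  have U: "integrable lebesgue U"
    using u unfolding U_def by (subst (asm) integrable_restrict_space) auto
  have eq: "(LINT x|lebesgue. indicator S x *\<^sub>R U x) =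
      (LINT x|lebesgue_on (box 0 l). indicator S x *\<^sub>R u x)" for S
    unfolding U_def by (subst integral_restrict_space) (auto simp: mult.commute)
  have sub: "(LINT x|lebesgue. indicator (box a b) x *\<^sub>R U x) = 0" if ab: "box a b \<subseteq> box 0 l" for a b
  proof -
    obtain \<phi> :: "nat \<Rightarrow> real^'d \<Rightarrow> complex" where \<phi>:
      "\<And>n. smooth (\<phi> n)" "\<And>n. closure {x. \<phi> n x \<noteq> 0} \<subseteq> box a b"
      "\<And>n x. norm (\<phi> n x) \<le> 1" "\<And>x. (\<lambda>n. \<phi> n x) \<longlonglongrightarrow> indicator (box a b) x"
      by (rule smooth_box_indicator[of a b]) (rule that; assumption)
    have "(\<lambda>n. LINT x|lebesgue_on (box 0 l). u x * \<phi> n x) \<longlonglongrightarrow>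
        (LINT x|lebesgue_on (box 0 l). u x * indicator (box a b) x)"
    proof (rule integral_dominated_convergence)
      show "integrable (lebesgue_on (box 0 l)) (\<lambda>x. norm (u x))" using u by simp
      show "AE x in lebesgue_on (box 0 l). (\<lambda>n. u x * \<phi> n x) \<longlonglongrightarrow> u x * indicator (box a b) x"
        by (intro AE_I2 tendsto_intros \<phi>)
      show "AE x in lebesgue_on (box 0 l). norm (u x * \<phi> n x) \<le> norm (u x)" for n
        using \<phi>(3) by (auto simp: norm_mult intro!: AE_I2 mult_left_le)
      show "(\<lambda>x. u x * \<phi> n x) \<in> borel_measurable (lebesgue_on (box 0 l))" for n
        using u in_L2_measurable[OF in_L2_continuous[OF smooth_continuous[OF \<phi>(1)]]] by auto
      show "(\<lambda>x. u x * indicator (box a b) x) \<in> borel_measurable (lebesgue_on (box 0 l))"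
        using u by (intro borel_measurable_times borel_measurable_integrable
            measurable_restrict_space1 borel_measurable_indicator) auto
    qed
    moreover have "(LINT x|lebesgue_on (box 0 l). u x * \<phi> n x) = 0" for n
      using test[OF \<phi>(1)] \<phi>(2) ab by blast
    ultimately have "(LINT x|lebesgue_on (box 0 l). u x * indicator (box a b) x) = 0"
      by (simp add: LIMSEQ_const_iff)
    moreover have "(\<lambda>x. indicator (box a b) x *\<^sub>R u x) = (\<lambda>x. u x * indicator (box a b) x)"
      by (auto simp: indicator_def fun_eq_iff)
    ultimately show ?thesis unfolding eq by simp
  qed
  have box: "(LINT x|lebesgue. indicator (box a b) x *\<^sub>R U x) = 0" for a b
  proof -
    \<comment> \<open>The extension \<open>U\<close> vanishes outside the cell, and the part of a
      box inside the cell is again a box.\<close>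
    obtain a' b' where *: "box a b \<inter> box 0 l = box a' b'" using box_Int_box[of a b 0 l] by blast
    have "(\<lambda>x. indicator (box a b) x *\<^sub>R U x) = (\<lambda>x. indicator (box a' b') x *\<^sub>R U x)"
      unfolding *[symmetric] U_def by (auto simp: indicator_def)
    then show ?thesis using sub[of a' b'] * by auto
  qed
  show ?thesis
  proof (rule density_zero[OF u])
    fix A assume "A \<in> sets (lebesgue_on (box 0 l))"
    then have "A \<in> sets lebesgue" by (auto simp: sets_restrict_space)
    \<comment> \<open>A Lebesgue measurable set differs from a Borel set only by a null set, which
      bridges the gap between the Borel statement and the completed measure.\<close>
    then obtain S N N' where A: "A = S \<union> N" "N \<subseteq> N'" "N' \<in> null_sets lborel" "S \<in> sets lborel"
      by (auto elim: sets_completionE)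
    have N: "AE x in lebesgue. x \<notin> N'"
      using A(3) by (intro AE_not_in null_sets_completionI)
    have "(LINT x|lebesgue. indicator A x *\<^sub>R U x) = (LINT x|lebesgue. indicator S x *\<^sub>R U x)"
    proof (rule integral_cong_AE)
      show "AE x in lebesgue. indicator A x *\<^sub>R U x = indicator S x *\<^sub>R U x"
        using N by (rule AE_mp) (use A(1,2) in \<open>auto simp: indicator_def\<close>)
      show "(\<lambda>x. indicator A x *\<^sub>R U x) \<in> borel_measurable lebesgue"
        "(\<lambda>x. indicator S x *\<^sub>R U x) \<in> borel_measurable lebesgue"
        using U A(4) \<open>A \<in> sets lebesgue\<close>
        by (intro borel_measurable_scaleR borel_measurable_indicator borel_measurable_integrable; simp)+
    qed
    also have "\<dots> = 0"
      using integral_eq_0_borel[OF U box] A(4) by simp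
    finally show "set_lebesgue_integral (lebesgue_on (box 0 l)) A u = 0"
      unfolding eq set_lebesgue_integral_def .
  qed
qed

lemma weak_gradient_unique:
  assumes "\<And>j. in_L2 l (\<lambda>x. v x $ j)" "weak_gradient l g v"
    and "\<And>j. in_L2 l (\<lambda>x. v' x $ j)" "weak_gradient l g v'"
  shows "AE x in lebesgue_on (box 0 l). v x = v' x"
proof -
  have "AE x in lebesgue_on (box 0 l). v x $ j - v' x $ j = 0" for j
  proof (rule fundamental_lemma)
    show "integrable (lebesgue_on (box 0 l)) (\<lambda>x. v x $ j - v' x $ j)"
      using assms by (intro in_L2_integrable in_L2_diff)
    fix \<phi> :: "real^'a \<Rightarrow> complex" assume \<phi>: "smooth \<phi>" "closure {x. \<phi> x \<noteq> 0} \<subseteq> box 0 l"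
    have \<phi>2: "in_L2 l \<phi>" using \<phi>(1) by (intro in_L2_continuous smooth_continuous)
    have "(LINT x|lebesgue_on (box 0 l). v x $ j * \<phi> x) = (LINT x|lebesgue_on (box 0 l). v' x $ j * \<phi> x)"
    proof -
      have "- (LINT x|lebesgue_on (box 0 l). v x $ j * \<phi> x) = - (LINT x|lebesgue_on (box 0 l). v' x $ j * \<phi> x)"
        using assms(2)[unfolded weak_gradient_def, rule_format, of \<phi> j]
          assms(4)[unfolded weak_gradient_def, rule_format, of \<phi> j] \<phi> by simp
      then show ?thesis by simp
    qed
    then show "(LINT x|lebesgue_on (box 0 l). (v x $ j - v' x $ j) * \<phi> x) = 0"
      unfolding left_diff_distrib using in_L2_mult_integrable[OF assms(1) \<phi>2] in_L2_mult_integrable[OF assms(3) \<phi>2]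
      by (subst Bochner_Integration.integral_diff) auto
  qed
  then have "AE x in lebesgue_on (box 0 l). \<forall>j\<in>UNIV. v x $ j - v' x $ j = 0"
    by (intro AE_finite_allI) auto
  then show ?thesis by eventually_elim (simp add: vec_eq_iff)
qed

lemma grad_props:
  assumes "in_H1 l g"
  shows "in_L2 l (\<lambda>x. grad l g x $ j)" "weak_gradient l g (grad l g)"
proof -
  have "(\<forall>j. in_L2 l (\<lambda>x. grad l g x $ j)) \<and> weak_gradient l g (grad l g)"
    unfolding grad_def by (rule someI_ex[OF conjunct2[OF assms[unfolded in_H1_def]]])
  then show "in_L2 l (\<lambda>x. grad l g x $ j)" "weak_gradient l g (grad l g)" by auto
qed

lemma grad_eqI:
  assumes "in_L2 l g" "\<And>j. in_L2 l (\<lambda>x. v x $ j)" "weak_gradient l g v"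
  shows "in_H1 l g" "AE x in lebesgue_on (box 0 l). grad l g x = v x"
proof -
  show "in_H1 l g" unfolding in_H1_def using assms by blast
  then show "AE x in lebesgue_on (box 0 l). grad l g x = v x"
    using grad_props weak_gradient_unique assms by blast
qed

section \<open>Closure properties of the periodic Sobolev space\<close>

lemma in_L2_smooth:
  assumes "smooth \<phi>"
  shows "in_L2 l \<phi>" "in_L2 l (partial_deriv j \<phi>)"
  using assms by (auto intro!: in_L2_continuous smooth_continuous smooth_partial_deriv)

lemma frechet_derivative_cart:
  assumes "smooth \<phi>"
  shows "frechet_derivative \<phi> (at z) h = (\<Sum>j\<in>UNIV. h $ j *\<^sub>R partial_deriv j \<phi> z)"
proof -
  interpret bounded_linear "frechet_derivative \<phi> (at z)"
    using smooth_has_derivative[OF assms] by (rule has_derivative_bounded_linear)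
  have "frechet_derivative \<phi> (at z) h = frechet_derivative \<phi> (at z) (\<Sum>j\<in>UNIV. h $ j *\<^sub>R axis j 1)"
    using basis_expansion[of h] by (simp add: scalar_mult_eq_scaleR)
  also have "\<dots> = (\<Sum>j\<in>UNIV. h $ j *\<^sub>R partial_deriv j \<phi> z)"
    by (simp add: sum scaleR partial_deriv_def)
  finally show ?thesis .
qed

lemma smooth_line_derivative:
  assumes "smooth \<phi>"
  shows "((\<lambda>t. \<phi> (y + t *\<^sub>R d)) has_vector_derivative
    (\<Sum>j\<in>UNIV. d $ j *\<^sub>R partial_deriv j \<phi> (y + t *\<^sub>R d))) (at t within S)"
proof -
  have "((\<lambda>t. y + t *\<^sub>R d) has_derivative (\<lambda>s. s *\<^sub>R d)) (at t within S)"
    by (auto intro!: derivative_eq_intros)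
  from has_derivative_compose[OF this smooth_has_derivative[OF assms]]
  show ?thesis
    unfolding has_vector_derivative_def frechet_derivative_cart[OF assms]
    by (simp add: scaleR_sum_right)
qed

lemma smooth_partial_line_derivative:
  assumes "smooth \<phi>"
  shows "((\<lambda>t. \<phi> (y + t *\<^sub>R axis j 1)) has_vector_derivative
    partial_deriv j \<phi> (y + t *\<^sub>R axis j 1)) (at t within S)"
proof -
  have *: "(\<Sum>i\<in>UNIV. axis j 1 $ i *\<^sub>R partial_deriv i \<phi> z) = partial_deriv j \<phi> z" for z
  proof -
    have "(\<Sum>i\<in>UNIV. axis j 1 $ i *\<^sub>R partial_deriv i \<phi> z) = (\<Sum>i\<in>UNIV. if i = j then partial_deriv i \<phi> z else 0)"
      by (intro sum.cong) (auto simp: axis_def)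
    then show ?thesis by simp
  qed
  show ?thesis using smooth_line_derivative[OF assms, of y "axis j 1" t S] unfolding * .
qed

text \<open>Translation invariance makes the integral of every difference quotient over the whole
  space vanish; the limit is taken by dominated convergence. This is the integration by parts behind
  the zero weak gradient of constants.\<close>

lemma integral_partial_deriv_eq_0:
  fixes \<phi> :: "real^'d::finite \<Rightarrow> complex"
  assumes \<phi>: "smooth \<phi>" and supp: "closure {x. \<phi> x \<noteq> 0} \<subseteq> box 0 l"
  shows "(LINT x|lebesgue_on (box 0 l). partial_deriv j \<phi> x) = 0"
proof -
  define \<psi> where "\<psi> = partial_deriv j \<phi>"
  define e where "e = (axis j 1 :: real^'d)"
  define h where "h n = 1 / real (Suc n)" for n
  have h: "0 < h n" "h n \<le> 1" for n by (auto simp: h_def field_simps)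
  have cont: "continuous_on S \<phi>" "continuous_on S \<psi>" for S
    using \<phi> unfolding \<psi>_def by (auto intro: smooth_continuous smooth_partial_deriv)
  have [measurable]: "\<phi> \<in> borel_measurable borel" "\<psi> \<in> borel_measurable borel"
    using cont by (auto intro: borel_measurable_continuous_onI)
  have \<phi>0: "\<phi> x = 0" if "x \<notin> box 0 l" for x
    using that supp closure_subset[of "{x. \<phi> x \<noteq> 0}"] by blast
  \<comment> \<open>Off the closed support the function vanishes in a neighbourhood, hence so does
    its derivative.\<close>
  have \<psi>0: "\<psi> x = 0" if x: "x \<notin> box 0 l" for x
  proof -
    have "(\<phi> has_derivative (\<lambda>h. 0)) (at x)"
    proof (rule has_derivative_transform_within_open)
      show "((\<lambda>x. 0) has_derivative (\<lambda>h. 0)) (at x)" by simp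
      show "open (- closure {x. \<phi> x \<noteq> 0})" by (intro open_Compl closed_closure)
      show "x \<in> - closure {x. \<phi> x \<noteq> 0}" using x supp by blast
      show "0 = \<phi> y" if "y \<in> - closure {x. \<phi> x \<noteq> 0}" for y
        using that closure_subset[of "{x. \<phi> x \<noteq> 0}"] by fastforce
    qed
    from frechet_derivative_at[OF this, symmetric] show ?thesis
      unfolding \<psi>_def partial_deriv_def by simp
  qed
  have "bounded (\<psi> ` cbox 0 l)"
    by (intro compact_imp_bounded compact_continuous_image cont compact_cbox)
  then obtain B where "\<And>x. x \<in> cbox 0 l \<Longrightarrow> norm (\<psi> x) \<le> B" unfolding bounded_iff by auto
  \<comment> \<open>The sides of \<open>l\<close> are arbitrary here, so the closed cell may be
    empty and \<open>B\<close> negative; the maximum with 0 covers this case and the points outside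
    the cell.\<close>
  then have B: "norm (\<psi> x) \<le> max B 0" for x
    using \<psi>0[of x] box_subset_cbox[of 0 l] by (cases "x \<in> box 0 l") (auto simp: le_max_iff_disj)
  define D where "D n x = (\<phi> (h n *\<^sub>R e + x) - \<phi> x) /\<^sub>R h n" for n x
  have int\<phi>: "integrable lborel \<phi>"
  proof -
    have "set_integrable lborel (cbox 0 l) \<phi>"
      unfolding set_integrable_def by (intro borel_integrable_compact compact_cbox cont)
    moreover have "(\<lambda>x. indicator (cbox 0 l) x *\<^sub>R \<phi> x) = \<phi>"
      using \<phi>0 box_subset_cbox[of 0 l] by (auto simp: indicator_def fun_eq_iff)
    ultimately show ?thesis by (simp add: set_integrable_def)
  qed
  have shift: "integrable lborel (\<lambda>x. \<phi> (c + x))" "(LINT x|lborel. \<phi> (c + x)) = (LINT x|lborel. \<phi> x)" for c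
  proof -
    have *: "integrable (distr lborel borel ((+) c)) \<phi>" using int\<phi> by (simp add: lborel_distr_plus)
    show "integrable lborel (\<lambda>x. \<phi> (c + x))"
      by (rule integrable_distr[OF _ *]) simp
    show "(LINT x|lborel. \<phi> (c + x)) = (LINT x|lborel. \<phi> x)"
      using integral_distr[of "(+) c" lborel borel \<phi>] by (simp add: lborel_distr_plus)
  qed
  have D0: "(LINT x|lborel. D n x) = 0" for n
    unfolding D_def using shift int\<phi> by simp
  have "(\<lambda>n. LINT x|lborel. D n x) \<longlonglongrightarrow> (LINT x|lborel. \<psi> x)"
  \<comment> \<open>Since steps are at most 1 in the direction \<open>e\<close>, a difference
    quotient can be nonzero only if \<open>x\<close> lies in the cell enlarged by \<open>e\<close>
    on its lower side; there the mean value inequality bounds it.\<close>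
  proof (rule integral_dominated_convergence[where w="\<lambda>x. max B 0 * indicator (cbox (- e) l) x"])
    show "integrable lborel (\<lambda>x. max B 0 * indicator (cbox (- e) l) x)"
      by (intro integrable_mult_right integrable_real_indicator) (auto simp: emeasure_lborel_cbox_eq)
    show "AE x in lborel. (\<lambda>n. D n x) \<longlonglongrightarrow> \<psi> x"
    proof (intro AE_I2)
      fix x
      have "((\<lambda>t. \<phi> (x + t *\<^sub>R e)) has_derivative (\<lambda>s. s *\<^sub>R \<psi> x)) (at 0)"
        using smooth_partial_line_derivative[OF \<phi>, of x j 0 UNIV]
        by (simp add: has_vector_derivative_def e_def \<psi>_def)
      then have "((\<lambda>s. norm (\<phi> (x + s *\<^sub>R e) - \<phi> x - s *\<^sub>R \<psi> x) / norm s) \<longlongrightarrow> 0) (at 0)"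
        by (simp add: has_derivative_at)
      moreover have "filterlim h (at 0) sequentially"
        unfolding h_def by real_asymp
      ultimately have lim: "(\<lambda>n. norm (\<phi> (x + h n *\<^sub>R e) - \<phi> x - h n *\<^sub>R \<psi> x) / norm (h n)) \<longlonglongrightarrow> 0"
        by (rule filterlim_compose)
      have "norm (\<phi> (x + h n *\<^sub>R e) - \<phi> x - h n *\<^sub>R \<psi> x) / norm (h n) = norm (D n x - \<psi> x)" for n
      proof -
        have "D n x - \<psi> x = (\<phi> (x + h n *\<^sub>R e) - \<phi> x - h n *\<^sub>R \<psi> x) /\<^sub>R h n"
          using h(1)[of n] by (simp add: D_def scaleR_diff_right add.commute)
        then show ?thesis using h(1)[of n] by (simp add: divide_inverse mult.commute)
      qed
      with lim have "(\<lambda>n. norm (D n x - \<psi> x)) \<longlonglongrightarrow> 0" by simp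
      then show "(\<lambda>n. D n x) \<longlonglongrightarrow> \<psi> x"
        using tendsto_norm_zero_iff LIM_zero_iff by blast
    qed
    show "AE x in lborel. norm (D n x) \<le> max B 0 * indicator (cbox (- e) l) x" for n
    proof (intro AE_I2)
      fix x
      show "norm (D n x) \<le> max B 0 * indicator (cbox (- e) l) x"
      proof (cases "x \<in> cbox (- e) l")
        case True
        have "norm (\<phi> (x + h n *\<^sub>R e) - \<phi> (x + 0 *\<^sub>R e)) \<le> max B 0 * norm (h n - 0)"
        proof (rule differentiable_bound[of UNIV "\<lambda>t. \<phi> (x + t *\<^sub>R e)" "\<lambda>t s. s *\<^sub>R \<psi> (x + t *\<^sub>R e)"])
          show "((\<lambda>t. \<phi> (x + t *\<^sub>R e)) has_derivative (\<lambda>s. s *\<^sub>R \<psi> (x + t *\<^sub>R e))) (at t within UNIV)" for t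
            using smooth_partial_line_derivative[OF \<phi>, of x j t UNIV]
            by (simp add: has_vector_derivative_def e_def \<psi>_def)
          show "onorm (\<lambda>s::real. s *\<^sub>R \<psi> (x + t *\<^sub>R e)) \<le> max B 0" for t
            by (rule onorm_le) (use mult_left_mono[OF B abs_ge_zero] in \<open>simp add: mult.commute\<close>)
        qed auto
        then have "norm (\<phi> (h n *\<^sub>R e + x) - \<phi> x) \<le> max B 0 * h n"
          using h(1)[of n] by (simp add: add.commute)
        moreover have "norm (D n x) = norm (\<phi> (h n *\<^sub>R e + x) - \<phi> x) / h n"
          using h(1)[of n] by (simp add: D_def divide_inverse mult.commute)
        ultimately show ?thesis using True h(1)[of n] by (simp add: pos_divide_le_eq)
      next
        case False
        then obtain i where i: "\<not> (- e $ i \<le> x $ i \<and> x $ i \<le> l $ i)"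
          by (auto simp: mem_box_cart)
        have "0 \<le> h n * e $ i" "h n * e $ i \<le> e $ i"
          using h[of n] by (auto simp: e_def axis_def)
        moreover have "0 \<le> e $ i" by (simp add: e_def axis_def)
        ultimately have "x \<notin> box 0 l" "h n *\<^sub>R e + x \<notin> box 0 l"
          using i unfolding mem_box_cart
          by (auto intro!: exI[of _ i] simp: not_less)
        then show ?thesis by (simp add: D_def \<phi>0)
      qed
    qed
    show "D n \<in> borel_measurable lborel" for n
      unfolding D_def by measurable
  qed measurable
  then have "(LINT x|lborel. \<psi> x) = 0" by (simp add: D0 LIMSEQ_const_iff)
  moreover have "(LINT x|lebesgue_on (box 0 l). \<psi> x) = (LINT x|lborel. \<psi> x)"
  proof -
    have "(LINT x|lebesgue_on (box 0 l). \<psi> x) = (LINT x|lebesgue. indicator (box 0 l) x *\<^sub>R \<psi> x)"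
      by (subst integral_restrict_space) auto
    also have "(\<lambda>x. indicator (box 0 l) x *\<^sub>R \<psi> x) = \<psi>"
      using \<psi>0 by (auto simp: indicator_def fun_eq_iff)
    finally show ?thesis by (simp add: integral_completion)
  qed
  ultimately show ?thesis unfolding \<psi>_def by simp
qed

lemma weak_gradient_const: "weak_gradient l (\<lambda>x. a) (\<lambda>x. 0)"
  unfolding weak_gradient_def by (auto simp: integral_partial_deriv_eq_0)

lemma weak_gradient_add:
  assumes "weak_gradient l f v" "weak_gradient l g w" "in_L2 l f" "in_L2 l g"
    and "\<And>j. in_L2 l (\<lambda>x. v x $ j)" "\<And>j. in_L2 l (\<lambda>x. w x $ j)"
  shows "weak_gradient l (\<lambda>x. f x + g x) (\<lambda>x. v x + w x)"
  unfolding weak_gradient_def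
proof (intro allI impI)
  fix \<phi> :: "real^'a \<Rightarrow> complex" and j
  assume \<phi>: "smooth \<phi> \<and> closure {x. \<phi> x \<noteq> 0} \<subseteq> box 0 l"
  note int = in_L2_mult_integrable[OF assms(3) in_L2_smooth(2)] in_L2_mult_integrable[OF assms(4) in_L2_smooth(2)]
    in_L2_mult_integrable[OF assms(5) in_L2_smooth(1)] in_L2_mult_integrable[OF assms(6) in_L2_smooth(1)]
  show "(LINT x|lebesgue_on (box 0 l). (f x + g x) * partial_deriv j \<phi> x) =
      - (LINT x|lebesgue_on (box 0 l). (v x + w x) $ j * \<phi> x)"
    using \<phi> int assms(1,2) by (simp add: weak_gradient_def distrib_right)
qed

lemma weak_gradient_cmult:
  assumes "weak_gradient l f v"
  shows "weak_gradient l (\<lambda>x. a * f x) (\<lambda>x. \<chi> j. a * v x $ j)"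
  using assms by (simp add: weak_gradient_def mult.assoc)

text \<open>The conjugation is moved onto the test function, whose conjugate is again smooth with
  the same support.\<close>

lemma weak_gradient_cnj:
  assumes "weak_gradient l f v"
  shows "weak_gradient l (\<lambda>x. cnj (f x)) (\<lambda>x. \<chi> j. cnj (v x $ j))"
  unfolding weak_gradient_def
proof (intro allI impI)
  fix \<phi> :: "real^'a \<Rightarrow> complex" and j
  assume \<phi>: "smooth \<phi> \<and> closure {x. \<phi> x \<noteq> 0} \<subseteq> box 0 l"
  then have "(LINT x|lebesgue_on (box 0 l). f x * partial_deriv j (\<lambda>x. cnj (\<phi> x)) x) =
      - (LINT x|lebesgue_on (box 0 l). v x $ j * cnj (\<phi> x))"
    using assms smooth_linear[OF _ bounded_linear_cnj, of \<phi>] by (simp add: weak_gradient_def)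
  then have eq: "(LINT x|lebesgue_on (box 0 l). f x * cnj (partial_deriv j \<phi> x)) =
      - (LINT x|lebesgue_on (box 0 l). v x $ j * cnj (\<phi> x))"
    using partial_deriv_linear[OF _ bounded_linear_cnj, of \<phi>] \<phi> by simp
  have "(LINT x|lebesgue_on (box 0 l). cnj (f x) * partial_deriv j \<phi> x) =
      cnj (LINT x|lebesgue_on (box 0 l). f x * cnj (partial_deriv j \<phi> x))"
    by (subst Bochner_Integration.integral_cnj[symmetric]) simp
  also have "\<dots> = - cnj (LINT x|lebesgue_on (box 0 l). v x $ j * cnj (\<phi> x))"
    by (simp only: eq complex_cnj_minus)
  also have "cnj (LINT x|lebesgue_on (box 0 l). v x $ j * cnj (\<phi> x)) =
      (LINT x|lebesgue_on (box 0 l). (\<chi> j. cnj (v x $ j)) $ j * \<phi> x)"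
    by (subst Bochner_Integration.integral_cnj[symmetric]) simp
  finally show "(LINT x|lebesgue_on (box 0 l). cnj (f x) * partial_deriv j \<phi> x) =
      - (LINT x|lebesgue_on (box 0 l). (\<chi> j. cnj (v x $ j)) $ j * \<phi> x)" .
qed

lemma L2_dist_sq_tendsto_add:
  assumes "\<And>n. in_L2 l (f n)" "\<And>n. in_L2 l (g n)" "in_L2 l F" "in_L2 l G"
    and "(\<lambda>n. L2_dist_sq l (f n) F) \<longlonglongrightarrow> 0" "(\<lambda>n. L2_dist_sq l (g n) G) \<longlonglongrightarrow> 0"
  shows "(\<lambda>n. L2_dist_sq l (\<lambda>x. f n x + g n x) (\<lambda>x. F x + G x)) \<longlonglongrightarrow> 0"
proof (rule tendsto_sandwich[OF _ _ tendsto_const])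
  show "\<forall>\<^sub>F n in sequentially. 0 \<le> L2_dist_sq l (\<lambda>x. f n x + g n x) (\<lambda>x. F x + G x)"
    by (simp add: L2_dist_sq_def)
  have "(\<lambda>n. 2 * L2_dist_sq l (f n) F + 2 * L2_dist_sq l (g n) G) \<longlonglongrightarrow> 2 * 0 + 2 * 0"
    by (intro tendsto_intros assms)
  then show "(\<lambda>n. 2 * L2_dist_sq l (f n) F + 2 * L2_dist_sq l (g n) G) \<longlonglongrightarrow> 0" by simp
  have "L2_dist_sq l (\<lambda>x. f n x + g n x) (\<lambda>x. F x + G x) \<le> 2 * L2_dist_sq l (f n) F + 2 * L2_dist_sq l (g n) G" for n
  proof -
    have int: "integrable (lebesgue_on (box 0 l)) (\<lambda>x. (norm (f n x - F x))\<^sup>2)"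
      "integrable (lebesgue_on (box 0 l)) (\<lambda>x. (norm (g n x - G x))\<^sup>2)"
      "integrable (lebesgue_on (box 0 l)) (\<lambda>x. (norm (f n x + g n x - (F x + G x)))\<^sup>2)"
      using in_L2_diff[OF assms(1,3)] in_L2_diff[OF assms(2,4)]
        in_L2_diff[OF in_L2_add[OF assms(1,2)] in_L2_add[OF assms(3,4)]] by (auto simp: in_L2_def)
    have "L2_dist_sq l (\<lambda>x. f n x + g n x) (\<lambda>x. F x + G x) \<le>
        (LINT x|lebesgue_on (box 0 l). 2 * (norm (f n x - F x))\<^sup>2 + 2 * (norm (g n x - G x))\<^sup>2)"
      unfolding L2_dist_sq_def
    proof (intro integral_mono int Bochner_Integration.integrable_add integrable_mult_right)
      fix x show "(norm (f n x + g n x - (F x + G x)))\<^sup>2 \<le> 2 * (norm (f n x - F x))\<^sup>2 + 2 * (norm (g n x - G x))\<^sup>2"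
        using norm_add_sq_le[of "f n x - F x" "g n x - G x"] by (simp add: algebra_simps)
    qed
    also have "\<dots> = 2 * L2_dist_sq l (f n) F + 2 * L2_dist_sq l (g n) G"
      using int by (simp add: L2_dist_sq_def)
    finally show ?thesis .
  qed
  then show "\<forall>\<^sub>F n in sequentially. L2_dist_sq l (\<lambda>x. f n x + g n x) (\<lambda>x. F x + G x)
      \<le> 2 * L2_dist_sq l (f n) F + 2 * L2_dist_sq l (g n) G" by simp
qed

lemma L2_dist_sq_cong_AE:
  assumes "in_L2 l f" "in_L2 l g" "in_L2 l g'" "AE x in lebesgue_on (box 0 l). g x = g' x"
  shows "L2_dist_sq l f g = L2_dist_sq l f g'"
  unfolding L2_dist_sq_def
proof (rule integral_cong_AE)
  show "AE x in lebesgue_on (box 0 l). (norm (f x - g x))\<^sup>2 = (norm (f x - g' x))\<^sup>2"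
    using assms(4) by eventually_elim simp
qed (use assms in \<open>auto simp: in_L2_def\<close>)

lemma continuous_set_coord: "continuous_on S (set_coord j c :: real^'d::finite \<Rightarrow> _)"
  unfolding set_coord_def
proof (intro continuous_on_vec_lambda)
  show "continuous_on S (\<lambda>x::real^'d. if i = j then c else x $ i)" for i
    by (cases "i = j") (auto intro!: continuous_intros)
qed

lemma in_L2_smooth_set_coord: "smooth \<phi> \<Longrightarrow> in_L2 l (\<lambda>x. \<phi> (set_coord j c x))"
  by (intro in_L2_continuous continuous_on_compose2[OF smooth_continuous continuous_set_coord]) auto

lemma in_H1_add:
  assumes "in_H1 l f" "in_H1 l g"
  shows "in_H1 l (\<lambda>x. f x + g x)"
    "AE x in lebesgue_on (box 0 l). grad l (\<lambda>x. f x + g x) x = grad l f x + grad l g x"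
proof -
  have "in_L2 l f" "in_L2 l g" using assms by (auto simp: in_H1_def)
  with assms show "in_H1 l (\<lambda>x. f x + g x)"
    "AE x in lebesgue_on (box 0 l). grad l (\<lambda>x. f x + g x) x = grad l f x + grad l g x"
    using grad_eqI[of l "\<lambda>x. f x + g x" "\<lambda>x. grad l f x + grad l g x"]
    by (auto simp: grad_props in_L2_add weak_gradient_add)
qed

lemma has_trace_add:
  assumes "in_H1 l f" "in_H1 l g" "has_trace l f j c s" "has_trace l g j c t"
  shows "has_trace l (\<lambda>x. f x + g x) j c (\<lambda>x. s x + t x)"
proof -
  have L2: "in_L2 l f" "in_L2 l g" using assms by (auto simp: in_H1_def)
  have st: "in_L2 l (\<lambda>x. s (set_coord j 0 x))" "in_L2 l (\<lambda>x. t (set_coord j 0 x))"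
    using assms by (auto simp: has_trace_def)
  obtain \<phi> where \<phi>: "\<And>n. smooth (\<phi> n)" "(\<lambda>n. L2_dist_sq l (\<phi> n) f) \<longlonglongrightarrow> 0"
    "\<And>i. (\<lambda>n. L2_dist_sq l (partial_deriv i (\<phi> n)) (\<lambda>x. grad l f x $ i)) \<longlonglongrightarrow> 0"
    "(\<lambda>n. L2_dist_sq l (\<lambda>x. \<phi> n (set_coord j c x)) (\<lambda>x. s (set_coord j 0 x))) \<longlonglongrightarrow> 0"
    using assms(3) unfolding has_trace_def by blast
  obtain \<psi> where \<psi>: "\<And>n. smooth (\<psi> n)" "(\<lambda>n. L2_dist_sq l (\<psi> n) g) \<longlonglongrightarrow> 0"
    "\<And>i. (\<lambda>n. L2_dist_sq l (partial_deriv i (\<psi> n)) (\<lambda>x. grad l g x $ i)) \<longlonglongrightarrow> 0"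
    "(\<lambda>n. L2_dist_sq l (\<lambda>x. \<psi> n (set_coord j c x)) (\<lambda>x. t (set_coord j 0 x))) \<longlonglongrightarrow> 0"
    using assms(4) unfolding has_trace_def by blast
  \<comment> \<open>The chosen \<open>grad\<close> of a sum agrees with the sum of the chosen
    gradients only almost everywhere, so the representative is exchanged inside the distance before
    the two limits are added.\<close>
  have grad: "L2_dist_sq l (partial_deriv i (\<lambda>x. \<phi> n x + \<psi> n x)) (\<lambda>x. grad l (\<lambda>x. f x + g x) x $ i) =
      L2_dist_sq l (\<lambda>x. partial_deriv i (\<phi> n) x + partial_deriv i (\<psi> n) x)
        (\<lambda>x. grad l f x $ i + grad l g x $ i)" for i n
    unfolding partial_deriv_add[OF \<phi>(1) \<psi>(1)]
  proof (rule L2_dist_sq_cong_AE)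
    show "AE x in lebesgue_on (box 0 l). grad l (\<lambda>x. f x + g x) x $ i = grad l f x $ i + grad l g x $ i"
      using in_H1_add(2)[OF assms(1,2)] by eventually_elim simp
    show "in_L2 l (\<lambda>x. partial_deriv i (\<phi> n) x + partial_deriv i (\<psi> n) x)"
      by (intro in_L2_add in_L2_smooth \<phi> \<psi>)
    show "in_L2 l (\<lambda>x. grad l (\<lambda>x. f x + g x) x $ i)"
      by (intro grad_props in_H1_add assms)
    show "in_L2 l (\<lambda>x. grad l f x $ i + grad l g x $ i)"
      by (intro in_L2_add grad_props assms)
  qed
  show ?thesis
    unfolding has_trace_def
  proof (intro conjI exI[of _ "\<lambda>n x. \<phi> n x + \<psi> n x"] allI)
    show "in_L2 l (\<lambda>x. s (set_coord j 0 x) + t (set_coord j 0 x))" using st by (rule in_L2_add)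
    show "smooth (\<lambda>x. \<phi> n x + \<psi> n x)" for n using \<phi>(1) \<psi>(1) by (rule smooth_add)
    show "(\<lambda>n. L2_dist_sq l (\<lambda>x. \<phi> n x + \<psi> n x) (\<lambda>x. f x + g x)) \<longlonglongrightarrow> 0"
      by (intro L2_dist_sq_tendsto_add L2 in_L2_smooth(1)[OF \<phi>(1)] in_L2_smooth(1)[OF \<psi>(1)] \<phi> \<psi>)
    show "(\<lambda>n. L2_dist_sq l (partial_deriv i (\<lambda>x. \<phi> n x + \<psi> n x)) (\<lambda>x. grad l (\<lambda>x. f x + g x) x $ i)) \<longlonglongrightarrow> 0" for i
      unfolding grad by (intro L2_dist_sq_tendsto_add in_L2_smooth(2)[OF \<phi>(1)] in_L2_smooth(2)[OF \<psi>(1)]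
          grad_props(1) assms(1,2) \<phi>(3) \<psi>(3))
    show "(\<lambda>n. L2_dist_sq l (\<lambda>x. \<phi> n (set_coord j c x) + \<psi> n (set_coord j c x))
        (\<lambda>x. s (set_coord j 0 x) + t (set_coord j 0 x))) \<longlonglongrightarrow> 0"
      by (intro L2_dist_sq_tendsto_add in_L2_smooth_set_coord st \<phi>(1,4) \<psi>(1,4))
  qed
qed

lemma in_H1p_add:
  assumes "in_H1p l f" "in_H1p l g"
  shows "in_H1p l (\<lambda>x. f x + g x)"
    "AE x in lebesgue_on (box 0 l). grad l (\<lambda>x. f x + g x) x = grad l f x + grad l g x"
proof -
  have H1: "in_H1 l f" "in_H1 l g" using assms by (auto simp: in_H1p_def)
  then show "AE x in lebesgue_on (box 0 l). grad l (\<lambda>x. f x + g x) x = grad l f x + grad l g x"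
    by (rule in_H1_add)
  show "in_H1p l (\<lambda>x. f x + g x)"
    unfolding in_H1p_def using in_H1_add(1)[OF H1] assms has_trace_add[OF H1]
    unfolding in_H1p_def by meson
qed

text \<open>A common treatment of complex multiples and of conjugation. The map scales norms by
  \<open>c\<close>, hence squared distances by the square of \<open>c\<close>, and so carries
  approximating sequences and their traces to approximating sequences and traces of the
  image.\<close>

lemma in_H1p_map:
  fixes L :: "complex \<Rightarrow> complex"
  assumes L: "bounded_linear L" "\<And>z. norm (L z) = c * norm z"
    and weak: "\<And>g v. weak_gradient l g v \<Longrightarrow> weak_gradient l (\<lambda>x. L (g x)) (\<lambda>x. \<chi> j. L (v x $ j))"
    and g: "in_H1p l g"
  shows "in_H1p l (\<lambda>x. L (g x))"
    "AE x in lebesgue_on (box 0 l). grad l (\<lambda>x. L (g x)) x = (\<chi> j. L (grad l g x $ j))"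
proof -
  have L_meas: "L \<in> borel_measurable borel"
    using L(1) by (intro borel_measurable_continuous_onI linear_continuous_on)
  have L2: "in_L2 l (\<lambda>x. L (f x))" if "in_L2 l f" for f
    using that L measurable_compose[OF _ L_meas] by (auto simp: in_L2_def power_mult_distrib)
  have dist: "L2_dist_sq l (\<lambda>x. L (f x)) (\<lambda>x. L (h x)) = c\<^sup>2 * L2_dist_sq l f h" for f h
    using L by (simp add: L2_dist_sq_def power_mult_distrib linear_diff[OF bounded_linear.linear, symmetric])
  have lim: "(\<lambda>n. L2_dist_sq l (\<lambda>x. L (f n x)) (\<lambda>x. L (h x))) \<longlonglongrightarrow> 0"
    if "(\<lambda>n. L2_dist_sq l (f n) h) \<longlonglongrightarrow> 0" for f :: "nat \<Rightarrow> real^'a \<Rightarrow> complex" and h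
    unfolding dist using tendsto_mult_left[OF that, of "c\<^sup>2"] by simp
  have H1: "in_H1 l g" using g by (simp add: in_H1p_def)
  then have *: "in_H1 l (\<lambda>x. L (g x))"
    "AE x in lebesgue_on (box 0 l). grad l (\<lambda>x. L (g x)) x = (\<chi> j. L (grad l g x $ j))"
    using grad_eqI[of l "\<lambda>x. L (g x)" "\<lambda>x. \<chi> j. L (grad l g x $ j)"] L2 weak grad_props[OF H1]
    by (auto simp: in_H1_def)
  show "AE x in lebesgue_on (box 0 l). grad l (\<lambda>x. L (g x)) x = (\<chi> j. L (grad l g x $ j))" by fact
  have "has_trace l (\<lambda>x. L (g x)) j b (\<lambda>x. L (t x))" if trace: "has_trace l g j b t" for j b t
  proof -
    obtain \<phi> where \<phi>: "\<And>n. smooth (\<phi> n)" "(\<lambda>n. L2_dist_sq l (\<phi> n) g) \<longlonglongrightarrow> 0"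
      "\<And>i. (\<lambda>n. L2_dist_sq l (partial_deriv i (\<phi> n)) (\<lambda>x. grad l g x $ i)) \<longlonglongrightarrow> 0"
      "(\<lambda>n. L2_dist_sq l (\<lambda>x. \<phi> n (set_coord j b x)) (\<lambda>x. t (set_coord j 0 x))) \<longlonglongrightarrow> 0"
      using trace unfolding has_trace_def by blast
    have grad: "L2_dist_sq l (partial_deriv i (\<lambda>x. L (\<phi> n x))) (\<lambda>x. grad l (\<lambda>x. L (g x)) x $ i) =
        L2_dist_sq l (\<lambda>x. L (partial_deriv i (\<phi> n) x)) (\<lambda>x. L (grad l g x $ i))" for i n
      unfolding partial_deriv_linear[OF \<phi>(1) L(1)]
    proof (rule L2_dist_sq_cong_AE)
      show "AE x in lebesgue_on (box 0 l). grad l (\<lambda>x. L (g x)) x $ i = L (grad l g x $ i)"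
        using *(2) by eventually_elim simp
      show "in_L2 l (\<lambda>x. L (partial_deriv i (\<phi> n) x))"
        by (intro L2 in_L2_smooth \<phi>)
      show "in_L2 l (\<lambda>x. grad l (\<lambda>x. L (g x)) x $ i)" "in_L2 l (\<lambda>x. L (grad l g x $ i))"
        by (intro L2 grad_props * H1)+
    qed
    show ?thesis
      unfolding has_trace_def
    proof (intro conjI exI[of _ "\<lambda>n x. L (\<phi> n x)"] allI)
      show "in_L2 l (\<lambda>x. L (t (set_coord j 0 x)))" using trace by (auto simp: has_trace_def intro: L2)
    qed (use lim \<phi> smooth_linear[OF \<phi>(1) L(1)] in \<open>auto simp: grad\<close>)
  qed
  then show "in_H1p l (\<lambda>x. L (g x))"
    using g *(1) unfolding in_H1p_def by meson
qed

lemma in_H1p_cmult: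
  assumes "in_H1p l g"
  shows "in_H1p l (\<lambda>x. a * g x)"
    "AE x in lebesgue_on (box 0 l). grad l (\<lambda>x. a * g x) x = (\<chi> j. a * grad l g x $ j)"
  by (rule in_H1p_map[of "(*) a" "norm a" l g, OF bounded_linear_mult_right norm_mult weak_gradient_cmult assms];
      assumption)+

lemma in_H1p_cnj:
  assumes "in_H1p l g"
  shows "in_H1p l (\<lambda>x. cnj (g x))"
    "AE x in lebesgue_on (box 0 l). grad l (\<lambda>x. cnj (g x)) x = (\<chi> j. cnj (grad l g x $ j))"
  using in_H1p_map[of cnj 1 l g, OF bounded_linear_cnj _ weak_gradient_cnj assms] by simp_all

text \<open>Constants serve as test functions for the solvability conditions and as the free part of
  every solution of a cell problem.\<close>

lemma in_H1p_const:
  shows "in_H1p l (\<lambda>x. a)" "AE x in lebesgue_on (box 0 l). grad l (\<lambda>x. a) x = 0"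
proof -
  have *: "in_H1 l (\<lambda>x. a)" "AE x in lebesgue_on (box 0 l). grad l (\<lambda>x. a) x = 0"
    using grad_eqI[of l "\<lambda>x. a" "\<lambda>x. 0"] in_L2_const weak_gradient_const by auto
  show "AE x in lebesgue_on (box 0 l). grad l (\<lambda>x. a) x = 0" by fact
  have "L2_dist_sq l (\<lambda>x. 0) (\<lambda>x. grad l (\<lambda>x. a) x $ i) = L2_dist_sq l (\<lambda>x. 0) (\<lambda>x. 0)" for i
  proof (rule L2_dist_sq_cong_AE)
    show "AE x in lebesgue_on (box 0 l). grad l (\<lambda>x. a) x $ i = 0"
      using *(2) by eventually_elim simp
  qed (use * in \<open>auto intro!: grad_props in_L2_const\<close>)
  then have "has_trace l (\<lambda>x. a) j c (\<lambda>x. a)" for j c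
    unfolding has_trace_def
    by (intro conjI exI[of _ "\<lambda>n x. a"]) (auto simp: smooth_const partial_deriv_const in_L2_const L2_dist_sq_def)
  then show "in_H1p l (\<lambda>x. a)" using *(1) unfolding in_H1p_def by blast
qed

section \<open>Functions with zero gradient\<close>

text \<open>The substitution has Jacobian \<open>c ^ CARD('d)\<close>, which is at least (1/2)^d. A
  factor uniform in \<open>c\<close> is wanted because \<open>c\<close> is integrated
  afterwards.\<close>

lemma nn_integral_affine_le:
  fixes g :: "real^'d::finite \<Rightarrow> ennreal"
  assumes [measurable]: "g \<in> borel_measurable borel" and c: "c \<ge> 1/2"
  shows "(\<integral>\<^sup>+x. g (a + c *\<^sub>R x) \<partial>lborel) \<le> 2 ^ CARD('d) * (\<integral>\<^sup>+x. g x \<partial>lborel)"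
proof -
  let ?n = "CARD('d)"
  have "(\<integral>\<^sup>+x. g x \<partial>lborel) =
      (\<integral>\<^sup>+x. g x \<partial>density (distr lborel borel (\<lambda>x. a + c *\<^sub>R x)) (\<lambda>_. ennreal (\<bar>c\<bar> ^ ?n)))"
    using lborel_affine[of c a] c by simp
  also have "\<dots> = ennreal (c ^ ?n) * (\<integral>\<^sup>+x. g (a + c *\<^sub>R x) \<partial>lborel)"
    using c by (simp add: nn_integral_density nn_integral_distr nn_integral_cmult)
  finally have *: "(\<integral>\<^sup>+x. g x \<partial>lborel) = ennreal (c ^ ?n) * (\<integral>\<^sup>+x. g (a + c *\<^sub>R x) \<partial>lborel)" .
  have "1 \<le> (2 * c) ^ ?n" using c by (intro one_le_power) simp
  then have "1 \<le> ennreal ((2 * c) ^ ?n)" by (metis ennreal_1 ennreal_leI)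
  also have "\<dots> = 2 ^ ?n * ennreal (c ^ ?n)"
    using c by (simp add: power_mult_distrib ennreal_mult ennreal_power[symmetric])
  finally have "1 * (\<integral>\<^sup>+x. g (a + c *\<^sub>R x) \<partial>lborel) \<le>
      2 ^ ?n * ennreal (c ^ ?n) * (\<integral>\<^sup>+x. g (a + c *\<^sub>R x) \<partial>lborel)"
    by (rule mult_right_mono) simp
  then show ?thesis unfolding * by (simp add: mult.assoc)
qed

text \<open>Of the two end points the one with the larger weight is integrated first, so that the affine
  substitution costs at most a factor \<open>2\<close> in each dimension.\<close>

lemma nn_integral_segment_le:
  fixes g :: "real^'d::finite \<Rightarrow> ennreal"
  assumes [measurable]: "g \<in> borel_measurable borel" and c: "0 \<le> c" "c \<le> 1"
    and B[measurable]: "B \<in> sets borel"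
  shows "(\<integral>\<^sup>+y. \<integral>\<^sup>+x. indicator B x * indicator B y * g ((1 - c) *\<^sub>R y + c *\<^sub>R x) \<partial>lborel \<partial>lborel)
    \<le> 2 ^ CARD('d) * emeasure lborel B * (\<integral>\<^sup>+x. g x \<partial>lborel)"
proof -
  have *: "(\<integral>\<^sup>+y. \<integral>\<^sup>+x. indicator B x * indicator B y * g ((1 - c) *\<^sub>R y + c *\<^sub>R x) \<partial>lborel \<partial>lborel)
    \<le> 2 ^ CARD('d) * emeasure lborel B * (\<integral>\<^sup>+x. g x \<partial>lborel)" if c: "c \<ge> 1/2" for c
  proof -
    have "(\<integral>\<^sup>+x. indicator B x * indicator B y * g ((1 - c) *\<^sub>R y + c *\<^sub>R x) \<partial>lborel)
        \<le> indicator B y * (2 ^ CARD('d) * (\<integral>\<^sup>+x. g x \<partial>lborel))" for y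
    proof -
      have "(\<integral>\<^sup>+x. indicator B x * indicator B y * g ((1 - c) *\<^sub>R y + c *\<^sub>R x) \<partial>lborel)
        \<le> (\<integral>\<^sup>+x. indicator B y * g ((1 - c) *\<^sub>R y + c *\<^sub>R x) \<partial>lborel)"
        by (intro nn_integral_mono) (auto simp: indicator_def)
      also have "\<dots> = indicator B y * (\<integral>\<^sup>+x. g ((1 - c) *\<^sub>R y + c *\<^sub>R x) \<partial>lborel)"
        by (simp add: nn_integral_cmult)
      also have "\<dots> \<le> indicator B y * (2 ^ CARD('d) * (\<integral>\<^sup>+x. g x \<partial>lborel))"
        by (intro mult_left_mono nn_integral_affine_le c) auto
      finally show ?thesis .
    qed
    then have "(\<integral>\<^sup>+y. \<integral>\<^sup>+x. indicator B x * indicator B y * g ((1 - c) *\<^sub>R y + c *\<^sub>R x) \<partial>lborel \<partial>lborel)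
        \<le> (\<integral>\<^sup>+y. indicator B y * (2 ^ CARD('d) * (\<integral>\<^sup>+x. g x \<partial>lborel)) \<partial>lborel)"
      by (intro nn_integral_mono)
    also have "\<dots> = 2 ^ CARD('d) * emeasure lborel B * (\<integral>\<^sup>+x. g x \<partial>lborel)"
      by (simp add: nn_integral_multc mult_ac)
    finally show ?thesis .
  qed
  show ?thesis
  proof (cases "c \<ge> 1/2")
    case True
    then show ?thesis by (rule *)
  next
    case False
    have "(\<integral>\<^sup>+y. \<integral>\<^sup>+x. indicator B x * indicator B y * g ((1 - c) *\<^sub>R y + c *\<^sub>R x) \<partial>lborel \<partial>lborel) =
        (\<integral>\<^sup>+x. \<integral>\<^sup>+y. indicator B x * indicator B y * g ((1 - c) *\<^sub>R y + c *\<^sub>R x) \<partial>lborel \<partial>lborel)"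
      by (rule lborel_pair.Fubini'[symmetric]) measurable
    also have "\<dots> = (\<integral>\<^sup>+y. \<integral>\<^sup>+x. indicator B x * indicator B y *
        g ((1 - (1 - c)) *\<^sub>R y + (1 - c) *\<^sub>R x) \<partial>lborel \<partial>lborel)"
      by (simp add: mult_ac add.commute)
    also have "\<dots> \<le> 2 ^ CARD('d) * emeasure lborel B * (\<integral>\<^sup>+x. g x \<partial>lborel)"
      by (rule *) (use False in simp)
    finally show ?thesis .
  qed
qed

text \<open>The increment between two points is the integral of the derivative along their segment.
  After Tonelli the parameter \<open>c\<close> of the segment is outermost, and for fixed
  \<open>c\<close> the double integral over end points is controlled by
  \<open>nn_integral_segment_le\<close>.\<close>

lemma smooth_poincare:
  fixes \<phi> :: "real^'d::finite \<Rightarrow> complex"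
  assumes \<phi>: "smooth \<phi>" and B[measurable]: "B \<in> sets borel" "convex B"
    and R: "\<And>x y j. x \<in> B \<Longrightarrow> y \<in> B \<Longrightarrow> \<bar>x $ j - y $ j\<bar> \<le> R"
  shows "(\<integral>\<^sup>+y. \<integral>\<^sup>+x. indicator B x * indicator B y * ennreal (norm (\<phi> x - \<phi> y)) \<partial>lborel \<partial>lborel)
    \<le> ennreal R * (2 ^ CARD('d) * emeasure lborel B *
        (\<integral>\<^sup>+x. indicator B x * ennreal (\<Sum>j\<in>UNIV. norm (partial_deriv j \<phi> x)) \<partial>lborel))"
proof -
  define s where "s x = (\<Sum>j\<in>UNIV. norm (partial_deriv j \<phi> x))" for x
  \<comment> \<open>Extension by zero outside \<open>B\<close> lets the affine substitution run over
    the whole space; convexity of \<open>B\<close> ensures that nothing is lost along the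
    segments.\<close>
  define g where "g x = indicator B x * ennreal (s x)" for x
  have cont: "continuous_on S \<phi>" "continuous_on S (partial_deriv j \<phi>)" for S j
    using \<phi> by (auto intro: smooth_continuous smooth_partial_deriv)
  have s_cont: "continuous_on S s" for S
    unfolding s_def by (intro continuous_intros cont)
  have [measurable]: "s \<in> borel_measurable borel" "\<phi> \<in> borel_measurable borel"
    using cont s_cont by (auto intro: borel_measurable_continuous_onI)
  have [measurable]: "g \<in> borel_measurable borel" unfolding g_def by measurable
  have s0: "0 \<le> s x" for x by (simp add: s_def sum_nonneg)
  have seg: "ennreal (norm (\<phi> x - \<phi> y)) \<le>
      ennreal R * (\<integral>\<^sup>+c. indicator {0..1} c * g ((1 - c) *\<^sub>R y + c *\<^sub>R x) \<partial>lborel)"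
    if x: "x \<in> B" "y \<in> B" for x y
  proof -
    define p where "p c = y + c *\<^sub>R (x - y)" for c
    have p: "p c = (1 - c) *\<^sub>R y + c *\<^sub>R x" for c by (simp add: p_def algebra_simps)
    have p_cont: "continuous_on S p" for S
      unfolding p_def by (intro continuous_intros)
    define F where "F c = (\<Sum>j\<in>UNIV. (x - y) $ j *\<^sub>R partial_deriv j \<phi> (p c))" for c
    have F_cont: "continuous_on S F" for S
      unfolding F_def by (intro continuous_intros continuous_on_compose2[OF cont(2)[of UNIV] p_cont]) auto
    have F_int: "set_integrable lborel {0..1} F"
      unfolding set_integrable_def by (intro borel_integrable_compact F_cont) auto
    have R0: "0 \<le> R" using R[OF x(1) x(1)] by simp
    have F_le: "norm (F c) \<le> R * s (p c)" for c
    proof -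
      have "norm (F c) \<le> (\<Sum>j\<in>UNIV. norm ((x - y) $ j *\<^sub>R partial_deriv j \<phi> (p c)))"
        unfolding F_def by (rule norm_sum)
      also have "\<dots> \<le> (\<Sum>j\<in>UNIV. R * norm (partial_deriv j \<phi> (p c)))"
        using R[OF x] by (intro sum_mono) (auto intro!: mult_right_mono)
      finally show ?thesis by (simp add: s_def sum_distrib_left)
    qed
    have "(F has_integral (\<phi> (p 1) - \<phi> (p 0))) {0..1}"
      unfolding F_def p_def
      by (intro fundamental_theorem_of_calculus smooth_line_derivative \<phi>) simp
    then have "\<phi> x - \<phi> y = (LINT c:{0..1}|lborel. F c)"
      using set_borel_integral_eq_integral(2)[OF F_int] by (simp add: integral_unique p_def)
    then have "ennreal (norm (\<phi> x - \<phi> y)) \<le> (\<integral>\<^sup>+c. norm (indicator {0..1} c *\<^sub>R F c) \<partial>lborel)"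
      unfolding set_lebesgue_integral_def
      using integral_norm_bound_ennreal[OF F_int[unfolded set_integrable_def]] by simp
    also have "\<dots> \<le> (\<integral>\<^sup>+c. ennreal R * (indicator {0..1} c * g (p c)) \<partial>lborel)"
    proof (rule nn_integral_mono)
      fix c
      show "ennreal (norm (indicator {0..1} c *\<^sub>R F c)) \<le> ennreal R * (indicator {0..1} c * g (p c))"
      proof (cases "c \<in> {0..1}")
        case True
        then have "p c \<in> B" unfolding p using x B(2) by (auto intro: convexD)
        then show ?thesis
          using True F_le[of c] R0 s0 by (simp add: g_def ennreal_mult[symmetric] ennreal_leI)
      qed simp
    qed
    also have "\<dots> = ennreal R * (\<integral>\<^sup>+c. indicator {0..1} c * g (p c) \<partial>lborel)"
      unfolding p by (rule nn_integral_cmult) measurable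
    finally show ?thesis unfolding p .
  qed
  have fin: "pair_sigma_finite (lborel :: real measure) (lborel :: (real^'d) measure)"
    by (intro pair_sigma_finite.intro lborel.sigma_finite_measure_axioms)
  \<comment> \<open>The cutoffs in \<open>x\<close>, \<open>y\<close> and \<open>c\<close> are
    gathered in one nonnegative integrand, so that \<open>c\<close> can be moved outwards past
    \<open>x\<close> and then past \<open>y\<close>.\<close>
  let ?h = "\<lambda>c y x. indicator {0..1} c * (indicator B x * indicator B y * g ((1 - c) *\<^sub>R y + c *\<^sub>R x))"
  have "(\<integral>\<^sup>+y. \<integral>\<^sup>+x. indicator B x * indicator B y * ennreal (norm (\<phi> x - \<phi> y)) \<partial>lborel \<partial>lborel)
      \<le> (\<integral>\<^sup>+y. \<integral>\<^sup>+x. ennreal R * (\<integral>\<^sup>+c. ?h c y x \<partial>lborel) \<partial>lborel \<partial>lborel)"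
  proof (intro nn_integral_mono)
    fix x y
    have "(\<integral>\<^sup>+c. ?h c y x \<partial>lborel) = indicator B x * indicator B y *
        (\<integral>\<^sup>+c. indicator {0..1} c * g ((1 - c) *\<^sub>R y + c *\<^sub>R x) \<partial>lborel)"
      by (subst nn_integral_cmult[symmetric]) (auto simp: mult_ac)
    then show "indicator B x * indicator B y * ennreal (norm (\<phi> x - \<phi> y)) \<le>
        ennreal R * (\<integral>\<^sup>+c. ?h c y x \<partial>lborel)"
      using seg[of x y] by (auto simp: indicator_def)
  qed
  also have "\<dots> = ennreal R * (\<integral>\<^sup>+y. \<integral>\<^sup>+x. \<integral>\<^sup>+c. ?h c y x \<partial>lborel \<partial>lborel \<partial>lborel)"
    by (simp add: nn_integral_cmult)
  also have "(\<integral>\<^sup>+y. \<integral>\<^sup>+x. \<integral>\<^sup>+c. ?h c y x \<partial>lborel \<partial>lborel \<partial>lborel) =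
      (\<integral>\<^sup>+y. \<integral>\<^sup>+c. \<integral>\<^sup>+x. ?h c y x \<partial>lborel \<partial>lborel \<partial>lborel)"
    by (intro nn_integral_cong pair_sigma_finite.Fubini'[OF fin]) measurable
  also have "\<dots> = (\<integral>\<^sup>+c. \<integral>\<^sup>+y. \<integral>\<^sup>+x. ?h c y x \<partial>lborel \<partial>lborel \<partial>lborel)"
    by (rule pair_sigma_finite.Fubini'[OF fin]) measurable
  also have "\<dots> \<le> (\<integral>\<^sup>+c. indicator {0..1} c * (2 ^ CARD('d) * emeasure lborel B * (\<integral>\<^sup>+x. g x \<partial>lborel)) \<partial>(lborel :: real measure))"
  proof (rule nn_integral_mono)
    fix c :: real
    have "(\<integral>\<^sup>+y. \<integral>\<^sup>+x. ?h c y x \<partial>lborel \<partial>lborel) = indicator {0..1} c *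
        (\<integral>\<^sup>+y. \<integral>\<^sup>+x. indicator B x * indicator B y * g ((1 - c) *\<^sub>R y + c *\<^sub>R x) \<partial>lborel \<partial>lborel)"
      by (simp add: nn_integral_cmult)
    also have "\<dots> \<le> indicator {0..1} c * (2 ^ CARD('d) * emeasure lborel B * (\<integral>\<^sup>+x. g x \<partial>lborel))"
      by (cases "c \<in> {0..1}") (use nn_integral_segment_le[of g c B] in auto)
    finally show "(\<integral>\<^sup>+y. \<integral>\<^sup>+x. ?h c y x \<partial>lborel \<partial>lborel) \<le>
      indicator {0..1} c * (2 ^ CARD('d) * emeasure lborel B * (\<integral>\<^sup>+x. g x \<partial>lborel))" .
  qed
  also have "\<dots> = 2 ^ CARD('d) * emeasure lborel B * (\<integral>\<^sup>+x. g x \<partial>lborel)"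
    by (simp add: nn_integral_multc)
  finally show ?thesis unfolding g_def s_def by (simp add: mult_left_mono)
qed

section \<open>Poincare inequality on the cell and passage to the limit\<close>

lemma nn_integral_cell:
  assumes "f \<in> borel_measurable borel"
  shows "(\<integral>\<^sup>+x. f x \<partial>lebesgue_on (box 0 l)) = (\<integral>\<^sup>+x. indicator (box 0 l) x * f x \<partial>lborel)"
  by (subst nn_integral_restrict_space) (auto simp: nn_integral_completion mult.commute)

lemma smooth_poincare_cell:
  fixes l :: "real^'d::finite"
  obtains K where "K < \<infinity>" "\<And>\<phi>. smooth \<phi> \<Longrightarrow>
    (\<integral>\<^sup>+y. \<integral>\<^sup>+x. ennreal (norm (\<phi> x - \<phi> y)) \<partial>lebesgue_on (box 0 l) \<partial>lebesgue_on (box 0 l))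
    \<le> K * (\<integral>\<^sup>+x. ennreal (\<Sum>j\<in>UNIV. norm (partial_deriv j \<phi> x)) \<partial>lebesgue_on (box 0 l))"
proof
  \<comment> \<open>The norm of \<open>l\<close> bounds each side of the cell and thus all
    coordinate differences. Finiteness of the constant is essential: later it multiplies a sequence
    tending to 0 in \<open>ennreal\<close>.\<close>
  show "ennreal (norm l) * (2 ^ CARD('d) * emeasure lborel (box 0 l)) < \<infinity>"
    using emeasure_lborel_box_finite[of 0 l]
    by (auto simp: ennreal_mult_eq_top_iff power_eq_top_ennreal less_top[symmetric])
  fix \<phi> :: "real^'d \<Rightarrow> complex" assume \<phi>: "smooth \<phi>"
  have cont: "continuous_on S \<phi>" "continuous_on S (partial_deriv j \<phi>)" for S j
    using \<phi> by (auto intro: smooth_continuous smooth_partial_deriv)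
  have [measurable]: "(\<lambda>x. \<Sum>j\<in>UNIV. norm (partial_deriv j \<phi> x)) \<in> borel_measurable borel"
    "\<phi> \<in> borel_measurable borel"
    using cont by (auto intro!: borel_measurable_continuous_onI continuous_intros)
  have "(\<integral>\<^sup>+y. \<integral>\<^sup>+x. ennreal (norm (\<phi> x - \<phi> y)) \<partial>lebesgue_on (box 0 l) \<partial>lebesgue_on (box 0 l)) =
      (\<integral>\<^sup>+y. \<integral>\<^sup>+x. indicator (box 0 l) x * ennreal (norm (\<phi> x - \<phi> y)) \<partial>lborel \<partial>lebesgue_on (box 0 l))"
    by (intro nn_integral_cong nn_integral_cell) measurable
  also have "\<dots> = (\<integral>\<^sup>+y. indicator (box 0 l) y * (\<integral>\<^sup>+x. indicator (box 0 l) x * ennreal (norm (\<phi> x - \<phi> y)) \<partial>lborel) \<partial>lborel)"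
    by (intro nn_integral_cell) measurable
  also have "\<dots> = (\<integral>\<^sup>+y. \<integral>\<^sup>+x. indicator (box 0 l) x * indicator (box 0 l) y * ennreal (norm (\<phi> x - \<phi> y)) \<partial>lborel \<partial>lborel)"
    by (subst nn_integral_cmult[symmetric]) (auto simp: mult_ac)
  also have "\<dots> \<le> ennreal (norm l) * (2 ^ CARD('d) * emeasure lborel (box 0 l) *
        (\<integral>\<^sup>+x. indicator (box 0 l) x * ennreal (\<Sum>j\<in>UNIV. norm (partial_deriv j \<phi> x)) \<partial>lborel))"
  proof (rule smooth_poincare[OF \<phi>])
    fix x y j assume "x \<in> box 0 l" "y \<in> box 0 l"
    then have "0 < x $ j \<and> x $ j < l $ j" "0 < y $ j \<and> y $ j < l $ j"
      by (auto simp: mem_box_cart)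
    then show "\<bar>x $ j - y $ j\<bar> \<le> norm l" using component_le_norm_cart[of l j] by linarith
  qed auto
  also have "(\<integral>\<^sup>+x. indicator (box 0 l) x * ennreal (\<Sum>j\<in>UNIV. norm (partial_deriv j \<phi> x)) \<partial>lborel) =
      (\<integral>\<^sup>+x. ennreal (\<Sum>j\<in>UNIV. norm (partial_deriv j \<phi> x)) \<partial>lebesgue_on (box 0 l))"
    by (rule nn_integral_cell[symmetric]) measurable
  finally show "(\<integral>\<^sup>+y. \<integral>\<^sup>+x. ennreal (norm (\<phi> x - \<phi> y)) \<partial>lebesgue_on (box 0 l) \<partial>lebesgue_on (box 0 l))
    \<le> ennreal (norm l) * (2 ^ CARD('d) * emeasure lborel (box 0 l)) *
      (\<integral>\<^sup>+x. ennreal (\<Sum>j\<in>UNIV. norm (partial_deriv j \<phi> x)) \<partial>lebesgue_on (box 0 l))"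
    by (simp add: mult.assoc)
qed

text \<open>Cauchy-Schwarz against the constant 1 on a cell of finite measure.\<close>

lemma L2_dist_imp_L1:
  assumes f: "\<And>n. in_L2 l (f n)" "in_L2 l F" and lim: "(\<lambda>n. L2_dist_sq l (f n) F) \<longlonglongrightarrow> 0"
  shows "(\<lambda>n. \<integral>\<^sup>+x. ennreal (norm (f n x - F x)) \<partial>lebesgue_on (box 0 l)) \<longlonglongrightarrow> 0"
proof -
  let ?M = "lebesgue_on (box 0 l)"
  interpret finite_measure ?M by (rule finite_measure_cell)
  define I where "I n = (LINT x|?M. norm (f n x - F x))" for n
  have diff: "in_L2 l (\<lambda>x. f n x - F x)" for n using f by (rule in_L2_diff)
  have eq: "(\<integral>\<^sup>+x. ennreal (norm (f n x - F x)) \<partial>?M) = ennreal (I n)" for n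
    unfolding I_def using in_L2_integrable[OF diff[of n]] by (intro nn_integral_eq_integral) auto
  have eq2: "(\<integral>\<^sup>+x. (ennreal (norm (f n x - F x)))\<^sup>2 \<partial>?M) = ennreal (L2_dist_sq l (f n) F)" for n
    unfolding L2_dist_sq_def ennreal_power[OF norm_ge_zero]
    using diff[of n] by (intro nn_integral_eq_integral) (auto simp: in_L2_def)
  have I0: "0 \<le> I n" for n by (simp add: I_def)
  have D0: "0 \<le> L2_dist_sq l (f n) F" for n by (simp add: L2_dist_sq_def)
  define m where "m = measure ?M (box 0 l)"
  have le: "(I n)\<^sup>2 \<le> L2_dist_sq l (f n) F * m" for n
  proof -
    have "(ennreal (I n))\<^sup>2 = (\<integral>\<^sup>+x. ennreal (norm (f n x - F x)) * 1 \<partial>?M)\<^sup>2"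
      unfolding eq[symmetric] by simp
    also have "\<dots> \<le> (\<integral>\<^sup>+x. (ennreal (norm (f n x - F x)))\<^sup>2 \<partial>?M) * (\<integral>\<^sup>+x. 1\<^sup>2 \<partial>?M)"
      by (rule Cauchy_Schwarz_nn_integral) (use in_L2_measurable[OF diff[of n]] in auto)
    also have "\<dots> = ennreal (L2_dist_sq l (f n) F * m)"
      using D0 unfolding eq2 m_def by (simp add: emeasure_eq_measure ennreal_mult)
    finally show ?thesis
      using I0 D0 by (simp add: ennreal_power ennreal_le_iff m_def)
  qed
  have sqrt: "(\<lambda>n. sqrt (L2_dist_sq l (f n) F * m)) \<longlonglongrightarrow> sqrt (0 * m)"
    by (intro tendsto_intros lim)
  have "I \<longlonglongrightarrow> 0"
  proof (rule tendsto_sandwich[OF _ _ tendsto_const])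
    show "(\<lambda>n. sqrt (L2_dist_sq l (f n) F * m)) \<longlonglongrightarrow> 0" using sqrt by simp
    show "\<forall>\<^sub>F n in sequentially. I n \<le> sqrt (L2_dist_sq l (f n) F * m)"
      using le by (intro always_eventually allI real_le_rsqrt)
  qed (use I0 in auto)
  then show ?thesis unfolding eq using tendsto_ennrealI by force
qed

text \<open>The Poincare inequality for smooth approximants passes to the limit and shows that |r(x)
  - r(y)| has zero double integral; freezing a suitable \<open>y\<close> yields the
  constant.\<close>

lemma zero_grad_imp_const:
  fixes l :: "real^'d::finite"
  assumes r: "in_H1p l r" and 0: "AE x in lebesgue_on (box 0 l). grad l r x = 0"
  obtains c where "AE x in lebesgue_on (box 0 l). r x = c"
proof -
  let ?M = "lebesgue_on (box 0 l)"
  interpret finite_measure ?M by (rule finite_measure_cell)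
  interpret P: pair_sigma_finite ?M ?M ..
  obtain K where K: "K < \<infinity>" "\<And>\<phi>. smooth \<phi> \<Longrightarrow>
    (\<integral>\<^sup>+y. \<integral>\<^sup>+x. ennreal (norm (\<phi> x - \<phi> y)) \<partial>?M \<partial>?M)
    \<le> K * (\<integral>\<^sup>+x. ennreal (\<Sum>j\<in>UNIV. norm (partial_deriv j \<phi> x)) \<partial>?M)"
    by (rule smooth_poincare_cell[of l]) (rule that; assumption)
  have H1: "in_H1 l r" and L2: "in_L2 l r" using r by (auto simp: in_H1p_def in_H1_def)
  have r_meas[measurable]: "r \<in> borel_measurable ?M" using L2 by (rule in_L2_measurable)
  \<comment> \<open>Having a trace includes H^1 approximation by smooth functions; the sequence
    belonging to any one face serves.\<close>
  obtain \<phi> where \<phi>: "\<And>n::nat. smooth (\<phi> n)" "(\<lambda>n. L2_dist_sq l (\<phi> n) r) \<longlonglongrightarrow> 0"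
    "\<And>i. (\<lambda>n. L2_dist_sq l (partial_deriv i (\<phi> n)) (\<lambda>x. grad l r x $ i)) \<longlonglongrightarrow> 0"
    using r unfolding in_H1p_def has_trace_def by blast
  have [measurable]: "\<phi> n \<in> borel_measurable ?M" "partial_deriv i (\<phi> n) \<in> borel_measurable ?M" for n i
    using \<phi>(1) by (auto intro!: in_L2_measurable in_L2_smooth)
  define a where "a n = (\<integral>\<^sup>+x. ennreal (norm (\<phi> n x - r x)) \<partial>?M)" for n
  define b where "b n = (\<Sum>i\<in>UNIV. \<integral>\<^sup>+x. ennreal (norm (partial_deriv i (\<phi> n) x - grad l r x $ i)) \<partial>?M)" for n
  have a: "a \<longlonglongrightarrow> 0"
    unfolding a_def by (intro L2_dist_imp_L1 \<phi> in_L2_smooth L2)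
  have "b \<longlonglongrightarrow> (\<Sum>i::'d\<in>UNIV. 0)"
    unfolding b_def by (intro tendsto_sum L2_dist_imp_L1 \<phi> in_L2_smooth grad_props H1)
  then have b: "b \<longlonglongrightarrow> 0" by simp
  \<comment> \<open>As the gradient of \<open>r\<close> vanishes, the gradients of the approximants
    coincide almost everywhere with the gradient errors in \<open>b\<close>, which tend to
    0.\<close>
  have b_eq: "(\<integral>\<^sup>+x. ennreal (\<Sum>j\<in>UNIV. norm (partial_deriv j (\<phi> n) x)) \<partial>?M) = b n" for n
  proof -
    have "(\<integral>\<^sup>+x. ennreal (\<Sum>j\<in>UNIV. norm (partial_deriv j (\<phi> n) x)) \<partial>?M) =
        (\<Sum>j\<in>UNIV. \<integral>\<^sup>+x. ennreal (norm (partial_deriv j (\<phi> n) x)) \<partial>?M)"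
      by (subst nn_integral_sum[symmetric]) (auto simp: sum_ennreal)
    also have "\<dots> = b n"
      unfolding b_def
    proof (intro sum.cong refl nn_integral_cong_AE)
      fix j
      show "AE x in ?M. ennreal (norm (partial_deriv j (\<phi> n) x)) =
          ennreal (norm (partial_deriv j (\<phi> n) x - grad l r x $ j))"
        using 0 by eventually_elim simp
    qed
    finally show ?thesis .
  qed
  define T where "T = (\<integral>\<^sup>+y. \<integral>\<^sup>+x. ennreal (norm (r x - r y)) \<partial>?M \<partial>?M)"
  define m where "m = emeasure ?M (space ?M)"
  \<comment> \<open>Of the three terms of the triangle inequality two depend on one variable only;
    each integrates to \<open>m * a n\<close>, which explains the factor 2.\<close>
  have T_le: "T \<le> 2 * m * a n + K * b n" for n
  proof -
    have "T \<le> (\<integral>\<^sup>+y. \<integral>\<^sup>+x. (ennreal (norm (\<phi> n x - r x)) + ennreal (norm (\<phi> n x - \<phi> n y)))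
        + ennreal (norm (\<phi> n y - r y)) \<partial>?M \<partial>?M)"
      unfolding T_def
    proof (intro nn_integral_mono)
      fix x y
      have "norm (r x - r y) \<le> norm (\<phi> n x - r x) + norm (\<phi> n x - \<phi> n y) + norm (\<phi> n y - r y)"
        by norm
      then show "ennreal (norm (r x - r y)) \<le> (ennreal (norm (\<phi> n x - r x)) + ennreal (norm (\<phi> n x - \<phi> n y)))
        + ennreal (norm (\<phi> n y - r y))"
        by (simp add: ennreal_plus[symmetric] ennreal_leI del: ennreal_plus)
    qed
    also have "\<dots> = (\<integral>\<^sup>+y. (a n + (\<integral>\<^sup>+x. ennreal (norm (\<phi> n x - \<phi> n y)) \<partial>?M))
        + ennreal (norm (\<phi> n y - r y)) * m \<partial>?M)"
      unfolding a_def m_def by (simp add: nn_integral_add)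
    also have "\<dots> = a n * m + (\<integral>\<^sup>+y. \<integral>\<^sup>+x. ennreal (norm (\<phi> n x - \<phi> n y)) \<partial>?M \<partial>?M) + a n * m"
      by (simp add: nn_integral_add nn_integral_multc a_def[symmetric] m_def)
    also have "\<dots> \<le> a n * m + K * b n + a n * m"
      using K(2)[OF \<phi>(1)[of n]] unfolding b_eq by (intro add_mono) auto
    also have "\<dots> = (m * a n + m * a n) + K * b n"
      by (simp add: ac_simps)
    also have "m * a n + m * a n = 2 * m * a n"
      by (metis mult_2 mult.assoc)
    finally show ?thesis .
  qed
  have "(\<lambda>n. 2 * m * a n + K * b n) \<longlonglongrightarrow> 2 * m * 0 + K * 0"
  proof (intro tendsto_add ennreal_tendsto_cmult a b)
    show "2 * m < top" unfolding m_def using emeasure_finite[of "space ?M"]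
      by (auto simp: ennreal_mult_eq_top_iff less_top[symmetric])
    show "K < top" using K(1) by simp
  qed
  then have "T \<le> 2 * m * 0 + K * 0"
    by (rule LIMSEQ_le_const) (use T_le in auto)
  then have "T = 0" by simp
  then have "AE y in ?M. (\<integral>\<^sup>+x. ennreal (norm (r x - r y)) \<partial>?M) = 0"
    unfolding T_def by (subst (asm) nn_integral_0_iff_AE) auto
  then have AE: "AE y in ?M. AE x in ?M. r x = r y"
    by eventually_elim (subst (asm) nn_integral_0_iff_AE, auto)
  show ?thesis
  proof (cases "\<exists>y. AE x in ?M. r x = r y")
    case True
    then show ?thesis using that by blast
  next
    \<comment> \<open>Without any such \<open>y\<close> the cell is a null set, and every constant
      will do.\<close>
    case False
    with AE have "AE y in ?M. False" by simp
    then have "AE x in ?M. r x = 0" by eventually_elim simp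
    then show ?thesis by (rule that)
  qed
qed

section \<open>Weak form of periodic problems\<close>

text \<open>Since \<open>grad\<close> is a choice up to null sets, gradients are carried along as explicit
  representatives \<open>v\<close>, which add up pointwise.\<close>

definition per_pair :: "real^'d::finite \<Rightarrow> (real^'d \<Rightarrow> complex) \<Rightarrow> (real^'d \<Rightarrow> complex^'d) \<Rightarrow> bool" where
  "per_pair l r v \<longleftrightarrow> in_H1p l r \<and> (\<forall>j. in_L2 l (\<lambda>x. v x $ j)) \<and>
     (AE x in lebesgue_on (box 0 l). grad l r x = v x)"

text \<open>Square integrability excludes the junk value \<open>0\<close> of non-integrable integrands, on which
  linearity of \<open>weak_div_eq\<close> would fail.\<close>

definition weak_div_L2 ::
  "real^'d::finite \<Rightarrow> (real^'d \<Rightarrow> 'd \<Rightarrow> complex) \<Rightarrow> (real^'d \<Rightarrow> complex) \<Rightarrow> bool" where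
  "weak_div_L2 l F f \<longleftrightarrow> (\<forall>j. in_L2 l (\<lambda>x. F x j)) \<and> in_L2 l f \<and> weak_div_eq l F f"

lemma per_pairD:
  assumes "per_pair l r v"
  shows "in_H1p l r" "in_L2 l r" "in_L2 l (\<lambda>x. v x $ j)"
    "AE x in lebesgue_on (box 0 l). grad l r x = v x"
  using assms by (auto simp: per_pair_def in_H1p_def in_H1_def)

lemma per_pair_grad: "in_H1p l r \<Longrightarrow> per_pair l r (grad l r)"
  by (auto simp: per_pair_def in_H1p_def intro: grad_props)

lemma per_pair_const: "per_pair l (\<lambda>x. a) (\<lambda>x. 0)"
  using in_H1p_const[of l a] by (simp add: per_pair_def in_L2_const)

lemma per_pair_add:
  assumes "per_pair l r v" "per_pair l s w"
  shows "per_pair l (\<lambda>x. r x + s x) (\<lambda>x. v x + w x)"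
  unfolding per_pair_def
proof (intro conjI allI)
  show "in_H1p l (\<lambda>x. r x + s x)" using assms by (intro in_H1p_add per_pairD)
  show "in_L2 l (\<lambda>x. (v x + w x) $ j)" for j using assms by (auto intro!: in_L2_add per_pairD(3))
  show "AE x in lebesgue_on (box 0 l). grad l (\<lambda>x. r x + s x) x = v x + w x"
    using in_H1p_add(2)[OF per_pairD(1)[OF assms(1)] per_pairD(1)[OF assms(2)]]
      per_pairD(4)[OF assms(1)] per_pairD(4)[OF assms(2)]
    by eventually_elim simp
qed

lemma per_pair_cmult:
  assumes "per_pair l r v"
  shows "per_pair l (\<lambda>x. a * r x) (\<lambda>x. \<chi> j. a * v x $ j)"
  unfolding per_pair_def
proof (intro conjI allI)
  show "in_H1p l (\<lambda>x. a * r x)" using assms by (intro in_H1p_cmult per_pairD)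
  show "in_L2 l (\<lambda>x. (\<chi> j. a * v x $ j) $ j)" for j using assms by (auto intro!: in_L2_cmult per_pairD(3))
  show "AE x in lebesgue_on (box 0 l). grad l (\<lambda>x. a * r x) x = (\<chi> j. a * v x $ j)"
    using in_H1p_cmult(2)[OF per_pairD(1)[OF assms], of a] per_pairD(4)[OF assms]
    by eventually_elim simp
qed

lemma per_pair_sum:
  assumes "finite I" "\<And>i. i \<in> I \<Longrightarrow> per_pair l (r i) (v i)"
  shows "per_pair l (\<lambda>x. \<Sum>i\<in>I. r i x) (\<lambda>x. \<Sum>i\<in>I. v i x)"
  using assms
  by (induction I rule: finite_induct) (auto intro: per_pair_add per_pair_const)

lemma weak_div_L2D:
  assumes "weak_div_L2 l F f"
  shows "in_L2 l (\<lambda>x. F x j)" "in_L2 l f"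
  using assms by (auto simp: weak_div_L2_def)

lemma flux_integrable:
  assumes "\<And>j. in_L2 l (\<lambda>x. F x j)" "\<And>j. in_L2 l (\<lambda>x. v x $ j)"
  shows "integrable (lebesgue_on (box 0 l)) (\<lambda>x. \<Sum>j\<in>UNIV. F x j * v x $ j)"
  using assms by (intro Bochner_Integration.integrable_sum in_L2_mult_integrable)

text \<open>Square integrability permits splitting the single integral of \<open>weak_div_eq\<close>
  into flux and source. Quantifying over pairs \<open>r\<close>, \<open>v\<close> allows any
  representative of the test gradient.\<close>

lemma weak_div_eq_iff:
  assumes "\<And>j. in_L2 l (\<lambda>x. F x j)" "in_L2 l f"
  shows "weak_div_eq l F f \<longleftrightarrow> (\<forall>r v. per_pair l r v \<longrightarrow>
    (LINT x|lebesgue_on (box 0 l). (\<Sum>j\<in>UNIV. F x j * v x $ j)) = (LINT x|lebesgue_on (box 0 l). f x * r x))"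
proof -
  have *: "(LINT x|lebesgue_on (box 0 l). - (\<Sum>j\<in>UNIV. F x j * grad l r x $ j) + f x * r x) =
      - (LINT x|lebesgue_on (box 0 l). (\<Sum>j\<in>UNIV. F x j * v x $ j)) + (LINT x|lebesgue_on (box 0 l). f x * r x)"
    if r: "per_pair l r v" for r v
  proof -
    have H1: "in_H1 l r" using r by (auto simp: per_pair_def in_H1p_def)
    note int = flux_integrable[OF assms(1) grad_props(1)[OF H1]] flux_integrable[OF assms(1) per_pairD(3)[OF r]]
      in_L2_mult_integrable[OF assms(2) per_pairD(2)[OF r]]
    have "(LINT x|lebesgue_on (box 0 l). (\<Sum>j\<in>UNIV. F x j * grad l r x $ j)) =
      (LINT x|lebesgue_on (box 0 l). (\<Sum>j\<in>UNIV. F x j * v x $ j))"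
    proof (intro integral_cong_AE borel_measurable_integrable int)
      show "AE x in lebesgue_on (box 0 l). (\<Sum>j\<in>UNIV. F x j * grad l r x $ j) = (\<Sum>j\<in>UNIV. F x j * v x $ j)"
        using per_pairD(4)[OF r] by eventually_elim simp
    qed
    then show ?thesis using int by simp
  qed
  show ?thesis
  proof
    assume L: "weak_div_eq l F f"
    show "\<forall>r v. per_pair l r v \<longrightarrow> (LINT x|lebesgue_on (box 0 l). (\<Sum>j\<in>UNIV. F x j * v x $ j)) =
        (LINT x|lebesgue_on (box 0 l). f x * r x)"
    proof (intro allI impI)
      fix r v assume r: "per_pair l r v"
      have "(LINT x|lebesgue_on (box 0 l). - (\<Sum>j\<in>UNIV. F x j * grad l r x $ j) + f x * r x) = 0"
        using L per_pairD(1)[OF r] by (simp add: weak_div_eq_def)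
      then show "(LINT x|lebesgue_on (box 0 l). (\<Sum>j\<in>UNIV. F x j * v x $ j)) =
        (LINT x|lebesgue_on (box 0 l). f x * r x)" unfolding *[OF r] by simp
    qed
  next
    assume R: "\<forall>r v. per_pair l r v \<longrightarrow> (LINT x|lebesgue_on (box 0 l). (\<Sum>j\<in>UNIV. F x j * v x $ j)) =
        (LINT x|lebesgue_on (box 0 l). f x * r x)"
    show "weak_div_eq l F f"
      unfolding weak_div_eq_def
    proof (intro allI impI)
      fix r assume "in_H1p l r"
      then have r: "per_pair l r (grad l r)" by (rule per_pair_grad)
      show "(LINT x|lebesgue_on (box 0 l). - (\<Sum>j\<in>UNIV. F x j * grad l r x $ j) + f x * r x) = 0"
        unfolding *[OF r] using R r by simp
    qed
  qed
qed

lemma weak_div_L2_test: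
  assumes "weak_div_L2 l F f" "per_pair l r v"
  shows "(LINT x|lebesgue_on (box 0 l). (\<Sum>j\<in>UNIV. F x j * v x $ j)) = (LINT x|lebesgue_on (box 0 l). f x * r x)"
  using assms weak_div_eq_iff[of l F f] by (simp add: weak_div_L2_def)

lemma weak_div_L2_add:
  assumes "weak_div_L2 l F f" "weak_div_L2 l F' f'"
  shows "weak_div_L2 l (\<lambda>x j. F x j + F' x j) (\<lambda>x. f x + f' x)"
proof -
  have L2: "in_L2 l (\<lambda>x. F x j + F' x j)" "in_L2 l (\<lambda>x. f x + f' x)" for j
    by (intro in_L2_add weak_div_L2D(1)[OF assms(1)] weak_div_L2D(1)[OF assms(2)]
        weak_div_L2D(2)[OF assms(1)] weak_div_L2D(2)[OF assms(2)])+
  have "(LINT x|lebesgue_on (box 0 l). (\<Sum>j\<in>UNIV. (F x j + F' x j) * v x $ j)) =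
      (LINT x|lebesgue_on (box 0 l). (f x + f' x) * r x)" if r: "per_pair l r v" for r v
  proof -
    note int = flux_integrable[OF weak_div_L2D(1)[OF assms(1)] per_pairD(3)[OF r]]
      flux_integrable[OF weak_div_L2D(1)[OF assms(2)] per_pairD(3)[OF r]]
      in_L2_mult_integrable[OF weak_div_L2D(2)[OF assms(1)] per_pairD(2)[OF r]]
      in_L2_mult_integrable[OF weak_div_L2D(2)[OF assms(2)] per_pairD(2)[OF r]]
    show ?thesis
      using int weak_div_L2_test[OF assms(1) r] weak_div_L2_test[OF assms(2) r]
      by (simp add: distrib_right sum.distrib)
  qed
  then show ?thesis using L2 by (simp add: weak_div_L2_def weak_div_eq_iff)
qed

lemma weak_div_L2_cmult:
  assumes "weak_div_L2 l F f"
  shows "weak_div_L2 l (\<lambda>x j. a * F x j) (\<lambda>x. a * f x)"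
proof -
  have L2: "in_L2 l (\<lambda>x. a * F x j)" "in_L2 l (\<lambda>x. a * f x)" for j
    by (intro in_L2_cmult weak_div_L2D(1)[OF assms] weak_div_L2D(2)[OF assms])+
  have "(LINT x|lebesgue_on (box 0 l). (\<Sum>j\<in>UNIV. a * F x j * v x $ j)) =
      (LINT x|lebesgue_on (box 0 l). a * f x * r x)" if r: "per_pair l r v" for r v
    using weak_div_L2_test[OF assms r] by (simp add: mult.assoc sum_distrib_left[symmetric])
  then show ?thesis using L2 by (simp add: weak_div_L2_def weak_div_eq_iff)
qed

lemma weak_div_L2_zero: "weak_div_L2 l (\<lambda>x j. 0) (\<lambda>x. 0)"
  by (simp add: weak_div_L2_def in_L2_const weak_div_eq_def)

lemma weak_div_L2_sum:
  assumes "finite I" "\<And>i. i \<in> I \<Longrightarrow> weak_div_L2 l (F i) (f i)"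
  shows "weak_div_L2 l (\<lambda>x j. \<Sum>i\<in>I. F i x j) (\<lambda>x. \<Sum>i\<in>I. f i x)"
  using assms
  by (induction I rule: finite_induct) (auto intro: weak_div_L2_add weak_div_L2_zero)

lemma weak_div_L2_cong_AE:
  assumes "weak_div_L2 l F f" "\<And>j. in_L2 l (\<lambda>x. F' x j)" "in_L2 l f'"
    and AE: "AE x in lebesgue_on (box 0 l). F x = F' x" "AE x in lebesgue_on (box 0 l). f x = f' x"
  shows "weak_div_L2 l F' f'"
proof -
  have "(LINT x|lebesgue_on (box 0 l). (\<Sum>j\<in>UNIV. F' x j * v x $ j)) =
      (LINT x|lebesgue_on (box 0 l). f' x * r x)" if r: "per_pair l r v" for r v
  proof -
    note int = flux_integrable[OF weak_div_L2D(1)[OF assms(1)] per_pairD(3)[OF r]]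
      flux_integrable[OF assms(2) per_pairD(3)[OF r]]
      in_L2_mult_integrable[OF weak_div_L2D(2)[OF assms(1)] per_pairD(2)[OF r]]
      in_L2_mult_integrable[OF assms(3) per_pairD(2)[OF r]]
    have "(LINT x|lebesgue_on (box 0 l). (\<Sum>j\<in>UNIV. F x j * v x $ j)) =
      (LINT x|lebesgue_on (box 0 l). (\<Sum>j\<in>UNIV. F' x j * v x $ j))"
    proof (intro integral_cong_AE borel_measurable_integrable int)
      show "AE x in lebesgue_on (box 0 l). (\<Sum>j\<in>UNIV. F x j * v x $ j) = (\<Sum>j\<in>UNIV. F' x j * v x $ j)"
        using AE(1) by eventually_elim simp
    qed
    moreover have "(LINT x|lebesgue_on (box 0 l). f x * r x) = (LINT x|lebesgue_on (box 0 l). f' x * r x)"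
    proof (intro integral_cong_AE borel_measurable_integrable int)
      show "AE x in lebesgue_on (box 0 l). f x * r x = f' x * r x"
        using AE(2) by eventually_elim simp
    qed
    ultimately show ?thesis using weak_div_L2_test[OF assms(1) r] by simp
  qed
  then show ?thesis using assms(2,3) by (simp add: weak_div_L2_def weak_div_eq_iff)
qed

text \<open>The solvability condition of a periodic problem, obtained by testing with the constant
  1.\<close>

lemma weak_div_L2_mean:
  assumes "weak_div_L2 l F f"
  shows "(LINT x|lebesgue_on (box 0 l). f x) = 0"
  using weak_div_L2_test[OF assms per_pair_const[of l 1]] by simp

section \<open>Uniqueness for the periodic cell problem\<close>

lemma admissible_coeffD:
  assumes "admissible_coeff l a"
  shows "in_L2 l f \<Longrightarrow> in_L2 l (\<lambda>x. complex_of_real (a x) * f x)"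
    and "in_L2 l (\<lambda>x. complex_of_real (a x))"
    and "integrable (lebesgue_on (box 0 l)) a"
proof -
  obtain C where C: "AE x in lebesgue_on (box 0 l). \<bar>a x\<bar> \<le> C"
    using assms by (auto simp: admissible_coeff_def)
  have a[measurable]: "a \<in> borel_measurable (lebesgue_on (box 0 l))"
    using assms by (auto simp: admissible_coeff_def)
  have AE: "AE x in lebesgue_on (box 0 l). norm (complex_of_real (a x)) \<le> C" using C by simp
  show "in_L2 l (\<lambda>x. complex_of_real (a x) * f x)" if "in_L2 l f"
    by (rule in_L2_bounded_mult[OF that _ AE]) measurable
  show L2: "in_L2 l (\<lambda>x. complex_of_real (a x))"
    by (rule in_L2_bounded[OF _ AE]) measurable
  show "integrable (lebesgue_on (box 0 l)) a"
    using in_L2_integrable[OF L2] complex_of_real_integrable_eq by blast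
qed

text \<open>The weak form is bilinear, so the conjugate of \<open>r\<close> is the test function
  that produces the energy, the integral of a |v|^2. The positive lower bound of \<open>a\<close>
  then forces the gradient to vanish.\<close>

lemma cell_problem_unique:
  assumes a: "admissible_coeff l a" and r: "per_pair l r v"
    and eq: "weak_div_L2 l (\<lambda>x j. complex_of_real (a x) * v x $ j) (\<lambda>x. 0)"
  obtains c where "AE x in lebesgue_on (box 0 l). r x = c" "AE x in lebesgue_on (box 0 l). v x = 0"
proof -
  let ?M = "lebesgue_on (box 0 l)"
  have cnj: "per_pair l (\<lambda>x. cnj (r x)) (\<lambda>x. \<chi> j. cnj (v x $ j))"
    unfolding per_pair_def
  proof (intro conjI allI)
    show "in_H1p l (\<lambda>x. cnj (r x))" using r by (intro in_H1p_cnj per_pairD)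
    show "in_L2 l (\<lambda>x. (\<chi> j. cnj (v x $ j)) $ j)" for j using r by (auto intro!: in_L2_cnj per_pairD(3))
    show "AE x in ?M. grad l (\<lambda>x. cnj (r x)) x = (\<chi> j. cnj (v x $ j))"
      using in_H1p_cnj(2)[OF per_pairD(1)[OF r]] per_pairD(4)[OF r] by eventually_elim simp
  qed
  define e where "e x = (\<Sum>j\<in>UNIV. (norm (v x $ j))\<^sup>2)" for x
  have eq1: "(\<Sum>j\<in>UNIV. complex_of_real (a x) * v x $ j * (\<chi> j. cnj (v x $ j)) $ j) = complex_of_real (a x * e x)" for x
    unfolding e_def of_real_mult of_real_sum sum_distrib_left
    by (intro sum.cong refl) (simp add: complex_norm_square[symmetric] mult.assoc)
  have "(LINT x|?M. complex_of_real (a x * e x)) = 0"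
    using weak_div_L2_test[OF eq cnj] unfolding eq1 by simp
  then have 0: "(LINT x|?M. a x * e x) = 0"
    by (simp only: integral_complex_of_real of_real_eq_0_iff)
  have "integrable ?M (\<lambda>x. complex_of_real (a x * e x))"
    unfolding eq1[symmetric] by (intro flux_integrable weak_div_L2D(1)[OF eq] per_pairD(3)[OF cnj])
  then have int: "integrable ?M (\<lambda>x. a x * e x)" using complex_of_real_integrable_eq by blast
  obtain c where c: "c > 0" "AE x in ?M. c \<le> a x" using a by (auto simp: admissible_coeff_def)
  have e0: "0 \<le> e x" for x by (simp add: e_def sum_nonneg)
  have nonneg: "AE x in ?M. 0 \<le> a x * e x"
    using c(2) by eventually_elim (use c(1) e0 in simp)
  have "AE x in ?M. a x * e x = 0"
    using integral_nonneg_eq_0_iff_AE[OF int nonneg] 0 by simp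
  then have v0: "AE x in ?M. v x = 0"
    using c(2)
  proof eventually_elim
    case (elim x)
    then have "e x = 0" using c(1) by simp
    then show ?case by (simp add: e_def sum_nonneg_eq_0_iff vec_eq_iff)
  qed
  have "AE x in ?M. grad l r x = 0" using v0 per_pairD(4)[OF r] by eventually_elim simp
  then obtain k where "AE x in ?M. r x = k" using zero_grad_imp_const[OF per_pairD(1)[OF r]] by blast
  then show ?thesis using v0 by (rule that)
qed

text \<open>In the hierarchy \<open>v\<close> is the gradient of the field of one order and
  \<open>r\<close> the field one order below, so they are independent arguments; \<kappa> stands for
  i khat.\<close>

definition shifted_flux :: "(real^'d::finite \<Rightarrow> real) \<Rightarrow> complex^'d \<Rightarrow> (real^'d \<Rightarrow> complex^'d) \<Rightarrow>
    (real^'d \<Rightarrow> complex) \<Rightarrow> real^'d \<Rightarrow> 'd \<Rightarrow> complex" where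
  "shifted_flux G \<kappa> v r x j = complex_of_real (G x) * (v x $ j + \<kappa> $ j * r x)"

text \<open>The contraction of a flux with \<kappa>, which enters the source of the next
  order.\<close>

definition flux_along :: "(real^'d::finite \<Rightarrow> real) \<Rightarrow> complex^'d \<Rightarrow> (real^'d \<Rightarrow> complex^'d) \<Rightarrow>
    (real^'d \<Rightarrow> complex) \<Rightarrow> real^'d \<Rightarrow> complex" where
  "flux_along G \<kappa> v r x = (\<Sum>j\<in>UNIV. \<kappa> $ j * shifted_flux G \<kappa> v r x j)"

lemma in_L2_flux:
  assumes "admissible_coeff l G" "\<And>j. in_L2 l (\<lambda>x. v x $ j)" "in_L2 l r"
  shows "in_L2 l (\<lambda>x. shifted_flux G \<kappa> v r x j)" "in_L2 l (flux_along G \<kappa> v r)"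
proof -
  show *: "in_L2 l (\<lambda>x. shifted_flux G \<kappa> v r x j)" for j
    unfolding shifted_flux_def by (intro admissible_coeffD(1) in_L2_add in_L2_cmult assms)
  show "in_L2 l (flux_along G \<kappa> v r)"
    unfolding flux_along_def[abs_def] by (intro in_L2_sum in_L2_cmult *)
qed

section \<open>Solution of the hierarchy\<close>

text \<open>That \<open>w\<^sub>1\<close> has no constant part follows from the solvability conditions of the problems for
  \<open>X\<^sub>3\<close> and \<open>E\<^sub>1\<close>.\<close>

lemma hierarchy_means:
  fixes l :: "real^'d::finite" and G \<rho> :: "real^'d \<Rightarrow> real" and \<kappa> :: "complex^'d" and \<omega>2 :: complex
    and X1 X2 X3 E0 E1 w0 w1 w2 w3 :: "real^'d \<Rightarrow> complex"
    and v1 v2 v3 u0 u1 g0 g1 g2 g3 g4 :: "real^'d \<Rightarrow> complex^'d"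
  defines "I f \<equiv> (LINT x|lebesgue_on (box 0 l). f x)"
    and "K \<equiv> flux_along G \<kappa>" and "F \<equiv> shifted_flux G \<kappa>"
    and "\<rho>c x \<equiv> complex_of_real (\<rho> x)"
  assumes vol: "measure (lebesgue_on (box 0 l)) (box 0 l) = 1"
    and G: "admissible_coeff l G" and \<rho>: "admissible_coeff l \<rho>"
    and pair: "per_pair l X1 v1" "per_pair l X2 v2" "per_pair l X3 v3" "per_pair l E0 u0" "per_pair l E1 u1"
      "per_pair l w0 g0" "per_pair l w1 g1" "per_pair l w2 g2" "per_pair l w3 g3"
    and mean0: "I X2 = 0" "I E0 = 0"
    and X1: "weak_div_L2 l (F v1 (\<lambda>x. 1)) (\<lambda>x. 0)"
    and X2: "weak_div_L2 l (F v2 X1) (\<lambda>x. K v1 (\<lambda>x. 1) x - \<rho>c x * (m0 / \<rho>0))"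
    and X3: "weak_div_L2 l (F v3 X2) (\<lambda>x. K v2 X1 x - \<rho>c x * X1 x * (m0 / \<rho>0))"
    and E0: "weak_div_L2 l (F u0 (\<lambda>x. 0)) (\<lambda>x. 1 - \<rho>c x / \<rho>0)"
    and E1: "weak_div_L2 l (F u1 E0) (\<lambda>x. K u0 (\<lambda>x. 0) x - \<rho>c x * X1 x / \<rho>0)"
    and W0: "weak_div_L2 l (F g0 (\<lambda>x. 0)) (\<lambda>x. 0)"
    and W1: "weak_div_L2 l (F g1 w0) (\<lambda>x. K g0 (\<lambda>x. 0) x)"
    and W2: "weak_div_L2 l (F g2 w1) (\<lambda>x. K g1 w0 x + \<omega>2 * \<rho>c x * w0 x + 1)"
    and W3: "weak_div_L2 l (F g3 w2) (\<lambda>x. K g2 w1 x + \<omega>2 * \<rho>c x * w1 x)"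
    and W4: "weak_div_L2 l (F g4 w3) (\<lambda>x. K g3 w2 x + \<omega>2 * \<rho>c x * w2 x)"
    and m0: "m0 = I (K v1 (\<lambda>x. 1))" and \<rho>0: "\<rho>0 = I \<rho>c" "\<rho>0 \<noteq> 0"
    and \<sigma>: "m0 + \<rho>0 * \<omega>2 \<noteq> 0"
  shows "I w0 * (m0 + \<rho>0 * \<omega>2) = - 1"
    and "I w2 * (m0 + \<rho>0 * \<omega>2) = - (I w0 * (I (K v3 X2) + \<omega>2 * I (\<lambda>x. \<rho>c x * X2 x))
      + (I (K u1 E0) + \<omega>2 * I (\<lambda>x. \<rho>c x * E0 x)))"
proof -
  let ?M = "lebesgue_on (box 0 l)"
  note p1 = pair(1) and p2 = pair(2) and p3 = pair(3) and pe0 = pair(4) and pe1 = pair(5)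
    and q0 = pair(6) and q1 = pair(7) and q2 = pair(8) and q3 = pair(9)
  have L2_\<rho>: "in_L2 l (\<lambda>x. \<rho>c x * f x)" if "in_L2 l f" for f
    unfolding \<rho>c_def using that by (rule admissible_coeffD(1)[OF \<rho>])
  have \<rho>_L2: "in_L2 l \<rho>c" unfolding \<rho>c_def[abs_def] by (rule admissible_coeffD(2)[OF \<rho>])
  have L2_K: "in_L2 l (K v r)" if "\<And>j. in_L2 l (\<lambda>x. v x $ j)" "in_L2 l r" for v r
    unfolding K_def using in_L2_flux(2)[OF G that] .
  have L2_F: "in_L2 l (\<lambda>x. F v r x j)" if "\<And>j. in_L2 l (\<lambda>x. v x $ j)" "in_L2 l r" for v r j
    unfolding F_def using in_L2_flux(1)[OF G that] .
  note L2 = in_L2_const in_L2_add in_L2_cmult in_L2_diff L2_\<rho> \<rho>_L2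
    L2_K[OF per_pairD(3)[OF p1] in_L2_const] L2_K[OF per_pairD(3)[OF p2] per_pairD(2)[OF p1]]
    L2_K[OF per_pairD(3)[OF p3] per_pairD(2)[OF p2]] L2_K[OF per_pairD(3)[OF pe0] in_L2_const]
    L2_K[OF per_pairD(3)[OF pe1] per_pairD(2)[OF pe0]]
    L2_F[OF per_pairD(3)[OF p1] in_L2_const] L2_F[OF per_pairD(3)[OF p2] per_pairD(2)[OF p1]]
    L2_F[OF per_pairD(3)[OF p3] per_pairD(2)[OF p2]] L2_F[OF per_pairD(3)[OF pe0] in_L2_const]
    L2_F[OF per_pairD(3)[OF pe1] per_pairD(2)[OF pe0]]
    per_pairD(2)[OF p1] per_pairD(2)[OF p2] per_pairD(2)[OF p3] per_pairD(2)[OF pe0]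
    per_pairD(2)[OF pe1]
  have I_add: "I (\<lambda>x. f x + g x) = I f + I g" if "in_L2 l f" "in_L2 l g" for f g
    unfolding I_def using that by (intro Bochner_Integration.integral_add in_L2_integrable)
  have I_diff: "I (\<lambda>x. f x - g x) = I f - I g" if "in_L2 l f" "in_L2 l g" for f g
    unfolding I_def using that by (intro Bochner_Integration.integral_diff in_L2_integrable)
  have I_cmult: "I (\<lambda>x. a * f x) = a * I f" for a f
    unfolding I_def by simp
  have I_const: "I (\<lambda>x. a) = a" for a
    unfolding I_def using vol by simp
  have I_cong: "I f = I g" if "AE x in ?M. f x = g x" "in_L2 l f" "in_L2 l g" for f g
    unfolding I_def using that by (intro integral_cong_AE in_L2_measurable)
  have I_mean: "I f = 0" if "weak_div_L2 l H f" for H f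
    unfolding I_def using that by (rule weak_div_L2_mean)
  \<comment> \<open>Problems whose data agree almost everywhere have solutions differing by a
    constant: in the difference of the fluxes the terms with \<open>p\<close> and \<open>q\<close>
    cancel and a homogeneous cell problem for \<open>g - v\<close> remains.\<close>
  have solve: "\<exists>c. (AE x in ?M. r x = s x + c) \<and> (AE x in ?M. g x = v x)"
    if r: "per_pair l r g" and W: "weak_div_L2 l (F g p) f"
      and s: "per_pair l s v" and S: "weak_div_L2 l (F v q) h" and p: "AE x in ?M. p x = q x"
      and f: "AE x in ?M. f x = h x" for r g p f s v q h
  proof -
    define d where "d x = r x + (-1) * s x" for x
    define e where "e x = g x + (\<chi> j. (-1) * v x $ j)" for x
    have de: "per_pair l d e"
      unfolding d_def[abs_def] e_def[abs_def] by (intro per_pair_add per_pair_cmult r s)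
    have "weak_div_L2 l (\<lambda>x j. F g p x j + (-1) * F v q x j) (\<lambda>x. f x + (-1) * h x)"
      by (intro weak_div_L2_add weak_div_L2_cmult W S)
    then have "weak_div_L2 l (\<lambda>x j. complex_of_real (G x) * e x $ j) (\<lambda>x. 0)"
    proof (rule weak_div_L2_cong_AE)
      show "AE x in ?M. (\<lambda>j. F g p x j + (-1) * F v q x j) = (\<lambda>j. complex_of_real (G x) * e x $ j)"
        using p by eventually_elim (auto simp: F_def shifted_flux_def e_def algebra_simps)
      show "AE x in ?M. f x + (-1) * h x = 0" using f by eventually_elim simp
      show "in_L2 l (\<lambda>x. complex_of_real (G x) * e x $ j)" for j
        by (intro admissible_coeffD(1)[OF G] per_pairD(3)[OF de])
    qed (rule in_L2_const)
    then obtain c where c: "AE x in ?M. d x = c" "AE x in ?M. e x = 0"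
      using cell_problem_unique[OF G de] by blast
    have "AE x in ?M. r x = s x + c" using c(1) by eventually_elim (simp add: d_def algebra_simps)
    moreover have "AE x in ?M. g x = v x"
      using c(2) by eventually_elim (simp add: e_def vec_eq_iff)
    ultimately show ?thesis by blast
  qed

  obtain c0 where w0: "AE x in ?M. w0 x = c0" and g0: "AE x in ?M. g0 x = 0"
    using cell_problem_unique[OF G q0] W0 by (auto simp: F_def shifted_flux_def[abs_def])

  have K0: "K g r x = 0" if "g x = 0" "r x = 0" for g r x
    using that by (simp add: K_def flux_along_def shifted_flux_def)
  have K_lin: "K g r x = a * K v s x + b * K v' s' x + c * K v'' s'' x"
    if "g x = (\<chi> j. a * v x $ j) + (\<chi> j. b * v' x $ j) + (\<chi> j. c * v'' x $ j)"
      "r x = a * s x + b * s' x + c * s'' x" for g r x a v s b v' s' c v'' s''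
    using that by (simp add: K_def flux_along_def shifted_flux_def sum_distrib_left sum.distrib[symmetric])
      (simp add: algebra_simps)

  have "\<exists>c. (AE x in ?M. w1 x = c0 * X1 x + c) \<and> (AE x in ?M. g1 x = (\<chi> j. c0 * v1 x $ j))"
  proof (rule solve[OF q1 W1 per_pair_cmult[OF p1]])
    have eq: "F (\<lambda>x. \<chi> j. c0 * v1 x $ j) (\<lambda>x. c0) = (\<lambda>x j. c0 * F v1 (\<lambda>x. 1) x j)"
      by (auto simp: F_def shifted_flux_def fun_eq_iff algebra_simps)
    show "weak_div_L2 l (F (\<lambda>x. \<chi> j. c0 * v1 x $ j) (\<lambda>x. c0)) (\<lambda>x. 0)"
      unfolding eq using weak_div_L2_cmult[OF X1, of c0] by simp
    show "AE x in ?M. K g0 (\<lambda>x. 0) x = 0" using g0 by eventually_elim (simp add: K0)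
  qed (rule w0)
  then obtain c1 where w1: "AE x in ?M. w1 x = c0 * X1 x + c1"
    and g1: "AE x in ?M. g1 x = (\<chi> j. c0 * v1 x $ j)" by blast

  have Kg1: "AE x in ?M. K g1 w0 x = c0 * K v1 (\<lambda>x. 1) x"
    using g1 w0
  proof eventually_elim
    case (elim x)
    then show ?case using K_lin[of g1 x c0 v1 0 "\<lambda>_. 0" 0 "\<lambda>_. 0" w0 "\<lambda>x. 1" "\<lambda>_. 0" "\<lambda>_. 0"]
      by (simp add: vec_eq_iff)
  qed
  \<comment> \<open>The mean of this source must vanish, which fixes the constant left free in
    \<open>w0\<close>.\<close>
  have src2: "AE x in ?M. K g1 w0 x + \<omega>2 * \<rho>c x * w0 x + 1 = c0 * K v1 (\<lambda>x. 1) x + \<omega>2 * c0 * \<rho>c x + 1"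
    using Kg1 w0 by eventually_elim simp
  have "I (\<lambda>x. c0 * K v1 (\<lambda>x. 1) x + \<omega>2 * c0 * \<rho>c x + 1) = 0"
    by (rule trans[OF sym[OF I_cong[OF src2 weak_div_L2D(2)[OF W2]]] I_mean[OF W2]]) (intro L2)
  moreover have "I (\<lambda>x. c0 * K v1 (\<lambda>x. 1) x + \<omega>2 * c0 * \<rho>c x + 1) = c0 * m0 + \<omega>2 * c0 * \<rho>0 + 1"
    by (simp add: I_add I_cmult I_const m0 \<rho>0(1) L2)
  ultimately have c0: "c0 * m0 + \<omega>2 * c0 * \<rho>0 = - 1"
    by (simp add: eq_neg_iff_add_eq_0)

  \<comment> \<open>The constant \<open>c1\<close> of \<open>w1\<close> is still unknown here and
    enters through X1, the response to a constant one order below.\<close>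
  define s2 where "s2 x = c0 * X2 x + c1 * X1 x + E0 x" for x
  define h2 where "h2 x = (\<chi> j. c0 * v2 x $ j) + (\<chi> j. c1 * v1 x $ j) + u0 x" for x
  have "\<exists>c. (AE x in ?M. w2 x = s2 x + c) \<and> (AE x in ?M. g2 x = h2 x)"
  proof (rule solve[OF q2 W2 _ _ w1])
    show "per_pair l s2 h2"
      unfolding s2_def[abs_def] h2_def[abs_def] by (intro per_pair_add per_pair_cmult p1 p2 pe0)
    have eq: "F h2 (\<lambda>x. c0 * X1 x + c1) =
        (\<lambda>x j. (c0 * F v2 X1 x j + c1 * F v1 (\<lambda>x. 1) x j) + F u0 (\<lambda>x. 0) x j)"
      by (auto simp: F_def shifted_flux_def h2_def fun_eq_iff algebra_simps)
    show "weak_div_L2 l (F h2 (\<lambda>x. c0 * X1 x + c1))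
        (\<lambda>x. (c0 * (K v1 (\<lambda>x. 1) x - \<rho>c x * (m0 / \<rho>0)) + c1 * 0) + (1 - \<rho>c x / \<rho>0))"
      unfolding eq by (intro weak_div_L2_add weak_div_L2_cmult X1 X2 E0)
    \<comment> \<open>The source of order two and the combination of cell sources differ by a
      multiple of \<open>c0 * m0 + \<omega>2 * c0 * \<rho>0 + 1\<close>, which is 0 by the condition
      just found.\<close>
    have "c0 * k + \<omega>2 * c0 * r + 1 = (c0 * (k - r * (m0 / \<rho>0)) + c1 * 0) + (1 - r / \<rho>0)" for k r
    proof -
      have "c0 * k + \<omega>2 * c0 * r + 1 - ((c0 * (k - r * (m0 / \<rho>0)) + c1 * 0) + (1 - r / \<rho>0))
          = r / \<rho>0 * (c0 * m0 + \<omega>2 * c0 * \<rho>0 + 1)"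
        using \<rho>0(2) by (simp add: field_simps)
      also have "\<dots> = 0" using c0 by simp
      finally show ?thesis by (simp only: right_minus_eq)
    qed
    then show "AE x in ?M. K g1 w0 x + \<omega>2 * \<rho>c x * w0 x + 1 =
        (c0 * (K v1 (\<lambda>x. 1) x - \<rho>c x * (m0 / \<rho>0)) + c1 * 0) + (1 - \<rho>c x / \<rho>0)"
      using src2 by simp
  qed
  then obtain c2 where w2: "AE x in ?M. w2 x = s2 x + c2" and g2: "AE x in ?M. g2 x = h2 x" by blast

  have src3: "AE x in ?M. K g2 w1 x + \<omega>2 * \<rho>c x * w1 x =
      (c0 * K v2 X1 x + c1 * K v1 (\<lambda>x. 1) x + K u0 (\<lambda>x. 0) x) + (\<omega>2 * c0 * (\<rho>c x * X1 x) + \<omega>2 * c1 * \<rho>c x)"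
    using g2 w1
  proof eventually_elim
    case (elim x)
    then show ?case
      using K_lin[of g2 x c0 v2 c1 v1 1 u0 w1 X1 "\<lambda>x. 1" "\<lambda>x. 0"]
      by (simp add: h2_def algebra_simps)
  qed
  \<comment> \<open>Solvability of the problem for X3, and below of that for E1, expresses both
    fluxes through the mean of \<open>\<rho>c x * X1 x\<close>.\<close>
  have KX: "I (K v2 X1) = I (\<lambda>x. \<rho>c x * X1 x) * (m0 / \<rho>0)"
  proof -
    have "I (\<lambda>x. K v2 X1 x - (m0 / \<rho>0) * (\<rho>c x * X1 x)) = 0"
      using I_mean[OF X3] by (simp add: mult_ac)
    then show ?thesis by (simp only: I_diff I_cmult L2) (simp add: mult.commute)
  qed
  have KE: "I (K u0 (\<lambda>x. 0)) = I (\<lambda>x. \<rho>c x * X1 x) / \<rho>0"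
  proof -
    have "I (\<lambda>x. K u0 (\<lambda>x. 0) x - (1 / \<rho>0) * (\<rho>c x * X1 x)) = 0"
      using I_mean[OF E1] by simp
    then show ?thesis by (simp only: I_diff I_cmult L2) simp
  qed
  have "I (\<lambda>x. (c0 * K v2 X1 x + c1 * K v1 (\<lambda>x. 1) x + K u0 (\<lambda>x. 0) x) + (\<omega>2 * c0 * (\<rho>c x * X1 x) + \<omega>2 * c1 * \<rho>c x)) = 0"
    by (rule trans[OF sym[OF I_cong[OF src3 weak_div_L2D(2)[OF W3]]] I_mean[OF W3]]) (intro L2)
  moreover have "I (\<lambda>x. (c0 * K v2 X1 x + c1 * K v1 (\<lambda>x. 1) x + K u0 (\<lambda>x. 0) x) + (\<omega>2 * c0 * (\<rho>c x * X1 x) + \<omega>2 * c1 * \<rho>c x))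
      = (c0 * I (K v2 X1) + c1 * m0 + I (K u0 (\<lambda>x. 0))) + (\<omega>2 * c0 * I (\<lambda>x. \<rho>c x * X1 x) + \<omega>2 * c1 * \<rho>0)"
    by (simp only: I_add I_cmult m0 \<rho>0(1) L2)
  ultimately have "(c0 * I (K v2 X1) + c1 * m0 + I (K u0 (\<lambda>x. 0))) + (\<omega>2 * c0 * I (\<lambda>x. \<rho>c x * X1 x) + \<omega>2 * c1 * \<rho>0) = 0"
    by simp
  \<comment> \<open>All terms with the mean of \<open>\<rho>c x * X1 x\<close> collect into a
    multiple of the equation for \<open>c0\<close>; only \<open>c1\<close> times the nonzero number
    \<open>m0 + \<rho>0 * \<omega>2\<close> survives.\<close>
  moreover have "(c0 * I (K v2 X1) + c1 * m0 + I (K u0 (\<lambda>x. 0))) + (\<omega>2 * c0 * I (\<lambda>x. \<rho>c x * X1 x) + \<omega>2 * c1 * \<rho>0)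
      = I (\<lambda>x. \<rho>c x * X1 x) / \<rho>0 * (c0 * m0 + \<omega>2 * c0 * \<rho>0 + 1) + c1 * (m0 + \<rho>0 * \<omega>2)"
    unfolding KX KE using \<rho>0(2) by (simp add: field_simps)
  ultimately have "c1 * (m0 + \<rho>0 * \<omega>2) = 0" using c0 by simp
  then have c1: "c1 = 0" using \<sigma> by simp

  \<comment> \<open>Since \<open>c1\<close> vanishes, X3 answers the X2 part of \<open>w2\<close>,
    E1 the E0 part and X1 the constant \<open>c2\<close>.\<close>
  define s3 where "s3 x = c0 * X3 x + E1 x + c2 * X1 x" for x
  define h3 where "h3 x = (\<chi> j. c0 * v3 x $ j) + u1 x + (\<chi> j. c2 * v1 x $ j)" for x
  have "\<exists>c. (AE x in ?M. w3 x = s3 x + c) \<and> (AE x in ?M. g3 x = h3 x)"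
  proof (rule solve[OF q3 W3 _ _ w2])
    show "per_pair l s3 h3"
      unfolding s3_def[abs_def] h3_def[abs_def] by (intro per_pair_add per_pair_cmult p1 p3 pe1)
    have eq: "F h3 (\<lambda>x. s2 x + c2) =
        (\<lambda>x j. (c0 * F v3 X2 x j + F u1 E0 x j) + c2 * F v1 (\<lambda>x. 1) x j)"
      by (auto simp: F_def shifted_flux_def h3_def s2_def c1 fun_eq_iff algebra_simps)
    show "weak_div_L2 l (F h3 (\<lambda>x. s2 x + c2))
        (\<lambda>x. (c0 * (K v2 X1 x - \<rho>c x * X1 x * (m0 / \<rho>0)) + (K u0 (\<lambda>x. 0) x - \<rho>c x * X1 x / \<rho>0)) + c2 * 0)"
      unfolding eq by (intro weak_div_L2_add weak_div_L2_cmult X1 X3 E1)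
    have key: "c0 * k + k' + \<omega>2 * c0 * r = (c0 * (k - r * (m0 / \<rho>0)) + (k' - r / \<rho>0)) + c2 * 0" for k k' r
    proof -
      have key: "c0 * k + k' + \<omega>2 * c0 * r - ((c0 * (k - r * (m0 / \<rho>0)) + (k' - r / \<rho>0)) + c2 * 0)
          = r / \<rho>0 * (c0 * m0 + \<omega>2 * c0 * \<rho>0 + 1)"
        using \<rho>0(2) by (simp add: field_simps)
      also have "\<dots> = 0" using c0 by simp
      finally show ?thesis by (simp only: right_minus_eq)
    qed
    show "AE x in ?M. K g2 w1 x + \<omega>2 * \<rho>c x * w1 x =
        (c0 * (K v2 X1 x - \<rho>c x * X1 x * (m0 / \<rho>0)) + (K u0 (\<lambda>x. 0) x - \<rho>c x * X1 x / \<rho>0)) + c2 * 0"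
      unfolding key[symmetric] using src3 by (simp add: c1)
  qed
  then obtain c3 where g3: "AE x in ?M. g3 x = h3 x" by blast

  have src4: "AE x in ?M. K g3 w2 x + \<omega>2 * \<rho>c x * w2 x =
      (c0 * K v3 X2 x + K u1 E0 x + c2 * K v1 (\<lambda>x. 1) x) +
      (\<omega>2 * c0 * (\<rho>c x * X2 x) + \<omega>2 * (\<rho>c x * E0 x) + \<omega>2 * c2 * \<rho>c x)"
    using g3 w2
  proof eventually_elim
    case (elim x)
    then show ?case
      using K_lin[of g3 x c0 v3 1 u1 c2 v1 w2 X2 E0 "\<lambda>x. 1"]
      by (simp add: h3_def s2_def c1 algebra_simps)
  qed
  have "I (\<lambda>x. (c0 * K v3 X2 x + K u1 E0 x + c2 * K v1 (\<lambda>x. 1) x) +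
      (\<omega>2 * c0 * (\<rho>c x * X2 x) + \<omega>2 * (\<rho>c x * E0 x) + \<omega>2 * c2 * \<rho>c x)) = 0"
    by (rule trans[OF sym[OF I_cong[OF src4 weak_div_L2D(2)[OF W4]]] I_mean[OF W4]]) (intro L2)
  moreover have "I (\<lambda>x. (c0 * K v3 X2 x + K u1 E0 x + c2 * K v1 (\<lambda>x. 1) x) +
      (\<omega>2 * c0 * (\<rho>c x * X2 x) + \<omega>2 * (\<rho>c x * E0 x) + \<omega>2 * c2 * \<rho>c x)) =
      (c0 * I (K v3 X2) + I (K u1 E0) + c2 * m0) +
      (\<omega>2 * c0 * I (\<lambda>x. \<rho>c x * X2 x) + \<omega>2 * I (\<lambda>x. \<rho>c x * E0 x) + \<omega>2 * c2 * \<rho>0)"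
    by (simp only: I_add I_cmult m0 \<rho>0(1) L2)
  \<comment> \<open>The fourth order enters through its solvability condition alone, and this
    determines \<open>c2\<close>.\<close>
  ultimately have 4: "(c0 * I (K v3 X2) + I (K u1 E0) + c2 * m0) +
      (\<omega>2 * c0 * I (\<lambda>x. \<rho>c x * X2 x) + \<omega>2 * I (\<lambda>x. \<rho>c x * E0 x) + \<omega>2 * c2 * \<rho>0) = 0"
    by simp

  have Iw0: "I w0 = c0"
    using I_cong[OF w0 per_pairD(2)[OF q0] in_L2_const] I_const by simp
  \<comment> \<open>X2 and E0 have zero mean, so the mean of \<open>w2\<close> is exactly the free
    constant \<open>c2\<close>.\<close>
  have "I w2 = I (\<lambda>x. (c0 * X2 x + E0 x) + c2)"
    using w2 by (intro I_cong per_pairD(2)[OF q2] in_L2_add in_L2_cmult per_pairD(2)[OF p2]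
        per_pairD(2)[OF pe0] in_L2_const) (simp add: s2_def c1)
  also have "\<dots> = c2"
    by (simp add: I_add I_cmult I_const mean0 L2)
  finally have Iw2: "I w2 = c2" .
  show "I w0 * (m0 + \<rho>0 * \<omega>2) = - 1"
    using c0 unfolding Iw0 by (simp add: algebra_simps)
  show "I w2 * (m0 + \<rho>0 * \<omega>2) = - (I w0 * (I (K v3 X2) + \<omega>2 * I (\<lambda>x. \<rho>c x * X2 x))
      + (I (K u1 E0) + \<omega>2 * I (\<lambda>x. \<rho>c x * E0 x)))"
    using 4 unfolding Iw0 Iw2 by (simp add: algebra_simps eq_neg_iff_add_eq_0)
qed

section \<open>Contraction of tensors\<close>

lemma finite_index_lists: "finite {js :: 'd::finite list. length js = n}"
  using finite_lists_length_eq[of "UNIV :: 'd set" n] by simp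

lemma contract_ik_0: "contract_ik 0 T k = T []"
  by (simp add: contract_ik_def)

text \<open>The first index is the one of the derivative and of the divergence; peeling it off turns
  a contracted tensor flux into \<open>flux_along\<close> of a vector flux.\<close>

lemma contract_ik_Suc:
  "contract_ik (Suc n) T k = (\<Sum>j\<in>UNIV. \<i> * complex_of_real (k $ j) * contract_ik n (\<lambda>js. T (j # js)) k)"
proof -
  let ?p = "\<lambda>js. \<Prod>j\<leftarrow>js. \<i> * complex_of_real (k $ j)"
  have "contract_ik (Suc n) T k = (\<Sum>(j, js)\<in>UNIV \<times> {js. length js = n}. T (j # js) * ?p (j # js))"
    unfolding contract_ik_def
    by (rule sum.reindex_bij_witness[of _ "\<lambda>(j, js). j # js" "\<lambda>js. (hd js, tl js)"])
      (auto simp: length_Suc_conv)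
  also have "\<dots> = (\<Sum>j\<in>UNIV. \<i> * complex_of_real (k $ j) * contract_ik n (\<lambda>js. T (j # js)) k)"
    by (simp add: sum.cartesian_product[symmetric] contract_ik_def sum_distrib_left mult_ac)
  finally show ?thesis .
qed

lemma contract_ik_1: "contract_ik 1 T k = (\<Sum>j\<in>UNIV. \<i> * complex_of_real (k $ j) * T [j])"
  by (simp add: contract_ik_Suc contract_ik_0)

lemma contract_ik_cong:
  "(\<And>js. length js = n \<Longrightarrow> S js = T js) \<Longrightarrow> contract_ik n S k = contract_ik n T k"
  by (auto simp: contract_ik_def intro!: sum.cong)

lemma contract_ik_add: "contract_ik n (\<lambda>js. S js + T js) k = contract_ik n S k + contract_ik n T k"
  by (simp add: contract_ik_def distrib_right sum.distrib)

lemma contract_ik_diff: "contract_ik n (\<lambda>js. S js - T js) k = contract_ik n S k - contract_ik n T k"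
  by (simp add: contract_ik_def left_diff_distrib sum_subtractf)

lemma contract_ik_cmult: "contract_ik n (\<lambda>js. a * T js) k = a * contract_ik n T k"
  by (simp add: contract_ik_def sum_distrib_left mult.assoc)

text \<open>A permutation of the indices permutes the factors of the product and reindexes the sum,
  so all \<open>fact n\<close> terms of the average contribute equally.\<close>

lemma contract_ik_tensor_sym: "contract_ik n (tensor_sym T) k = contract_ik n T (k :: real^'d::finite)"
proof -
  let ?p = "\<lambda>js. \<Prod>j\<leftarrow>js. \<i> * complex_of_real (k $ j)"
  let ?L = "{js :: 'd list. length js = n}"
  let ?P = "{p. p permutes {..<n}}"
  have perm: "(\<Sum>js\<in>?L. T (permute_list p js) * ?p js) = contract_ik n T k" if p: "p \<in> ?P" for p
    unfolding contract_ik_def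
  proof (rule sum.reindex_bij_witness[of _ "permute_list (inv p)" "permute_list p"])
    fix js :: "'d list" assume "js \<in> ?L"
    then have js: "length js = n" by simp
    have p': "p permutes {..<length js}" "inv p permutes {..<length js}"
      using p js permutes_inv by auto
    show "permute_list (inv p) (permute_list p js) = js"
      using permute_list_compose[OF p'(2), of p] permutes_inv_o[OF p'(1)] by simp
    show "permute_list p (permute_list (inv p) js) = js"
      using permute_list_compose[OF p'(1), of "inv p"] permutes_inv_o[OF p'(1)] by simp
    have "?p (permute_list p js) = ?p js"
      by (simp only: prod_mset_prod_list[symmetric] mset_map mset_permute_list[OF p'(1)])
    then show "T (permute_list p js) * ?p (permute_list p js) = T (permute_list p js) * ?p js"
      by simp
  qed (auto simp: length_permute_list)
  have "contract_ik n (tensor_sym T) k = (\<Sum>js\<in>?L. \<Sum>p\<in>?P. T (permute_list p js) * ?p js / fact n)"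
    unfolding contract_ik_def tensor_sym_def
    by (intro sum.cong refl) (simp add: sum_distrib_right sum_divide_distrib)
  also have "\<dots> = (\<Sum>p\<in>?P. (\<Sum>js\<in>?L. T (permute_list p js) * ?p js) / fact n)"
    by (subst sum.swap) (simp add: sum_divide_distrib)
  also have "\<dots> = (\<Sum>p\<in>?P. contract_ik n T k / fact n)"
    by (intro sum.cong refl) (simp only: perm)
  also have "\<dots> = contract_ik n T k"
    using card_permutations[of "{..<n}" n] by simp
  finally show ?thesis .
qed

lemma contract_ik_tensor_sym':
  "contract_ik n (\<lambda>js. tensor_sym' T (j # js)) k = contract_ik n (\<lambda>js. T (j # js)) k"
  unfolding tensor_sym'_def by (simp add: contract_ik_tensor_sym)

lemma contract_ik_tensor_prod:
  "contract_ik (m + n) (tensor_prod m S T) k = contract_ik m S k * contract_ik n T k"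
proof (induction m arbitrary: S)
  case 0
  have "tensor_prod 0 S T = (\<lambda>js. S [] * T js)" by (simp add: tensor_prod_def fun_eq_iff)
  then show ?case by (simp add: contract_ik_cmult contract_ik_0)
next
  case (Suc m)
  have "(\<lambda>js. tensor_prod (Suc m) S T (j # js)) = tensor_prod m (\<lambda>js. S (j # js)) T" for j
    by (simp add: tensor_prod_def fun_eq_iff)
  then show ?case by (simp add: contract_ik_Suc Suc sum_distrib_right mult.assoc)
qed

lemma contract_ik_id_row: "contract_ik 1 (\<lambda>js. id_tensor (j # js)) k = \<i> * complex_of_real (k $ j)"
proof -
  have "contract_ik 1 (\<lambda>js. id_tensor (j # js)) k =
      (\<Sum>i\<in>UNIV. if i = j then \<i> * complex_of_real (k $ i) else 0)"
    unfolding contract_ik_1 by (intro sum.cong) (auto simp: id_tensor_def)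
  then show ?thesis by simp
qed

lemma contract_ik_id_prod_row:
  "contract_ik (Suc n) (\<lambda>js. tensor_prod 2 id_tensor T (j # js)) k = \<i> * complex_of_real (k $ j) * contract_ik n T k"
proof -
  have "(\<lambda>js. tensor_prod 2 id_tensor T (j # js)) = tensor_prod 1 (\<lambda>js. id_tensor (j # js)) T"
    by (simp add: tensor_prod_def fun_eq_iff numeral_2_eq_2)
  then show ?thesis using contract_ik_tensor_prod[of 1 n "\<lambda>js. id_tensor (j # js)" T k]
    by (simp add: contract_ik_id_row[unfolded One_nat_def])
qed

section \<open>Contracted tensor fields and contracted cell problems\<close>

lemma in_L2_tensor_sym:
  assumes "\<And>is. length is = length js \<Longrightarrow> in_L2 l (\<lambda>x. T x is)"
  shows "in_L2 l (\<lambda>x. tensor_sym (T x) js)"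
proof -
  have "in_L2 l (\<lambda>x. inverse (fact (length js)) * (\<Sum>p | p permutes {..<length js}. T x (permute_list p js)))"
    using assms by (intro in_L2_sum in_L2_cmult) auto
  then show ?thesis by (simp add: tensor_sym_def divide_inverse mult.commute)
qed

lemma in_L2_tensor_sym':
  assumes "\<And>is. length is = length (tl js) \<Longrightarrow> in_L2 l (\<lambda>x. T x (hd js # is))"
  shows "in_L2 l (\<lambda>x. tensor_sym' (T x) js)"
  unfolding tensor_sym'_def by (rule in_L2_tensor_sym) (rule assms)

lemma in_L2_id_prod:
  assumes "\<And>js. length js = n \<Longrightarrow> in_L2 l (\<lambda>x. T x js)" "length js = Suc (Suc n)"
  shows "in_L2 l (\<lambda>x. tensor_prod 2 id_tensor (T x) js)"
  unfolding tensor_prod_def using assms by (intro in_L2_cmult) auto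

lemma integral_contract_ik:
  assumes "\<And>js. length js = n \<Longrightarrow> in_L2 l (\<lambda>x. T x js)"
  shows "(LINT x|lebesgue_on (box 0 l). contract_ik n (T x) k) =
    contract_ik n (\<lambda>js. LINT x|lebesgue_on (box 0 l). T x js) k"
proof -
  have "integrable (lebesgue_on (box 0 l)) (\<lambda>x. T x js * a)" if "length js = n" for js a
    by (intro integrable_mult_left in_L2_integrable assms that)
  then show ?thesis
    unfolding contract_ik_def by (subst Bochner_Integration.integral_sum) auto
qed

text \<open>A gradient representative assembled from the chosen gradients of the components; it
  agrees with \<open>grad\<close> of the contracted field only almost everywhere.\<close>

definition contracted_grad ::
  "real^'d::finite \<Rightarrow> nat \<Rightarrow> (real^'d \<Rightarrow> 'd tensor) \<Rightarrow> real^'d \<Rightarrow> real^'d \<Rightarrow> complex^'d" where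
  "contracted_grad l n X k x = (\<chi> j. contract_ik n (\<lambda>js. tensor_grad l X x (j # js)) k)"

text \<open>Contraction is a finite linear combination of the component problems with coefficients
  taken from (i k)^n. \<open>cell_solution\<close> carries only \<open>weak_div_eq\<close>, so the
  square integrability behind linearity is supplied separately for flux and source.\<close>

lemma cell_solution_contract:
  fixes l :: "real^'d::finite"
  assumes sol: "cell_solution l n X F f" and vol: "measure lebesgue (box 0 l) = 1"
    and F: "\<And>js j. length js = n \<Longrightarrow> in_L2 l (\<lambda>x. F x (j # js))"
    and f: "\<And>js. length js = n \<Longrightarrow> in_L2 l (\<lambda>x. f x js)"
  shows "per_pair l (\<lambda>x. contract_ik n (X x) k) (contracted_grad l n X k)"
    and "(LINT x|lebesgue_on (box 0 l). contract_ik n (X x) k) = 0"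
    and "weak_div_L2 l (\<lambda>x j. contract_ik n (\<lambda>js. F x (j # js)) k) (\<lambda>x. contract_ik n (f x) k)"
proof -
  let ?p = "\<lambda>js. \<Prod>j\<leftarrow>js. \<i> * complex_of_real (k $ j)"
  let ?L = "{js :: 'd list. length js = n}"
  have H1p: "in_H1p l (\<lambda>x. X x js)" and mean: "mean l (\<lambda>x. X x js) = 0"
    and eq: "weak_div_eq l (\<lambda>x j. F x (j # js)) (\<lambda>x. f x js)" if "length js = n" for js
    using sol that by (auto simp: cell_solution_def)
  have "per_pair l (\<lambda>x. \<Sum>js\<in>?L. ?p js * X x js) (\<lambda>x. \<Sum>js\<in>?L. \<chi> j. ?p js * grad l (\<lambda>x. X x js) x $ j)"
    by (intro per_pair_sum per_pair_cmult per_pair_grad H1p finite_index_lists) simp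
  moreover have "(\<lambda>x. \<Sum>js\<in>?L. \<chi> j. ?p js * grad l (\<lambda>x. X x js) x $ j) = contracted_grad l n X k"
    by (auto simp: contracted_grad_def contract_ik_def tensor_grad_def vec_eq_iff fun_eq_iff mult.commute)
  ultimately show "per_pair l (\<lambda>x. contract_ik n (X x) k) (contracted_grad l n X k)"
    by (simp add: contract_ik_def mult.commute)
  have "(LINT x|lebesgue_on (box 0 l). contract_ik n (X x) k) =
      contract_ik n (\<lambda>js. LINT x|lebesgue_on (box 0 l). X x js) k"
    using per_pairD(2)[OF per_pair_grad[OF H1p]] by (intro integral_contract_ik)
  also have "\<dots> = contract_ik n (\<lambda>js. 0) k"
    using mean vol by (intro contract_ik_cong) (simp add: mean_def)
  finally show "(LINT x|lebesgue_on (box 0 l). contract_ik n (X x) k) = 0"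
    by (simp add: contract_ik_def)
  have "weak_div_L2 l (\<lambda>x j. \<Sum>js\<in>?L. ?p js * F x (j # js)) (\<lambda>x. \<Sum>js\<in>?L. ?p js * f x js)"
    using F f eq by (intro weak_div_L2_sum weak_div_L2_cmult finite_index_lists) (simp add: weak_div_L2_def)
  then show "weak_div_L2 l (\<lambda>x j. contract_ik n (\<lambda>js. F x (j # js)) k) (\<lambda>x. contract_ik n (f x) k)"
    by (simp add: contract_ik_def mult.commute)
qed

lemma in_L2_tensor_grad:
  assumes "cell_solution l n X F f" "length js = Suc n"
  shows "in_L2 l (\<lambda>x. tensor_grad l X x js)" 
proof -
  have "in_H1 l (\<lambda>x. X x (tl js))" using assms by (auto simp: cell_solution_def in_H1p_def)
  then show ?thesis unfolding tensor_grad_def by (rule grad_props)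
qed

lemma in_L2_cell_solution:
  assumes "cell_solution l n X F f" "length js = n"
  shows "in_L2 l (\<lambda>x. X x js)"
  using assms by (auto simp: cell_solution_def in_H1p_def in_H1_def)

lemma contract_ik_polynomial:
  fixes T :: "'d::finite tensor"
  shows "polynomial_function (\<lambda>(k, \<omega>::real). contract_ik 2 T k)"
proof -
  have lin: "real_polynomial_function (\<lambda>z::(real^'d) \<times> real. fst z $ j)" for j
    unfolding real_polynomial_function_eq
    by (intro polynomial_function_bounded_linear bounded_linear_compose[OF bounded_linear_vec_nth bounded_linear_fst])
  \<comment> \<open>The minus sign is the square of the imaginary unit: the coefficients are
    complex, the monomials in \<open>k\<close> real.\<close>
  have "polynomial_function (\<lambda>z::(real^'d) \<times> real. \<Sum>i\<in>UNIV. \<Sum>j\<in>UNIV. (fst z $ i * fst z $ j) *\<^sub>R (- T [i, j]))"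
    by (intro polynomial_function_sum polynomial_function_mult polynomial_function_const)
      (use polynomial_function_mult[OF lin[unfolded real_polynomial_function_eq] lin[unfolded real_polynomial_function_eq]] in auto)
  also have "(\<lambda>z::(real^'d) \<times> real. \<Sum>i\<in>UNIV. \<Sum>j\<in>UNIV. (fst z $ i * fst z $ j) *\<^sub>R (- T [i, j])) =
      (\<lambda>(k, \<omega>). contract_ik 2 T k)"
    by (auto simp: fun_eq_iff numeral_2_eq_2 contract_ik_Suc contract_ik_0 scaleR_conv_of_real
        sum_distrib_left algebra_simps intro!: sum.cong)
  finally show ?thesis .
qed

lemma contract_ik_scaleR: "contract_ik n T (\<epsilon> *\<^sub>R k) = complex_of_real \<epsilon> ^ n * contract_ik n T k"
proof -
  have "(\<Prod>j\<leftarrow>js. \<i> * complex_of_real ((\<epsilon> *\<^sub>R k) $ j)) =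
      complex_of_real \<epsilon> ^ length js * (\<Prod>j\<leftarrow>js. \<i> * complex_of_real (k $ j))" for js
    by (induction js) (auto simp: mult_ac)
  then show ?thesis by (simp add: contract_ik_def sum_distrib_left mult_ac)
qed

text \<open>A purely algebraic comparison. The two relations for \<open>c0\<close> and
  \<open>c2\<close> cancel the orders 0 and 2 in \<epsilon> of the numerator, while both
  denominators have nonzero limits.\<close>

lemma impedance_ratio_smallo:
  fixes c0 c2 \<sigma> A B :: complex
  assumes c0: "c0 * \<sigma> = - 1" and c2: "c2 * \<sigma> = - (c0 * A + B)"
  shows "(\<lambda>\<epsilon>::real. of_real \<epsilon> ^ 2 / (c0 + of_real \<epsilon> ^ 2 * c2) -
      inverse (- 1 - of_real \<epsilon> ^ 2 * B) * (of_real \<epsilon> ^ 2 * \<sigma> + of_real \<epsilon> ^ 4 * A)) \<in> o[at 0](\<lambda>\<epsilon>. of_real (\<epsilon> ^ 4))"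
proof (rule smalloI_tendsto)
  let ?P = "\<lambda>\<epsilon>::real. c0 + of_real \<epsilon> ^ 2 * c2" and ?Q = "\<lambda>\<epsilon>::real. 1 + of_real \<epsilon> ^ 2 * B"
  have lim: "(?P \<longlongrightarrow> c0 + of_real 0 ^ 2 * c2) (at 0)" "(?Q \<longlongrightarrow> 1 + of_real 0 ^ 2 * B) (at 0)"
    by (intro tendsto_intros)+
  have c0': "c0 \<noteq> 0" using c0 by auto
  have ev: "\<forall>\<^sub>F \<epsilon> in at 0. ?P \<epsilon> \<noteq> 0" "\<forall>\<^sub>F \<epsilon> in at 0. ?Q \<epsilon> \<noteq> 0"
    by (rule tendsto_imp_eventually_ne[OF lim(1)], use c0' in simp)
      (rule tendsto_imp_eventually_ne[OF lim(2)], simp)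
  have ne: "\<forall>\<^sub>F \<epsilon>::real in at 0. \<epsilon> \<noteq> 0" by (simp add: eventually_at_filter)
  then show "\<forall>\<^sub>F \<epsilon>::real in at 0. complex_of_real (\<epsilon> ^ 4) \<noteq> 0" by eventually_elim simp
  have "((\<lambda>\<epsilon>. of_real \<epsilon> ^ 2 * (A * c2) / (?P \<epsilon> * ?Q \<epsilon>)) \<longlongrightarrow>
      of_real 0 ^ 2 * (A * c2) / ((c0 + of_real 0 ^ 2 * c2) * (1 + of_real 0 ^ 2 * B))) (at 0)"
    by (intro tendsto_intros) (use c0' in auto)
  then have "((\<lambda>\<epsilon>. of_real \<epsilon> ^ 2 * (A * c2) / (?P \<epsilon> * ?Q \<epsilon>)) \<longlongrightarrow> 0) (at 0)" by simp
  then show "((\<lambda>\<epsilon>::real. (of_real \<epsilon> ^ 2 / ?P \<epsilon> - inverse (- 1 - of_real \<epsilon> ^ 2 * B) *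
      (of_real \<epsilon> ^ 2 * \<sigma> + of_real \<epsilon> ^ 4 * A)) / of_real (\<epsilon> ^ 4)) \<longlongrightarrow> 0) (at 0)"
  proof (rule Lim_transform_eventually)
    show "\<forall>\<^sub>F \<epsilon>::real in at 0. of_real \<epsilon> ^ 2 * (A * c2) / (?P \<epsilon> * ?Q \<epsilon>) =
        (of_real \<epsilon> ^ 2 / ?P \<epsilon> - inverse (- 1 - of_real \<epsilon> ^ 2 * B) *
      (of_real \<epsilon> ^ 2 * \<sigma> + of_real \<epsilon> ^ 4 * A)) / of_real (\<epsilon> ^ 4)"
      using ev ne
    proof eventually_elim
      case (elim \<epsilon>)
      define e where "e = complex_of_real \<epsilon> ^ 2"
      have e: "e \<noteq> 0" "complex_of_real \<epsilon> ^ 4 = e ^ 2" using elim(3) by (auto simp: e_def)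
      define P Q where "P = c0 + e * c2" and "Q = 1 + e * B"
      have PQ: "P \<noteq> 0" "Q \<noteq> 0" using elim by (auto simp: P_def Q_def e_def)
      have key: "Q + (\<sigma> + e * A) * P = e ^ 2 * (A * c2)"
      proof -
        have "Q + (\<sigma> + e * A) * P = (1 + c0 * \<sigma>) + e * (B + c0 * A + c2 * \<sigma>) + e ^ 2 * (A * c2)"
          by (simp add: P_def Q_def algebra_simps power2_eq_square)
        then show ?thesis using c0 c2 by simp
      qed
      \<comment> \<open>Here Q is minus the impedance factor, which turns the difference of the two
        quotients into a sum over the common denominator \<open>P * Q\<close>.\<close>
      have diff: "e / P - inverse (- 1 - e * B) * (e * \<sigma> + e ^ 2 * A) = e * (Q + (\<sigma> + e * A) * P) / (P * Q)"
      proof -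
        have "inverse (- 1 - e * B) = - inverse Q"
          by (simp add: Q_def inverse_minus_eq[symmetric])
        show ?thesis unfolding \<open>inverse (- 1 - e * B) = - inverse Q\<close>
          using PQ by (simp add: field_simps power2_eq_square)
      qed
      have "e * (A * c2) / (P * Q) = (e / P - inverse (- 1 - e * B) * (e * \<sigma> + e ^ 2 * A)) / e ^ 2"
        unfolding diff key using e(1) by (simp add: power2_eq_square)
      then show ?case
        unfolding of_real_power e(2) P_def Q_def e_def[symmetric] .
    qed
  qed
qed

section \<open>Orders 2 to 4, the contracted hierarchy and the comparison of impedances\<close>

lemma contract_ik_2:
  "contract_ik 2 T k = (\<Sum>j\<in>UNIV. \<i> * complex_of_real (k $ j) * contract_ik 1 (\<lambda>js. T (j # js)) k)"
  unfolding numeral_2_eq_2 One_nat_def by (rule contract_ik_Suc)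

lemma contract_ik_3:
  "contract_ik 3 T k = (\<Sum>j\<in>UNIV. \<i> * complex_of_real (k $ j) * contract_ik 2 (\<lambda>js. T (j # js)) k)"
  unfolding numeral_3_eq_3 numeral_2_eq_2 by (rule contract_ik_Suc)

lemma contract_ik_4:
  "contract_ik 4 T k = (\<Sum>j\<in>UNIV. \<i> * complex_of_real (k $ j) * contract_ik 3 (\<lambda>js. T (j # js)) k)"
  using contract_ik_Suc[of 3 T k] by simp

lemma contract_ik_id_prod_row_2:
  "contract_ik 2 (\<lambda>js. tensor_prod 2 id_tensor T (j # js)) k = \<i> * complex_of_real (k $ j) * contract_ik 1 T k"
  using contract_ik_id_prod_row[of 1 T j k] by (simp add: numeral_2_eq_2)

lemma contract_ik_id_prod_row_3:
  "contract_ik 3 (\<lambda>js. tensor_prod 2 id_tensor T (j # js)) k = \<i> * complex_of_real (k $ j) * contract_ik 2 T k"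
  using contract_ik_id_prod_row[of 2 T j k] by (simp add: numeral_3_eq_3)

lemma contract_ik_multc: "contract_ik n (\<lambda>js. T js * a) k = contract_ik n T k * a"
  using contract_ik_cmult[of n a T k] by (simp add: mult.commute)

lemma contracted_grad_row:
  "contract_ik n (\<lambda>js. tensor_grad l X x (j # js)) k = contracted_grad l n X k x $ j"
  by (simp add: contracted_grad_def)

lemma willis_hierarchy_weak_div:
  assumes hier: "willis_hierarchy l G \<rho> khat what w"
    and G: "admissible_coeff l G" and \<rho>: "admissible_coeff l \<rho>" and m: "m \<in> {0..4}"
  defines "\<kappa> \<equiv> (\<chi> j. \<i> * complex_of_real (khat $ j))"
  shows "weak_div_L2 l (shifted_flux G \<kappa> (grad l (w m)) (w (m - 1)))
    (\<lambda>x. flux_along G \<kappa> (grad l (w (m - 1))) (w (m - 2)) x +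
      complex_of_real what ^ 2 * complex_of_real (\<rho> x) * w (m - 2) x + (if m = 2 then 1 else 0))"
proof -
  have zero: "w (-1) = (\<lambda>x. 0)" "w (-2) = (\<lambda>x. 0)" using hier by (auto simp: willis_hierarchy_def)
  \<comment> \<open>The range starts at -2 because the equations of orders 0 and 1 refer to the
    fields with negative index, which are zero.\<close>
  have H1p: "in_H1p l (w i)" if "i \<in> {-2..4}" for i
  proof (cases "i < 0")
    case True
    with that have "i = -1 \<or> i = -2" by auto
    then show ?thesis using zero in_H1p_const[of l 0] by auto
  next
    case False
    with that hier show ?thesis by (auto simp: willis_hierarchy_def)
  qed
  have L2: "in_L2 l (w i)" "in_L2 l (\<lambda>x. grad l (w i) x $ j)" if "i \<in> {-2..4}" for i j
    using per_pair_grad[OF H1p[OF that]] by (auto intro: per_pairD)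
  have range: "m \<in> {-2..4}" "m - 1 \<in> {-2..4}" "m - 2 \<in> {-2..4}" using m by auto
  have "weak_div_eq l
      (\<lambda>x j. G x * (grad l (w m) x $ j + \<i> * khat $ j * w (m - 1) x))
      (\<lambda>x. (\<Sum>j\<in>UNIV. \<i> * khat $ j *
               (G x * (grad l (w (m - 1)) x $ j + \<i> * khat $ j * w (m - 2) x)))
           + complex_of_real what ^ 2 * complex_of_real (\<rho> x) * w (m - 2) x + (if m = 2 then 1 else 0))"
    using hier m unfolding willis_hierarchy_def by blast
  moreover have "in_L2 l (\<lambda>x. shifted_flux G \<kappa> (grad l (w m)) (w (m - 1)) x j)" for j
    by (intro in_L2_flux(1) G L2 range)
  moreover have "in_L2 l (\<lambda>x. flux_along G \<kappa> (grad l (w (m - 1))) (w (m - 2)) x +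
      complex_of_real what ^ 2 * (complex_of_real (\<rho> x) * w (m - 2) x) + (if m = 2 then 1 else 0))"
    by (intro in_L2_add in_L2_cmult in_L2_const in_L2_flux(2) admissible_coeffD(1)[OF \<rho>] G L2 range)
  ultimately show ?thesis
    by (simp add: weak_div_L2_def shifted_flux_def[abs_def] flux_along_def[abs_def] \<kappa>_def mult.assoc)
qed

theorem theorem4p1:
  fixes l khat :: "real^'d::finite"
    and what :: real
    and G \<rho> :: "real^'d \<Rightarrow> real"
    and chi1 chi2 chi3 eta1 :: "real^'d \<Rightarrow> 'd tensor"
    and eta0 :: "real^'d \<Rightarrow> complex"
    and w :: "int \<Rightarrow> real^'d \<Rightarrow> complex"
  assumes "CARD('d) \<in> {1, 2, 3}"
    and "\<And>j. 0 < l $ j"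
    and "measure lebesgue (box 0 l) = 1"
    and "admissible_coeff l G"
    and "admissible_coeff l \<rho>"
    and "is_chi1 l G chi1"
    and "is_chi2 l G \<rho> chi1 chi2"
    and "is_chi3 l G \<rho> chi1 chi2 chi3"
    and "is_eta0 l G \<rho> eta0"
    and "is_eta1 l G \<rho> chi1 eta0 eta1"
    and "willis_hierarchy l G \<rho> khat what w"
    and "contract_ik 2 (mu0 l G chi1) khat + mean l \<rho> * what\<^sup>2 \<noteq> 0"
  shows "polynomial_function (\<lambda>(k, \<omega>). impedance_factor l G \<rho> eta0 eta1 k \<omega>) \<and>
    (\<forall>\<epsilon>::real. impedance_factor l G \<rho> eta0 eta1 (\<epsilon> *\<^sub>R khat) (\<epsilon> * what) =
       - 1 - \<epsilon>\<^sup>2 * (contract_ik 2 (eta1_flux l G eta0 eta1) khat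
                      + mean l (\<lambda>x. \<rho> x * eta0 x) * what\<^sup>2)) \<and>
    (\<lambda>\<epsilon>::real. willis_impedance_2 l w \<epsilon>
        - inverse (impedance_factor l G \<rho> eta0 eta1 (\<epsilon> *\<^sub>R khat) (\<epsilon> * what))
          * two_scale_impedance_2 l G \<rho> chi1 chi2 chi3 khat what \<epsilon>)
      \<in> o[at 0](\<lambda>\<epsilon>. complex_of_real (\<epsilon>^4))"
proof -
  note vol = assms(3) and G = assms(4) and \<rho> = assms(5) and hier = assms(11) and \<sigma> = assms(12)
  let ?M = "lebesgue_on (box 0 l)"
  define \<kappa> where "\<kappa> = (\<chi> j. \<i> * complex_of_real (khat $ j))"
  have vol': "measure ?M (box 0 l) = 1"
    using vol by (simp add: measure_restrict_space)
  have mean: "mean l f = (LINT x|?M. f x)" for f :: "real^'d \<Rightarrow> 'b::{banach, second_countable_topology}"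
    using vol by (simp add: mean_def)

  define \<rho>0 where "\<rho>0 = mean l (\<lambda>x. complex_of_real (\<rho> x))"
  have \<rho>0_real: "complex_of_real (mean l \<rho>) = \<rho>0"
    by (simp add: \<rho>0_def mean integral_complex_of_real)
  note chi1 = assms(6)[unfolded is_chi1_def]
    and chi2 = assms(7)[unfolded is_chi2_def of_real_divide of_real_1 \<rho>0_real, folded \<rho>0_def]
    and chi3 = assms(8)[unfolded is_chi3_def of_real_divide of_real_1 \<rho>0_real, folded \<rho>0_def]
    and eta1 = assms(10)[unfolded is_eta1_def of_real_divide of_real_1 \<rho>0_real, folded \<rho>0_def]
  have eta0: "in_H1p l eta0" "mean l eta0 = 0"
    "weak_div_eq l (\<lambda>x j. G x * grad l eta0 x $ j)
       (\<lambda>x. - ((\<rho> x - \<rho>0) / \<rho>0))"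
    using assms(9) by (auto simp: is_eta0_def \<rho>0_real)
  note L2_grad = in_L2_tensor_grad[OF chi1] in_L2_tensor_grad[OF chi2] in_L2_tensor_grad[OF chi3]
    in_L2_tensor_grad[OF eta1] per_pairD(3)[OF per_pair_grad[OF eta0(1)]]
  note L2_sol = in_L2_cell_solution[OF chi1] in_L2_cell_solution[OF chi2] in_L2_cell_solution[OF chi3]
    in_L2_cell_solution[OF eta1] per_pairD(2)[OF per_pair_grad[OF eta0(1)]]
  note L2G = admissible_coeffD(1)[OF G] and L2\<rho> = admissible_coeffD(1)[OF \<rho>]

  define X1 X2 X3 E1 where "X1 x = contract_ik 1 (chi1 x) khat" and "X2 x = contract_ik 2 (chi2 x) khat"
    and "X3 x = contract_ik 3 (chi3 x) khat" and "E1 x = contract_ik 1 (eta1 x) khat" for x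
  define v1 v2 v3 u1 where "v1 = contracted_grad l 1 chi1 khat" and "v2 = contracted_grad l 2 chi2 khat"
    and "v3 = contracted_grad l 3 chi3 khat" and "u1 = contracted_grad l 1 eta1 khat"
  define u0 where "u0 = grad l eta0"
  define m0 where "m0 = contract_ik 2 (mu0 l G chi1) khat"
  note contract = contract_ik_add contract_ik_diff contract_ik_cmult contract_ik_tensor_sym
    contract_ik_tensor_sym' contract_ik_id_row contract_ik_id_prod_row_2 contract_ik_id_prod_row_3
    contracted_grad_row

  have L2_flux1: "in_L2 l (\<lambda>x. G x * (tensor_grad l chi1 x js + id_tensor js))" if "length js = 2" for js
    using that by (intro L2G in_L2_add L2_grad in_L2_const) auto
  have L2_flux3: "in_L2 l (\<lambda>x. G x * (tensor_grad l chi3 x js + tensor_prod 2 id_tensor (chi2 x) js))"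
    if "length js = 4" for js
    using that by (intro L2G in_L2_add L2_grad in_L2_id_prod[of 2] L2_sol) auto
  have L2_eta1: "in_L2 l (\<lambda>x. G x * (tensor_grad l eta1 x js + id_tensor js * eta0 x))"
    if "length js = 2" for js
    using that by (intro L2G in_L2_add L2_grad in_L2_cmult L2_sol) auto

  have flux1: "contract_ik 1 (\<lambda>js. G x * (tensor_grad l chi1 x (j # js) + id_tensor (j # js))) khat =
      shifted_flux G \<kappa> v1 (\<lambda>x. 1) x j" for x j
    by (simp only: contract) (simp add: shifted_flux_def v1_def \<kappa>_def)
  have flux2: "contract_ik 2 (\<lambda>js. G x * (tensor_grad l chi2 x (j # js) +
      tensor_sym' (tensor_prod 2 id_tensor (chi1 x)) (j # js))) khat = shifted_flux G \<kappa> v2 X1 x j" for x j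
    by (simp only: contract) (simp add: shifted_flux_def v2_def \<kappa>_def X1_def)
  have flux3: "contract_ik 3 (\<lambda>js. G x * (tensor_grad l chi3 x (j # js) +
      tensor_prod 2 id_tensor (chi2 x) (j # js))) khat = shifted_flux G \<kappa> v3 X2 x j" for x j
    by (simp only: contract) (simp add: shifted_flux_def v3_def \<kappa>_def X2_def)
  \<comment> \<open>The flux in the problem for \<open>chi3\<close> is symmetrized and the one in
    \<open>mu2\<close> is not; both contract to the same vector flux.\<close>
  have flux3': "contract_ik 3 (\<lambda>js. G x * (tensor_grad l chi3 x (j # js) +
      tensor_sym' (tensor_prod 2 id_tensor (chi2 x)) (j # js))) khat = shifted_flux G \<kappa> v3 X2 x j" for x j
    by (simp only: contract) (simp add: shifted_flux_def v3_def \<kappa>_def X2_def)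
  have flux_eta: "contract_ik 1 (\<lambda>js. G x * (tensor_grad l eta1 x (j # js) + id_tensor (j # js) * eta0 x)) khat =
      shifted_flux G \<kappa> u1 eta0 x j" for x j
    by (simp only: contract contract_ik_multc) (simp add: shifted_flux_def u1_def \<kappa>_def)

  have chi1_eqs: "per_pair l X1 v1" "weak_div_L2 l (shifted_flux G \<kappa> v1 (\<lambda>x. 1)) (\<lambda>x. 0)"
  proof -
    have F: "in_L2 l (\<lambda>x. G x * (tensor_grad l chi1 x (j # js) + id_tensor (j # js)))"
      if "length js = 1" for j js
      using that by (intro L2_flux1) simp
    have src: "contract_ik 1 (\<lambda>js. 0) khat = 0" by (simp add: contract_ik_def)
    note * = cell_solution_contract[OF chi1 vol F in_L2_const, of khat, unfolded flux1 src]
    show "per_pair l X1 v1"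
      using *(1) by (simp add: X1_def[abs_def] v1_def)
    show "weak_div_L2 l (shifted_flux G \<kappa> v1 (\<lambda>x. 1)) (\<lambda>x. 0)"
      using *(3) .
  qed

  \<comment> \<open>The cell has measure 1, so the positive lower bound of \<rho> passes to its
    mean, which is a denominator in the cell problems.\<close>
  have \<rho>_pos: "0 < (LINT x|?M. \<rho> x)"
  proof -
    obtain c where c: "c > 0" "AE x in ?M. c \<le> \<rho> x" using \<rho> by (auto simp: admissible_coeff_def)
    interpret finite_measure ?M by (rule finite_measure_cell)
    have "(LINT x|?M. c) \<le> (LINT x|?M. \<rho> x)"
      using c(2) by (intro integral_mono_AE admissible_coeffD(3)[OF \<rho>]) auto
    then show ?thesis using c(1) vol' by simp
  qed
  have \<rho>0: "\<rho>0 = (LINT x|?M. complex_of_real (\<rho> x))" "\<rho>0 \<noteq> 0"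
    using \<rho>_pos \<rho>0_real by (auto simp: \<rho>0_def mean)

  have grad_row2: "contract_ik 2 (tensor_grad l chi1 x) khat = (\<Sum>j\<in>UNIV. \<kappa> $ j * v1 x $ j)" for x
    by (simp only: contract_ik_2 contract) (simp add: v1_def \<kappa>_def)
  have grad_row3: "contract_ik 3 (tensor_grad l chi2 x) khat = (\<Sum>j\<in>UNIV. \<kappa> $ j * v2 x $ j)" for x
    by (simp only: contract_ik_3 contract) (simp add: v2_def \<kappa>_def)
  have id_2: "contract_ik 2 id_tensor khat = (\<Sum>j\<in>UNIV. \<kappa> $ j * \<kappa> $ j)"
    by (simp only: contract_ik_2 contract) (simp add: \<kappa>_def)
  have id_prod_3: "contract_ik 3 (tensor_prod 2 id_tensor T) khat =
      (\<Sum>j\<in>UNIV. \<kappa> $ j * \<kappa> $ j) * contract_ik 1 T khat" for T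
    using contract_ik_tensor_prod[of 2 1 id_tensor T khat] unfolding id_2 by simp
  have prod_3: "contract_ik 3 (tensor_prod 1 S T) khat = contract_ik 1 S khat * contract_ik 2 T khat" for S T
    using contract_ik_tensor_prod[of 1 2 S T khat] by (simp add: numeral_3_eq_3)
  \<comment> \<open>Separating gradient and identity parts gives the shape in which the contracted
    sources of the cell problems appear.\<close>
  have along: "flux_along G \<kappa> v r x =
      G x * ((\<Sum>j\<in>UNIV. \<kappa> $ j * v x $ j) + (\<Sum>j\<in>UNIV. \<kappa> $ j * \<kappa> $ j) * r x)" for v r x
    by (simp add: flux_along_def shifted_flux_def distrib_left sum.distrib sum_distrib_left sum_distrib_right mult_ac)

  have chi2_eqs: "per_pair l X2 v2" "(LINT x|?M. X2 x) = 0"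
    "weak_div_L2 l (shifted_flux G \<kappa> v2 X1)
      (\<lambda>x. flux_along G \<kappa> v1 (\<lambda>x. 1) x - complex_of_real (\<rho> x) * (m0 / \<rho>0))"
  proof -
    have F: "in_L2 l (\<lambda>x. G x * (tensor_grad l chi2 x (j # js) +
        tensor_sym' (tensor_prod 2 id_tensor (chi1 x)) (j # js)))" if "length js = 2" for j js
      using that by (intro L2G in_L2_add L2_grad in_L2_tensor_sym' in_L2_id_prod[of 1] L2_sol) auto
    have f: "in_L2 l (\<lambda>x. G x * (tensor_sym (tensor_grad l chi1 x) js + id_tensor js) -
        \<rho> x / \<rho>0 * mu0 l G chi1 js)" if "length js = 2" for js
    proof -
      have "in_L2 l (\<lambda>x. G x * (tensor_sym (tensor_grad l chi1 x) js + id_tensor js) -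
          \<rho> x * (mu0 l G chi1 js / \<rho>0))"
        using that by (intro in_L2_diff L2G L2\<rho> in_L2_add in_L2_tensor_sym L2_grad in_L2_const) auto
      then show ?thesis by simp
    qed
    have src: "contract_ik 2 (\<lambda>js. G x * (tensor_sym (tensor_grad l chi1 x) js + id_tensor js) -
        \<rho> x / \<rho>0 * mu0 l G chi1 js) khat =
        flux_along G \<kappa> v1 (\<lambda>x. 1) x - complex_of_real (\<rho> x) * (m0 / \<rho>0)" for x
      by (simp only: contract grad_row2 id_2 along) (simp add: m0_def)
    note * = cell_solution_contract[OF chi2 vol F f, of khat, unfolded flux2 src]
    show "per_pair l X2 v2" "(LINT x|?M. X2 x) = 0"
      using *(1,2) by (simp_all add: X2_def[abs_def] v2_def)
    show "weak_div_L2 l (shifted_flux G \<kappa> v2 X1)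
      (\<lambda>x. flux_along G \<kappa> v1 (\<lambda>x. 1) x - complex_of_real (\<rho> x) * (m0 / \<rho>0))"
      using *(3) .
  qed

  have chi3_eqs: "per_pair l X3 v3"
    "weak_div_L2 l (shifted_flux G \<kappa> v3 X2)
      (\<lambda>x. flux_along G \<kappa> v2 X1 x - complex_of_real (\<rho> x) * X1 x * (m0 / \<rho>0))"
  proof -
    have F: "in_L2 l (\<lambda>x. G x * (tensor_grad l chi3 x (j # js) +
        tensor_sym' (tensor_prod 2 id_tensor (chi2 x)) (j # js)))" if "length js = 3" for j js
      using that by (intro L2G in_L2_add L2_grad in_L2_tensor_sym' in_L2_id_prod[of 2] L2_sol) auto
    have \<rho>chi: "in_L2 l (\<lambda>x. tensor_prod 1 (\<lambda>is. \<rho> x * chi1 x is) (mu0 l G chi1) js)"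
      if "length js = 3" for js
    proof -
      have "in_L2 l (\<lambda>x. mu0 l G chi1 (drop 1 js) * (\<rho> x * chi1 x (take 1 js)))"
        using that by (intro in_L2_cmult L2\<rho> L2_sol) auto
      then show ?thesis by (simp add: tensor_prod_def mult.commute)
    qed
    have f: "in_L2 l (\<lambda>x. G x * (tensor_sym (tensor_grad l chi2 x) js + tensor_sym (tensor_prod 2 id_tensor (chi1 x)) js)
        - 1 / \<rho>0 * tensor_sym (tensor_prod 1 (\<lambda>is. \<rho> x * chi1 x is) (mu0 l G chi1)) js)"
      if "length js = 3" for js
      using that by (intro in_L2_diff L2G in_L2_add in_L2_cmult in_L2_tensor_sym L2_grad
          in_L2_id_prod[of 1] L2_sol \<rho>chi) auto
    have src: "contract_ik 3 (\<lambda>js. G x * (tensor_sym (tensor_grad l chi2 x) js + tensor_sym (tensor_prod 2 id_tensor (chi1 x)) js)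
        - 1 / \<rho>0 * tensor_sym (tensor_prod 1 (\<lambda>is. \<rho> x * chi1 x is) (mu0 l G chi1)) js) khat =
        flux_along G \<kappa> v2 X1 x - complex_of_real (\<rho> x) * X1 x * (m0 / \<rho>0)" for x
      by (simp only: contract grad_row3 id_prod_3 prod_3 along) (simp add: m0_def X1_def)
    note * = cell_solution_contract[OF chi3 vol F f, of khat, unfolded flux3' src]
    show "per_pair l X3 v3"
      using *(1) by (simp add: X3_def[abs_def] v3_def)
    show "weak_div_L2 l (shifted_flux G \<kappa> v3 X2)
      (\<lambda>x. flux_along G \<kappa> v2 X1 x - complex_of_real (\<rho> x) * X1 x * (m0 / \<rho>0))"
      using *(3) .
  qed

  have eta0_eqs: "per_pair l eta0 u0" "(LINT x|?M. eta0 x) = 0"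
    "weak_div_L2 l (shifted_flux G \<kappa> u0 (\<lambda>x. 0)) (\<lambda>x. 1 - complex_of_real (\<rho> x) / \<rho>0)"
  proof -
    show "per_pair l eta0 u0" unfolding u0_def by (rule per_pair_grad[OF eta0(1)])
    show "(LINT x|?M. eta0 x) = 0" using eta0(2) by (simp add: mean)
    have "- ((complex_of_real (\<rho> x) - \<rho>0) / \<rho>0) = 1 - complex_of_real (\<rho> x) / \<rho>0" for x
      using \<rho>0(2) by (simp add: field_simps)
    then have "weak_div_eq l (shifted_flux G \<kappa> u0 (\<lambda>x. 0)) (\<lambda>x. 1 - complex_of_real (\<rho> x) / \<rho>0)"
      using eta0(3) by (simp add: shifted_flux_def[abs_def] u0_def)
    moreover have "in_L2 l (\<lambda>x. 1 - complex_of_real (\<rho> x) * (1 / \<rho>0))"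
      by (intro in_L2_diff L2\<rho> in_L2_const)
    ultimately show "weak_div_L2 l (shifted_flux G \<kappa> u0 (\<lambda>x. 0)) (\<lambda>x. 1 - complex_of_real (\<rho> x) / \<rho>0)"
      using in_L2_flux(1)[OF G L2_grad(5)[folded u0_def] in_L2_const]
      by (simp add: weak_div_L2_def)
  qed

  have eta1_eqs: "per_pair l E1 u1"
    "weak_div_L2 l (shifted_flux G \<kappa> u1 eta0)
      (\<lambda>x. flux_along G \<kappa> u0 (\<lambda>x. 0) x - complex_of_real (\<rho> x) * X1 x / \<rho>0)"
  proof -
    have F: "in_L2 l (\<lambda>x. G x * (tensor_grad l eta1 x (j # js) + id_tensor (j # js) * eta0 x))"
      if "length js = 1" for j js
      using that by (intro L2_eta1) simp
    have f: "in_L2 l (\<lambda>x. G x * grad l eta0 x $ hd js - \<rho> x * chi1 x js / \<rho>0)" if "length js = 1" for js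
    proof -
      have "in_L2 l (\<lambda>x. G x * grad l eta0 x $ hd js - 1 / \<rho>0 * (\<rho> x * chi1 x js))"
        using that by (intro in_L2_diff in_L2_cmult L2G L2\<rho> L2_grad L2_sol)
      then show ?thesis by simp
    qed
    have src: "contract_ik 1 (\<lambda>js. G x * grad l eta0 x $ hd js - \<rho> x * chi1 x js / \<rho>0) khat =
        flux_along G \<kappa> u0 (\<lambda>x. 0) x - complex_of_real (\<rho> x) * X1 x / \<rho>0" for x
      by (simp add: contract_ik_1[unfolded One_nat_def] X1_def flux_along_def shifted_flux_def u0_def \<kappa>_def right_diff_distrib sum_subtractf
          sum_distrib_left sum_divide_distrib mult_ac)
    note * = cell_solution_contract[OF eta1 vol F f, of khat, unfolded flux_eta src]
    show "per_pair l E1 u1"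
      using *(1) by (simp add: E1_def[abs_def] u1_def)
    show "weak_div_L2 l (shifted_flux G \<kappa> u1 eta0)
      (\<lambda>x. flux_along G \<kappa> u0 (\<lambda>x. 0) x - complex_of_real (\<rho> x) * X1 x / \<rho>0)"
      using *(3) .
  qed

  define I where "I f = (LINT x|?M. f x)" for f :: "real^'d \<Rightarrow> complex"
  \<comment> \<open>The contracted coefficients are rewritten as means of contracted fluxes, the
    form in which they arise from the solvability conditions.\<close>
  have m0: "m0 = I (flux_along G \<kappa> v1 (\<lambda>x. 1))"
  proof -
    have "m0 = contract_ik 2 (\<lambda>js. LINT x|?M. G x * (tensor_grad l chi1 x js + id_tensor js)) khat"
      by (simp add: m0_def mu0_def contract_ik_tensor_sym mean)
    also have "\<dots> = (LINT x|?M. contract_ik 2 (\<lambda>js. G x * (tensor_grad l chi1 x js + id_tensor js)) khat)"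
      by (rule integral_contract_ik[symmetric]) (rule L2_flux1)
    finally show ?thesis
      unfolding contract_ik_2 flux1 by (simp add: I_def flux_along_def[abs_def] \<kappa>_def)
  qed
  have mu2: "contract_ik 4 (mu2 l G chi2 chi3) khat = I (flux_along G \<kappa> v3 X2)"
  proof -
    have "contract_ik 4 (mu2 l G chi2 chi3) khat =
        contract_ik 4 (\<lambda>js. LINT x|?M. G x * (tensor_grad l chi3 x js + tensor_prod 2 id_tensor (chi2 x) js)) khat"
      by (simp add: mu2_def contract_ik_tensor_sym mean)
    also have "\<dots> = (LINT x|?M. contract_ik 4
        (\<lambda>js. G x * (tensor_grad l chi3 x js + tensor_prod 2 id_tensor (chi2 x) js)) khat)"
      by (rule integral_contract_ik[symmetric]) (rule L2_flux3)
    finally show ?thesis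
      unfolding contract_ik_4 flux3 by (simp add: I_def flux_along_def[abs_def] \<kappa>_def)
  qed
  have eta_flux: "contract_ik 2 (eta1_flux l G eta0 eta1) khat = I (flux_along G \<kappa> u1 eta0)"
  proof -
    have "contract_ik 2 (eta1_flux l G eta0 eta1) khat =
        contract_ik 2 (\<lambda>js. LINT x|?M. G x * (tensor_grad l eta1 x js + id_tensor js * eta0 x)) khat"
      by (simp add: eta1_flux_def[abs_def] mean)
    also have "\<dots> = (LINT x|?M. contract_ik 2
        (\<lambda>js. G x * (tensor_grad l eta1 x js + id_tensor js * eta0 x)) khat)"
      by (rule integral_contract_ik[symmetric]) (rule L2_eta1)
    finally show ?thesis
      unfolding contract_ik_2 flux_eta by (simp add: I_def flux_along_def[abs_def] \<kappa>_def)
  qed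
  have rho2: "contract_ik 2 (rho2 l \<rho> chi2) khat = I (\<lambda>x. \<rho> x * X2 x)"
  proof -
    have "contract_ik 2 (rho2 l \<rho> chi2) khat = contract_ik 2 (\<lambda>js. LINT x|?M. \<rho> x * chi2 x js) khat"
      by (simp add: rho2_def[abs_def] mean)
    also have "\<dots> = (LINT x|?M. contract_ik 2 (\<lambda>js. \<rho> x * chi2 x js) khat)"
      by (rule integral_contract_ik[symmetric]) (intro L2\<rho> L2_sol)
    finally show ?thesis by (simp add: I_def X2_def contract_ik_cmult)
  qed

  define \<omega>2 where "\<omega>2 = complex_of_real what ^ 2"
  have zero: "w (-1) = (\<lambda>x. 0)" "w (-2) = (\<lambda>x. 0)" using hier by (auto simp: willis_hierarchy_def)
  have w_pair: "per_pair l (w m) (grad l (w m))" if "m \<in> {0..4}" for m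
    using hier that by (auto simp: willis_hierarchy_def intro: per_pair_grad)
  note W = willis_hierarchy_weak_div[OF hier G \<rho>, folded \<kappa>_def \<omega>2_def]
  have W0: "weak_div_L2 l (shifted_flux G \<kappa> (grad l (w 0)) (\<lambda>x. 0)) (\<lambda>x. 0)"
  proof (rule weak_div_L2_cong_AE[OF W[of 0]])
    show "AE x in ?M. shifted_flux G \<kappa> (grad l (w 0)) (w (0 - 1)) x = shifted_flux G \<kappa> (grad l (w 0)) (\<lambda>x. 0) x"
      using zero by simp
    \<comment> \<open>\<open>grad\<close> of the zero field is a choice that vanishes only almost
      everywhere, so the source of order 0 is replaced by 0 up to a null set.\<close>
    show "AE x in ?M. flux_along G \<kappa> (grad l (w (0 - 1))) (w (0 - 2)) x + \<omega>2 * \<rho> x * w (0 - 2) x +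
        (if (0::int) = 2 then 1 else 0) = 0"
      using in_H1p_const(2)[of l 0] by eventually_elim (simp add: zero along)
    show "in_L2 l (\<lambda>x. shifted_flux G \<kappa> (grad l (w 0)) (\<lambda>x. 0) x j)" for j
      by (intro in_L2_flux(1) G per_pairD(3)[OF w_pair] in_L2_const) simp
  qed (auto intro: in_L2_const)
  have hier_eqs: "weak_div_L2 l (shifted_flux G \<kappa> (grad l (w 1)) (w 0)) (\<lambda>x. flux_along G \<kappa> (grad l (w 0)) (\<lambda>x. 0) x)"
    "weak_div_L2 l (shifted_flux G \<kappa> (grad l (w 2)) (w 1))
      (\<lambda>x. flux_along G \<kappa> (grad l (w 1)) (w 0) x + \<omega>2 * \<rho> x * w 0 x + 1)"
    "weak_div_L2 l (shifted_flux G \<kappa> (grad l (w 3)) (w 2))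
      (\<lambda>x. flux_along G \<kappa> (grad l (w 2)) (w 1) x + \<omega>2 * \<rho> x * w 1 x)"
    "weak_div_L2 l (shifted_flux G \<kappa> (grad l (w 4)) (w 3))
      (\<lambda>x. flux_along G \<kappa> (grad l (w 3)) (w 2) x + \<omega>2 * \<rho> x * w 2 x)"
    using W[of 1] W[of 2] W[of 3] W[of 4] by (simp_all add: zero)
  have \<sigma>0: "m0 + \<rho>0 * \<omega>2 \<noteq> 0"
    using \<sigma> by (simp add: m0_def \<rho>0_def \<rho>0_real \<omega>2_def)
  note means = hierarchy_means[OF vol' G \<rho> chi1_eqs(1) chi2_eqs(1) chi3_eqs(1) eta0_eqs(1) eta1_eqs(1)
      w_pair[of 0] w_pair[of 1] w_pair[of 2] w_pair[of 3] chi2_eqs(2) eta0_eqs(2)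
      chi1_eqs(2) chi2_eqs(3) chi3_eqs(2) eta0_eqs(3) eta1_eqs(2) W0 hier_eqs m0[unfolded I_def] \<rho>0 \<sigma>0,
      simplified, folded I_def]

  define A where "A = contract_ik 4 (mu2 l G chi2 chi3) khat + contract_ik 2 (rho2 l \<rho> chi2) khat * \<omega>2"
  define B where "B = contract_ik 2 (eta1_flux l G eta0 eta1) khat + mean l (\<lambda>x. \<rho> x * eta0 x) * \<omega>2"
  have c0: "I (w 0) * (m0 + \<rho>0 * \<omega>2) = - 1" by (rule means)
  have c2: "I (w 2) * (m0 + \<rho>0 * \<omega>2) = - (I (w 0) * A + B)"
    using means(2) by (simp add: A_def B_def mu2 rho2 eta_flux mean I_def mult.commute)
  have factor: "impedance_factor l G \<rho> eta0 eta1 (\<epsilon> *\<^sub>R khat) (\<epsilon> * what) = - 1 - of_real \<epsilon> ^ 2 * B" for \<epsilon>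
    by (simp add: impedance_factor_def B_def contract_ik_scaleR \<omega>2_def power_mult_distrib algebra_simps)
  have willis: "willis_impedance_2 l w \<epsilon> = of_real \<epsilon> ^ 2 / (I (w 0) + of_real \<epsilon> ^ 2 * I (w 2))" for \<epsilon>
    by (simp add: willis_impedance_2_def mean I_def)
  have two_scale: "two_scale_impedance_2 l G \<rho> chi1 chi2 chi3 khat what \<epsilon> =
      of_real \<epsilon> ^ 2 * (m0 + \<rho>0 * \<omega>2) + of_real \<epsilon> ^ 4 * A" for \<epsilon>
    by (simp add: two_scale_impedance_2_def m0_def \<rho>0_def \<rho>0_real \<omega>2_def A_def)
  show ?thesis
  proof (intro conjI allI)
    have "polynomial_function (\<lambda>z::(real^'d) \<times> real. snd z * snd z)"
      using polynomial_function_mult[OF polynomial_function_bounded_linear[OF bounded_linear_snd]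
          polynomial_function_bounded_linear[OF bounded_linear_snd]] by simp
    then have "polynomial_function (\<lambda>z::(real^'d) \<times> real. - 1 - ((case z of (k, \<omega>) \<Rightarrow> contract_ik 2 (eta1_flux l G eta0 eta1) k)
        + (snd z * snd z) *\<^sub>R mean l (\<lambda>x. \<rho> x * eta0 x)))"
      by (intro polynomial_function_diff polynomial_function_add polynomial_function_mult
          polynomial_function_const contract_ik_polynomial)
    also have "(\<lambda>z::(real^'d) \<times> real. - 1 - ((case z of (k, \<omega>) \<Rightarrow> contract_ik 2 (eta1_flux l G eta0 eta1) k)
        + (snd z * snd z) *\<^sub>R mean l (\<lambda>x. \<rho> x * eta0 x))) = (\<lambda>(k, \<omega>). impedance_factor l G \<rho> eta0 eta1 k \<omega>)"
      by (auto simp: impedance_factor_def fun_eq_iff scaleR_conv_of_real power2_eq_square)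
    finally show "polynomial_function (\<lambda>(k, \<omega>). impedance_factor l G \<rho> eta0 eta1 k \<omega>)" .
    show "impedance_factor l G \<rho> eta0 eta1 (\<epsilon> *\<^sub>R khat) (\<epsilon> * what) =
       - 1 - \<epsilon>\<^sup>2 * (contract_ik 2 (eta1_flux l G eta0 eta1) khat
                      + mean l (\<lambda>x. \<rho> x * eta0 x) * what\<^sup>2)" for \<epsilon> :: real
      unfolding factor by (simp add: B_def \<omega>2_def)
    show "(\<lambda>\<epsilon>::real. willis_impedance_2 l w \<epsilon>
        - inverse (impedance_factor l G \<rho> eta0 eta1 (\<epsilon> *\<^sub>R khat) (\<epsilon> * what))
          * two_scale_impedance_2 l G \<rho> chi1 chi2 chi3 khat what \<epsilon>)
      \<in> o[at 0](\<lambda>\<epsilon>. complex_of_real (\<epsilon>^4))"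
      unfolding factor willis two_scale using c0 c2 by (rule impedance_ratio_smallo)
  qed
qed

end
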